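(* The only value of the real parameter $\lambda$ for which the Hausdorff $2$-area integrand $\phi_\lambda$ of the projective Finsler metric $$\varphi_\lambda(\mathbf{x},\mathbf{v}) = \frac{(1+\lambda^2\|\mathbf{x}\|^2)\|\mathbf{v}\|^2+\lambda^2\langle \mathbf{x},\mathbf{v}\rangle^2}{\|\mathbf{v}\|}$$ on $\mathbb{R}^3$ admits a Crofton formula is $\lambda=0$.
   Context: $\mathbb{R}^3$ carries its standard inner product $\langle\cdot,\cdot\rangle$ and norm $\|\cdot\|$; $T\mathbb{R}^3$ is identified with $\mathbb{R}^3\times\mathbb{R}^3\ni(\mathbf{x},\mathbf{v})$. A Minkowski norm on a finite-dimensional real vector space is a norm that is smooth away from the origin and such that the Hessian of its square is positive definite at every nonzero point. A Finsler metric on a manifold is a continuous function on the tangent bundle, smooth away from the zero section, whose restriction to each tangent space is a Minkowski norm. A Finsler metric on $\mathbb{R}^n$ is projective if its geodesics are straight lines; each $\varphi_\lambda$ is a projective Finsler metric. Hausdorff $2$-area integrand of a Finsler metric $\varphi$ on $\mathbb{R}^3$: for $\mathbf{x}\in\mathbb{R}^3$ and a nonzero bivector $\mathbf{a}=\mathbf{v}_1\wedge\mathbf{v}_2\in\Lambda^2\mathbb{R}^3$, let $B_{\mathbf{x}}=\{\mathbf{v}:\varphi(\mathbf{x},\mathbf{v})\le1\}$ and let $\langle\mathbf{a}\rangle$ be the plane spanned by $\mathbf{v}_1,\mathbf{v}_2$. Then $\phi(\mathbf{x},\mathbf{a})=\pi/\mathrm{vol}(B_{\mathbf{x}}\cap\langle\mathbf{a}\rangle;\mathbf{a})$,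 where $\mathrm{vol}(\cdot\,;\mathbf{a})$ is the Lebesgue measure on $\langle\mathbf{a}\rangle$ for which the parallelogram spanned by $\mathbf{v}_1,\mathbf{v}_2$ has measure $1$; $\phi_\lambda$ denotes the integrand of $\varphi_\lambda$. For a surface $N$, $\int_N\phi$ is computed in local parametrizations $\mathbf{r}(s,t)$ as $\int\phi(\mathbf{r},\partial_s\mathbf{r}\wedge\partial_t\mathbf{r})\,ds\,dt$. Such an integrand $\phi$ admits a Crofton formula if there exists a smooth (possibly signed) measure $\mu$ on the manifold $\mathrm{Geod}(\mathbb{R}^3)$ of oriented lines in $\mathbb{R}^3$ such that for any hypersurface $N\subset\mathbb{R}^3$, $$\int_N\phi=\int_{\ell\in\mathrm{Geod}(\mathbb{R}^3)}\#(\ell\cap N)\,d\mu.$$ *)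

theory Defs
  imports "HOL-Analysis.Analysis"
begin

text \<open>For open \<open>S\<close> in a Euclidean space, \<open>Ck_on k S f\<close> is the usual \<open>C^k\<close> condition: all iterated
  directional derivatives up to order \<open>k\<close> exist on \<open>S\<close> and are continuous there.\<close>

primrec Ck_on :: "nat \<Rightarrow> 'a::euclidean_space set \<Rightarrow> ('a \<Rightarrow> 'b::euclidean_space) \<Rightarrow> bool" where
  "Ck_on 0 S f \<longleftrightarrow> continuous_on S f"
| "Ck_on (Suc k) S f \<longleftrightarrow>
     (\<forall>x\<in>S. f differentiable at x) \<and> (\<forall>v. Ck_on k S (\<lambda>x. frechet_derivative f (at x) v))"

definition smooth_on :: "'a::euclidean_space set \<Rightarrow> ('a \<Rightarrow> 'b::euclidean_space) \<Rightarrow> bool" where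
  "smooth_on S f \<longleftrightarrow> (\<forall>k. Ck_on k S f)"

definition local_parametrization ::
    "(real^3) set \<Rightarrow> (real \<times> real) set \<Rightarrow> (real \<times> real \<Rightarrow> real^3) \<Rightarrow> bool" where
  "local_parametrization N U r \<longleftrightarrow>
     open U \<and> smooth_on U r \<and> (\<forall>w\<in>U. inj (frechet_derivative r (at w))) \<and>
     openin (top_of_set N) (r ` U) \<and> (\<exists>g. homeomorphism U (r ` U) r g)"

text \<open>Hypersurfaces are smooth embedded surfaces without boundary, not required to be closed
  subsets, connected or of finite area.\<close>

definition embedded_surface :: "(real^3) set \<Rightarrow> bool" where
  "embedded_surface N \<longleftrightarrow> (\<forall>p\<in>N. \<exists>U r. local_parametrization N U r \<and> p \<in> r ` U)"

definition surface_atlas ::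
    "(real^3) set \<Rightarrow> (nat \<Rightarrow> (real \<times> real) set) \<Rightarrow> (nat \<Rightarrow> real \<times> real \<Rightarrow> real^3) \<Rightarrow> bool" where
  "surface_atlas N U r \<longleftrightarrow>
     (\<forall>i. local_parametrization N (U i) (r i)) \<and> N = (\<Union>i. r i ` U i)"

text \<open>Chart domains may be empty, so finite atlases are included.\<close>

lemma embedded_surface_iff_atlas:
  "embedded_surface N \<longleftrightarrow> (\<exists>U r. surface_atlas N U r)"
proof
  assume N: "embedded_surface N"
  define F where "F = {V. \<exists>U r. local_parametrization N U r \<and> V = r ` U}"
  have op: "\<And>V. V \<in> F \<Longrightarrow> openin (top_of_set N) V"
    unfolding F_def local_parametrization_def by blast
  then obtain F' where F': "F' \<subseteq> F" "countable F'" "\<Union>F' = \<Union>F"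
    using Lindelof_openin by metis
  have sub: "\<Union>F \<subseteq> N"
    using op openin_imp_subset by blast
  have sup: "N \<subseteq> \<Union>F"
    using N unfolding embedded_surface_def F_def by blast
  have smooth_empty: "Ck_on k {} f" for k and f :: "real \<times> real \<Rightarrow> real^3"
    by (induction k arbitrary: f) simp_all
  have "local_parametrization N {} (\<lambda>_. 0)"
    by (simp add: local_parametrization_def smooth_on_def smooth_empty homeomorphism_def)
  then have "{} \<in> F"
    unfolding F_def by blast
  define G where "G = insert {} F'"
  have G: "G \<subseteq> F" "countable G" "G \<noteq> {}" "\<Union>G = N"
    unfolding G_def using F' sub sup \<open>{} \<in> F\<close> by simp_all
  have "\<forall>i. \<exists>U r. local_parametrization N U r \<and> from_nat_into G i = r ` U"
  proof
    fix i
    have "from_nat_into G i \<in> F"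
      using G(1) from_nat_into[OF G(3)] by blast
    then show "\<exists>U r. local_parametrization N U r \<and> from_nat_into G i = r ` U"
      by (simp add: F_def)
  qed
  then obtain U r where "\<And>i. local_parametrization N (U i) (r i)"
      "\<And>i. from_nat_into G i = r i ` U i"
    by metis
  moreover have "(\<Union>i. from_nat_into G i) = N"
    using G(4) range_from_nat_into[OF G(3,2)] by simp
  ultimately show "\<exists>U r. surface_atlas N U r"
    unfolding surface_atlas_def by (intro exI[of _ U] exI[of _ r]) simp
next
  assume "\<exists>U r. surface_atlas N U r"
  then show "embedded_surface N"
    unfolding surface_atlas_def embedded_surface_def by blast
qed

text \<open>A (nonnegative) \<open>2\<close>-area integrand is a function \<open>\<Phi> x v1 v2\<close>, standing for its value at the
  point \<open>x\<close> and the bivector \<open>v1 \<and> v2\<close>; only linearly independent \<open>v1\<close>, \<open>v2\<close> matter.\<close>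

type_synonym area_integrand = "real^3 \<Rightarrow> real^3 \<Rightarrow> real^3 \<Rightarrow> real"

text \<open>Lebesgue measure on the plane spanned by \<open>v1\<close>, \<open>v2\<close>, normalized so that the parallelogram
  they span has measure \<open>1\<close>.\<close>

definition plane_measure :: "real^3 \<Rightarrow> real^3 \<Rightarrow> (real^3) measure" where
  "plane_measure v1 v2 = distr lborel borel (\<lambda>(s::real, t::real). s *\<^sub>R v1 + t *\<^sub>R v2)"

definition hausdorff_area_integrand :: "(real^3 \<Rightarrow> real^3 \<Rightarrow> real) \<Rightarrow> area_integrand" where
  "hausdorff_area_integrand \<phi> x v1 v2 =
     pi / measure (plane_measure v1 v2) ({v. \<phi> x v \<le> 1} \<inter> span {v1, v2})"

text \<open>Points covered by several charts are counted only in the first one. By the change of variables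
  formula the value \<open>I\<close> does not depend on the atlas, and it exists for every embedded surface by
  the lemma above.\<close>

definition has_surface_integral :: "area_integrand \<Rightarrow> (real^3) set \<Rightarrow> ennreal \<Rightarrow> bool" where
  "has_surface_integral \<Phi> N I \<longleftrightarrow>
     (\<exists>U r. surface_atlas N U r \<and>
        I = (\<Sum>i. \<integral>\<^sup>+ w \<in> U i - r i -` (\<Union>j<i. r j ` U j).
               ennreal (\<Phi> (r i w)
                          (frechet_derivative (r i) (at w) (1, 0))
                          (frechet_derivative (r i) (at w) (0, 1))) \<partial>lborel))"

text \<open>The oriented line \<open>{p + t u}\<close> with unit direction \<open>u\<close> is represented by the pair \<open>(u, p)\<close>
  where \<open>p\<close> is its point closest to the origin, which identifies the manifold of oriented lines
  with the tangent bundle of the unit sphere.\<close>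

definition oriented_lines :: "((real^3) \<times> (real^3)) set" where
  "oriented_lines = {(u, p). norm u = 1 \<and> u \<bullet> p = 0}"

definition line_points :: "(real^3) \<times> (real^3) \<Rightarrow> (real^3) set" where
  "line_points l = range (\<lambda>t. snd l + t *\<^sub>R fst l)"

text \<open>The invariant measure \<open>d\<sigma>(u) dp\<close>, with \<open>\<sigma>\<close> the area of the unit sphere and \<open>dp\<close> the
  two-dimensional Lebesgue measure on the orthogonal complement of \<open>u\<close>. Here \<open>\<sigma>(A)\<close> is \<open>3\<close> times the
  volume of the cone over \<open>A\<close> inside the unit ball, and the area of \<open>B\<close> in the complement of \<open>u\<close> is the
  volume of the cylinder of height \<open>1\<close> over \<open>B\<close>.\<close>

definition line_measure :: "((real^3) \<times> (real^3)) measure" where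
  "line_measure = scale_measure 3
     (distr (restrict_space lborel {(x, y). norm x \<le> 1 \<and> 0 \<le> y \<bullet> sgn x \<and> y \<bullet> sgn x \<le> 1}) borel
       (\<lambda>(x, y). (sgn x, y - (y \<bullet> sgn x) *\<^sub>R sgn x)))"

text \<open>As \<open>line_measure\<close> is given by a smooth nowhere vanishing density, the smooth signed measures on
  the manifold of oriented lines are exactly \<open>f \<cdot> line_measure\<close> with \<open>f\<close> a smooth function on this
  manifold. As usual for subsets of a Euclidean space, smoothness means smooth extendability
  to a neighbourhood.\<close>

definition smooth_line_density :: "((real^3) \<times> (real^3) \<Rightarrow> real) \<Rightarrow> bool" where
  "smooth_line_density f \<longleftrightarrow> (\<exists>W. open W \<and> oriented_lines \<subseteq> W \<and> smooth_on W f)"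

definition crossing_number :: "(real^3) \<times> (real^3) \<Rightarrow> (real^3) set \<Rightarrow> ennreal" where
  "crossing_number l N = emeasure (count_space UNIV) (line_points l \<inter> N)"

text \<open>The integral of the crossing number against the positive part of \<open>f \<cdot> line_measure\<close>
  (\<open>ennreal\<close> sends negative reals to \<open>0\<close>); the negative part is obtained from \<open>- f\<close>.\<close>

definition crossing_integral_pos :: "((real^3) \<times> (real^3) \<Rightarrow> real) \<Rightarrow> (real^3) set \<Rightarrow> ennreal" where
  "crossing_integral_pos f N =
     (\<integral>\<^sup>+ l \<in> oriented_lines. (ennreal (f l) * crossing_number l N) \<partial>line_measure)"

text \<open>The formula is required for every hypersurface \<open>N\<close> for which the integral of the crossing
  number against the signed measure exists in the usual extended sense, that is, unless its positive
  and negative parts are both infinite. For \<open>N\<close> bounded and of finite area both parts are finite, and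
  for a nonnegative measure the integral always exists.\<close>

definition admits_crofton_formula :: "area_integrand \<Rightarrow> bool" where
  "admits_crofton_formula \<Phi> \<longleftrightarrow>
     (\<exists>f. smooth_line_density f \<and>
       (\<forall>N I. embedded_surface N \<and> has_surface_integral \<Phi> N I \<and>
          (crossing_integral_pos f N < \<infinity> \<or> crossing_integral_pos (\<lambda>l. - f l) N < \<infinity>) \<longrightarrow>
          enn2ereal I =
            enn2ereal (crossing_integral_pos f N) -
            enn2ereal (crossing_integral_pos (\<lambda>l. - f l) N)))"

text \<open>For \<open>v = 0\<close> division by zero yields the correct value \<open>0\<close>.\<close>

definition phi_metric :: "real \<Rightarrow> real^3 \<Rightarrow> real^3 \<Rightarrow> real" where
  "phi_metric a x v =
     ((1 + a\<^sup>2 * (norm x)\<^sup>2) * (norm v)\<^sup>2 + a\<^sup>2 * (x \<bullet> v)\<^sup>2) / norm v"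

end

theory Submission
  imports Defs "HOL-Real_Asymp.Real_Asymp"
begin

text \<open>For \<open>a = 0\<close> the integrand is the Euclidean area and the formula is the classical one of Cauchy and
  Crofton: for a fixed direction the area formula for the projection along it integrates the crossing
  number to the integral of \<open>\<bar>u \<bullet> n\<bar>\<close> over the surface, and averaging over all directions
  gives a multiple of the area.

  For \<open>a \<noteq> 0\<close> apply a hypothetical Crofton formula to spheres about the origin and to unit discs through
  the origin. For every single line, the number of crossings with a disc, averaged over the normal of the disc, is
  a fixed multiple of the number of crossings with the sphere of radius \<open>1 / sqrt (1 + t\<^sup>2)\<close>, averaged
  over \<open>t\<close> with weight \<open>1 / (1 + t\<^sup>2)\<close>; both averages depend only on the distance of the line from the origin.
  By Tonelli the same holds for the surface integrals, whatever the density is. On spheres the integrand is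
  \<open>(1 + a\<^sup>2 R\<^sup>2)\<^sup>2\<close> times the area, which forces the disc to have the integral of
  \<open>1 + 3 s + 15/8 s\<^sup>2\<close>, \<open>s = a\<^sup>2 \<rho>\<^sup>2\<close>. But the actual integrand
  \<open>2 ((1 + s) (1 + 2 s))\<^bsup>3/2\<^esup> / (2 + 3 s)\<close> is strictly larger.\<close>

section \<open>Smoothness of rational maps\<close>

text \<open>The weight \<open>1 / (1 + t^2)\<close> is a Cauchy density: \<open>t\<close> is the
  quotient of two orthogonal coordinates of the normal of the disc, and a line transversal to the
  disc crosses it exactly when it enters the sphere of radius \<open>1 / sqrt (1 + t^2)\<close>. The
  coefficients \<open>3\<close> and \<open>15/8\<close> come from the integrals of the second, third
  and fourth powers of this density, which are in the ratio 1 : 3/4 : 5/8. The actual disc integrand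
  agrees with the resulting polynomial up to order \<open>s^3\<close>; the gap opens only at order
  \<open>s^4\<close>.

  The density may change sign, so Tonelli is applied to its positive and negative parts separately,
  and the negative contribution has to be cancelled at the end. It must therefore be finite. This is
  why all test surfaces lie in the unit ball: the lines meeting the ball form a compact set, the
  density is bounded on it, and the Euclidean Crofton formula bounds both parts by a multiple of the
  Euclidean area. The case \<open>a = 0\<close> is thus an ingredient of the case
  \<open>a \<noteq> 0\<close>.

  Counting crossings involves projections of sets, under which Borel sets are not stable;
  sigma-compactness of surfaces restores measurability.\<close>

lemma Ck_on_cong:
  assumes "open S" "\<And>x. x \<in> S \<Longrightarrow> f x = g x" "Ck_on k S f"
  shows "Ck_on k S g"
  using assms(2,3)
proof (induction k arbitrary: f g)
  case 0
  then show ?case using continuous_on_cong[OF refl, of S f g] by simp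
next
  case (Suc k)
  have der: "(f has_derivative D) (at x) \<longleftrightarrow> (g has_derivative D) (at x)" if "x \<in> S" for x D
    using has_derivative_transform_within_open[OF _ assms(1) that, of f D UNIV g]
      has_derivative_transform_within_open[OF _ assms(1) that, of g D UNIV f] Suc.prems(1) by metis
  then have *: "frechet_derivative f (at x) v = frechet_derivative g (at x) v" if "x \<in> S" for x v
    using that by (simp add: frechet_derivative_def)
  have "f differentiable at x \<longleftrightarrow> g differentiable at x" if "x \<in> S" for x
    using der[OF that] by (simp add: differentiable_def)
  with Suc.prems(2) Suc.IH[OF *] show ?case by auto
qed

text \<open>Smoothness is verified by exhibiting a class of functions stable under directional
  derivatives; induction on the order then covers all orders at once. It is used for constants and
  for rational maps.\<close>

lemma smooth_on_derivative_closed: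
  assumes "open S" and "P f"
    and "\<And>g x. P g \<Longrightarrow> x \<in> S \<Longrightarrow> g differentiable at x"
    and "\<And>g v. P g \<Longrightarrow> \<exists>h. P h \<and> (\<forall>x\<in>S. frechet_derivative g (at x) v = h x)"
  shows "smooth_on S f"
  unfolding smooth_on_def
proof
  fix k
  show "Ck_on k S f"
    using \<open>P f\<close>
  proof (induction k arbitrary: f)
    case 0
    then show ?case
      using assms(3) by (simp add: continuous_at_imp_continuous_on differentiable_imp_continuous_within)
  next
    case (Suc k)
    have "Ck_on k S (\<lambda>x. frechet_derivative f (at x) v)" for v
    proof -
      obtain h where "P h" and h: "\<forall>x\<in>S. frechet_derivative f (at x) v = h x"
        using assms(4)[OF Suc.prems] by blast
      then show ?thesis
        using Ck_on_cong[OF assms(1) _ Suc.IH[OF \<open>P h\<close>]] by simp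
    qed
    with assms(3)[OF Suc.prems] show ?case by simp
  qed
qed

lemma smooth_on_const: "smooth_on UNIV (\<lambda>x. c)"
proof (rule smooth_on_derivative_closed[where P = "\<lambda>g. \<exists>c. g = (\<lambda>x. c)"])
  fix g :: "'a \<Rightarrow> 'b" and v
  assume "\<exists>c. g = (\<lambda>x. c)"
  then show "\<exists>h. (\<exists>c. h = (\<lambda>x. c)) \<and> (\<forall>x\<in>UNIV. frechet_derivative g (at x) v = h x)"
    by (intro exI[of _ "\<lambda>x. 0"]) auto
qed auto

text \<open>The only denominator needed is that of stereographic projection. It never vanishes, so
  no domain conditions arise, and the derivative of its inverse is a polynomial in the coordinates
  and this inverse.\<close>

inductive rational_fun :: "(real \<times> real \<Rightarrow> real) \<Rightarrow> bool" where
  rf_const: "rational_fun (\<lambda>w. c)"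
| rf_fst: "rational_fun fst"
| rf_snd: "rational_fun snd"
| rf_inv: "rational_fun (\<lambda>w. inverse (1 + (fst w)\<^sup>2 + (snd w)\<^sup>2))"
| rf_add: "rational_fun f \<Longrightarrow> rational_fun g \<Longrightarrow> rational_fun (\<lambda>w. f w + g w)"
| rf_mult: "rational_fun f \<Longrightarrow> rational_fun g \<Longrightarrow> rational_fun (\<lambda>w. f w * g w)"

lemma one_plus_squares_pos: "1 + (a::real)\<^sup>2 + b\<^sup>2 > 0"
  by (simp add: add_pos_nonneg)

lemma inverse_quadratic_has_derivative:
  "((\<lambda>w::real\<times>real. inverse (1 + (fst w)\<^sup>2 + (snd w)\<^sup>2)) has_derivative
    (\<lambda>v. - 2 * ((fst w * fst v + snd w * snd v) *
      (inverse (1 + (fst w)\<^sup>2 + (snd w)\<^sup>2) * inverse (1 + (fst w)\<^sup>2 + (snd w)\<^sup>2))))) (at w)"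
  using one_plus_squares_pos[of "fst w" "snd w"]
  by (intro derivative_eq_intros ext refl) (auto simp: algebra_simps)

lemma rational_fun_derivative:
  assumes "rational_fun g"
  shows "\<exists>D. (\<forall>w. (g has_derivative D w) (at w)) \<and> (\<forall>v. rational_fun (\<lambda>w. D w v))"
  using assms
proof induction
  case (rf_const c)
  show ?case
    by (rule exI[of _ "\<lambda>w v. 0"]) (simp add: rational_fun.rf_const)
next
  case rf_fst
  show ?case
    by (rule exI[of _ "\<lambda>w. fst"])
       (simp add: rational_fun.rf_const has_derivative_fst[OF has_derivative_ident])
next
  case rf_snd
  show ?case
    by (rule exI[of _ "\<lambda>w. snd"])
       (simp add: rational_fun.rf_const has_derivative_snd[OF has_derivative_ident])
next
  case rf_inv
  let ?i = "\<lambda>w::real\<times>real. inverse (1 + (fst w)\<^sup>2 + (snd w)\<^sup>2)"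
  show ?case
  proof (rule exI[of _ "\<lambda>w v. (- 2) * ((fst w * fst v + snd w * snd v) * (?i w * ?i w))"], intro conjI allI)
    show "(?i has_derivative (\<lambda>v. (- 2) * ((fst w * fst v + snd w * snd v) * (?i w * ?i w)))) (at w)" for w
      by (rule inverse_quadratic_has_derivative)
    show "rational_fun (\<lambda>w. - 2 * ((fst w * fst v + snd w * snd v) * (?i w * ?i w)))" for v
      by (rule rational_fun.rf_mult[OF rational_fun.rf_const rational_fun.rf_mult[OF
            rational_fun.rf_add[OF rational_fun.rf_mult[OF rational_fun.rf_fst rational_fun.rf_const]
              rational_fun.rf_mult[OF rational_fun.rf_snd rational_fun.rf_const]]
            rational_fun.rf_mult[OF rational_fun.rf_inv rational_fun.rf_inv]]])
  qed
next
  case (rf_add f g)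
  then obtain D E where DE: "\<forall>w. (f has_derivative D w) (at w)" "\<forall>v. rational_fun (\<lambda>w. D w v)"
      "\<forall>w. (g has_derivative E w) (at w)" "\<forall>v. rational_fun (\<lambda>w. E w v)" by blast
  show ?case
    by (rule exI[of _ "\<lambda>w v. D w v + E w v"])
       (intro conjI allI rational_fun.rf_add has_derivative_add DE[rule_format])
next
  case (rf_mult f g)
  then obtain D E where DE: "\<forall>w. (f has_derivative D w) (at w)" "\<forall>v. rational_fun (\<lambda>w. D w v)"
      "\<forall>w. (g has_derivative E w) (at w)" "\<forall>v. rational_fun (\<lambda>w. E w v)" by blast
  show ?case
    by (rule exI[of _ "\<lambda>w v. f w * E w v + D w v * g w"])
       (intro conjI allI has_derivative_mult DE[rule_format]
         rational_fun.rf_add[OF rational_fun.rf_mult rational_fun.rf_mult] rf_mult.hyps)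
qed

lemma smooth_on_rational:
  fixes b1 b2 b3 :: "real^3"
  assumes "rational_fun g1" "rational_fun g2" "rational_fun g3"
  shows "smooth_on UNIV (\<lambda>w. g1 w *\<^sub>R b1 + g2 w *\<^sub>R b2 + g3 w *\<^sub>R b3)"
proof (rule smooth_on_derivative_closed)
  let ?F = "\<lambda>g1 g2 g3 w. g1 w *\<^sub>R b1 + g2 w *\<^sub>R b2 + g3 w *\<^sub>R b3"
  let ?P = "\<lambda>g. \<exists>g1 g2 g3. rational_fun g1 \<and> rational_fun g2 \<and> rational_fun g3 \<and> g = ?F g1 g2 g3"
  show "?P (?F g1 g2 g3)" using assms by blast
  have D: "\<exists>D. (\<forall>w. (g has_derivative D w) (at w)) \<and> (\<forall>v. ?P (\<lambda>w. D w v))" if g: "?P g" for g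
  proof -
    from g obtain g1 g2 g3 where g: "rational_fun g1" "rational_fun g2" "rational_fun g3"
      and eq: "g = ?F g1 g2 g3" by blast
    from rational_fun_derivative[OF g(1)] obtain D1 where
      D1: "\<forall>w. (g1 has_derivative D1 w) (at w)" "\<forall>v. rational_fun (\<lambda>w. D1 w v)" by blast
    from rational_fun_derivative[OF g(2)] obtain D2 where
      D2: "\<forall>w. (g2 has_derivative D2 w) (at w)" "\<forall>v. rational_fun (\<lambda>w. D2 w v)" by blast
    from rational_fun_derivative[OF g(3)] obtain D3 where
      D3: "\<forall>w. (g3 has_derivative D3 w) (at w)" "\<forall>v. rational_fun (\<lambda>w. D3 w v)" by blast
    show ?thesis
    proof (rule exI[of _ "\<lambda>w v. ?F (\<lambda>w. D1 w v) (\<lambda>w. D2 w v) (\<lambda>w. D3 w v) w"], rule conjI; rule allI)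
      fix w v
      show "(g has_derivative (\<lambda>v. ?F (\<lambda>w. D1 w v) (\<lambda>w. D2 w v) (\<lambda>w. D3 w v) w)) (at w)"
        unfolding eq
        by (rule has_derivative_add[OF has_derivative_add])
           (rule has_derivative_scaleR_left D1(1)[rule_format] D2(1)[rule_format] D3(1)[rule_format])+
      show "?P (\<lambda>w. ?F (\<lambda>w. D1 w v) (\<lambda>w. D2 w v) (\<lambda>w. D3 w v) w)"
        by (rule exI[of _ "\<lambda>w. D1 w v"], rule exI[of _ "\<lambda>w. D2 w v"], rule exI[of _ "\<lambda>w. D3 w v"])
           (simp add: D1(2) D2(2) D3(2))
    qed
  qed
  show "g differentiable at w" if "?P g" for g w
    using D[OF that] unfolding differentiable_def by blast
  show "\<exists>h. ?P h \<and> (\<forall>w\<in>UNIV. frechet_derivative g (at w) v = h w)" if g: "?P g" for g v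
  proof -
    from D[OF g] obtain D where D: "(\<forall>w. (g has_derivative D w) (at w)) \<and> (\<forall>v. ?P (\<lambda>w. D w v))"
      by (rule exE)
    have "frechet_derivative g (at w) = D w" for w
      using frechet_derivative_at[OF D[THEN conjunct1, rule_format, of w]] by simp
    then show ?thesis
      by (intro exI[of _ "\<lambda>w. D w v"] conjI D[THEN conjunct2, rule_format]) simp
  qed
qed simp

lemma smooth_on_C1:
  assumes "smooth_on U r"
  shows "w \<in> U \<Longrightarrow> (r has_derivative frechet_derivative r (at w)) (at w)"
    and "continuous_on U (\<lambda>w. frechet_derivative r (at w) v)"
    and "continuous_on U r"
proof -
  have "Ck_on (Suc 0) U r" "Ck_on 0 U r" using assms unfolding smooth_on_def by blast+
  then show "w \<in> U \<Longrightarrow> (r has_derivative frechet_derivative r (at w)) (at w)"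
    "continuous_on U (\<lambda>w. frechet_derivative r (at w) v)" "continuous_on U r"
    by (auto simp: frechet_derivative_works)
qed

section \<open>Orthonormal frames and the slope substitution\<close>

text \<open>The coordinates of \<open>real^3\<close> with respect to an orthonormal frame, read as a map from
  \<open>real \<times> real \<times> real\<close> so that Tonelli's theorem applies coordinatewise.\<close>

definition frame3 :: "real^3 \<Rightarrow> real^3 \<Rightarrow> real^3 \<Rightarrow> real \<times> real \<times> real \<Rightarrow> real^3" where
  "frame3 e1 e2 e3 = (\<lambda>(a, b, c). a *\<^sub>R e1 + b *\<^sub>R e2 + c *\<^sub>R e3)"

lemma frame3_measurable [measurable]: "frame3 e1 e2 e3 \<in> borel_measurable borel"
  unfolding frame3_def by (simp add: split_beta' borel_measurable_continuous_onI continuous_intros)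

section \<open>Lebesgue measure in orthonormal coordinates\<close>

lemma lborel_orthogonal_transformation:
  fixes f :: "real^'n::{finite,wellorder} \<Rightarrow> real^'n::_"
  assumes f: "orthogonal_transformation f"
  shows "distr lborel borel f = lborel"
proof (rule lborel_eqI[symmetric])
  have lin: "linear f" using f orthogonal_transformation_linear by blast
  have meas[measurable]: "f \<in> borel_measurable borel"
    by (intro borel_measurable_continuous_onI linear_continuous_on lin linear_conv_bounded_linear[THEN iffD1])
  show "sets (distr lborel borel f) = sets borel" by simp
  fix l u :: "real^'n::_"
  assume lu: "\<And>b. b \<in> Basis \<Longrightarrow> l \<bullet> b \<le> u \<bullet> b"
  have inv: "orthogonal_transformation (inv f)"
    using f orthogonal_transformation_inv by blast
  have vim: "f -` box l u = inv f ` box l u"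
    using bij_vimage_eq_inv_image orthogonal_transformation_bij[OF f] by blast
  have lm: "inv f ` box l u \<in> lmeasurable"
    using measurable_orthogonal_image[OF inv] by simp
  have "emeasure (distr lborel borel f) (box l u) = emeasure lborel (f -` box l u)"
    by (subst emeasure_distr) auto
  also have "\<dots> = emeasure lebesgue (inv f ` box l u)"
    unfolding vim[symmetric] using measurable_sets[OF meas, of "box l u"] by simp
  also have "\<dots> = ennreal (measure lebesgue (inv f ` box l u))"
    by (simp add: emeasure_eq_measure2 lm)
  also have "\<dots> = ennreal (measure lebesgue (box l u))"
    by (simp add: measure_orthogonal_image[OF inv])
  also have "\<dots> = ennreal (\<Prod>b\<in>Basis. (u - l) \<bullet> b)"
    using lu by (simp add: measure_lborel_box_eq)
  finally show "emeasure (distr lborel borel f) (box l u) = ennreal (\<Prod>b\<in>Basis. (u - l) \<bullet> b)" .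
qed

lemma Basis_vec3: "(Basis :: (real^3) set) = {axis 1 1, axis 2 1, axis 3 1}"
  by (auto simp: Basis_vec_def UNIV_3)

lemma Basis_triple: "(Basis :: (real \<times> real \<times> real) set) = {(1, 0, 0), (0, 1, 0), (0, 0, 1)}"
  by (auto simp: Basis_prod_def zero_prod_def)

lemma lborel_standard_frame:
  "distr lborel borel (frame3 (axis 1 1) (axis 2 1) (axis 3 1)) = lborel"
proof (rule lborel_eqI[symmetric])
  let ?f = "frame3 (axis 1 1) (axis 2 1) (axis 3 1)"
  fix l u :: "real^3"
  assume lu: "\<And>b. b \<in> Basis \<Longrightarrow> l \<bullet> b \<le> u \<bullet> b"
  have lu': "l$1 \<le> u$1" "l$2 \<le> u$2" "l$3 \<le> u$3"
    using lu[of "axis 1 1"] lu[of "axis 2 1"] lu[of "axis 3 1"] by (auto simp: Basis_vec3 inner_axis)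
  have comp: "?f (a, b, c) $ 1 = a" "?f (a, b, c) $ 2 = b" "?f (a, b, c) $ 3 = c" for a b c
    by (auto simp: frame3_def axis_def)
  have "?f -` box l u = box (l$1, l$2, l$3) (u$1, u$2, u$3)"
    by (auto simp: box_def Basis_vec3 inner_axis comp Basis_triple)
  then have "emeasure (distr lborel borel ?f) (box l u) =
      emeasure lborel (box (l$1, l$2, l$3) (u$1, u$2, u$3))"
    by (subst emeasure_distr) auto
  also have "\<dots> = ennreal ((u$1 - l$1) * ((u$2 - l$2) * (u$3 - l$3)))"
    by (subst emeasure_lborel_box) (auto simp: Basis_triple lu')
  also have "\<dots> = ennreal (\<Prod>b\<in>Basis. (u - l) \<bullet> b)"
    by (simp add: Basis_vec3 inner_axis axis_eq_axis)
  finally show "emeasure (distr lborel borel ?f) (box l u) = ennreal (\<Prod>b\<in>Basis. (u - l) \<bullet> b)" .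
qed simp

definition orthonormal3 :: "real^3 \<Rightarrow> real^3 \<Rightarrow> real^3 \<Rightarrow> bool" where
  "orthonormal3 e1 e2 e3 \<longleftrightarrow> e1 \<bullet> e1 = 1 \<and> e2 \<bullet> e2 = 1 \<and> e3 \<bullet> e3 = 1 \<and>
     e1 \<bullet> e2 = 0 \<and> e1 \<bullet> e3 = 0 \<and> e2 \<bullet> e3 = 0"

lemma orthonormal3_axis: "orthonormal3 (axis 1 1) (axis 2 1) (axis 3 1)"
  by (simp add: orthonormal3_def inner_axis_axis)

lemma frame3_inner:
  assumes "orthonormal3 e1 e2 e3"
  shows "frame3 e1 e2 e3 (a, b, c) \<bullet> frame3 e1 e2 e3 (a', b', c') = a * a' + b * b' + c * c'"
  using assms by (simp add: frame3_def orthonormal3_def inner_add_left inner_add_right inner_commute)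

lemma norm_frame3:
  assumes "orthonormal3 e1 e2 e3"
  shows "norm (frame3 e1 e2 e3 (a, b, c)) = sqrt (a\<^sup>2 + b\<^sup>2 + c\<^sup>2)"
  unfolding norm_eq_sqrt_inner frame3_inner[OF assms] by (simp add: power2_eq_square)

text \<open>Any orthonormal frame is the standard one followed by an orthogonal map. The standard
  frame sends boxes of triples to boxes of vectors, and rotation invariance does the rest.\<close>

lemma lborel_frame3:
  assumes "orthonormal3 e1 e2 e3"
  shows "distr lborel borel (frame3 e1 e2 e3) = lborel"
proof -
  define T where "T v = frame3 e1 e2 e3 (v$1, v$2, v$3)" for v :: "real^3"
  have lin: "linear T"
    unfolding T_def frame3_def by (auto intro!: linearI simp: algebra_simps)
  have "T v \<bullet> T w = v \<bullet> w" for v w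
    unfolding T_def frame3_inner[OF assms] by (simp add: inner_vec_def sum_3)
  then have ort: "orthogonal_transformation T"
    using lin by (simp add: orthogonal_transformation_def)
  have [measurable]: "T \<in> borel_measurable borel"
    by (intro borel_measurable_continuous_onI linear_continuous_on lin linear_conv_bounded_linear[THEN iffD1])
  have "frame3 e1 e2 e3 = T \<circ> frame3 (axis 1 1) (axis 2 1) (axis 3 1)"
    by (auto simp: T_def frame3_def axis_def fun_eq_iff)
  then have "distr lborel borel (frame3 e1 e2 e3) =
      distr (distr lborel borel (frame3 (axis 1 1) (axis 2 1) (axis 3 1))) borel T"
    by (simp add: distr_distr)
  then show ?thesis
    by (simp add: lborel_standard_frame lborel_orthogonal_transformation[OF ort])
qed

lemma nn_integral_lborel_pair:
  fixes f :: "'a::euclidean_space \<times> 'b::euclidean_space \<Rightarrow> ennreal"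
  assumes "f \<in> borel_measurable borel"
  shows "(\<integral>\<^sup>+ w. f w \<partial>lborel) = (\<integral>\<^sup>+ x. \<integral>\<^sup>+ y. f (x, y) \<partial>lborel \<partial>lborel)"
    and "(\<integral>\<^sup>+ w. f w \<partial>lborel) = (\<integral>\<^sup>+ y. \<integral>\<^sup>+ x. f (x, y) \<partial>lborel \<partial>lborel)"
proof -
  have f: "f \<in> borel_measurable (lborel \<Otimes>\<^sub>M lborel)"
    using assms by (simp add: lborel_prod)
  show "(\<integral>\<^sup>+ w. f w \<partial>lborel) = (\<integral>\<^sup>+ x. \<integral>\<^sup>+ y. f (x, y) \<partial>lborel \<partial>lborel)"
    using lborel.nn_integral_fst[OF f] by (simp add: lborel_prod)
  show "(\<integral>\<^sup>+ w. f w \<partial>lborel) = (\<integral>\<^sup>+ y. \<integral>\<^sup>+ x. f (x, y) \<partial>lborel \<partial>lborel)"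
    using lborel_pair.nn_integral_snd[OF f] by (simp add: lborel_prod)
qed

text \<open>The third coordinate is outermost so that, with \<open>c\<close> fixed, the double
  integral over the plane of \<open>e1\<close> and \<open>e2\<close> is open to the slope
  substitution.\<close>

lemma nn_integral_frame3:
  assumes "orthonormal3 e1 e2 e3" and [measurable]: "f \<in> borel_measurable borel"
  shows "(\<integral>\<^sup>+ v. f v \<partial>lborel) =
    (\<integral>\<^sup>+ c. \<integral>\<^sup>+ a. \<integral>\<^sup>+ b. f (a *\<^sub>R e1 + b *\<^sub>R e2 + c *\<^sub>R e3) \<partial>lborel \<partial>lborel \<partial>lborel)"
proof -
  let ?g = "\<lambda>w. f (frame3 e1 e2 e3 w)"
  have "(\<integral>\<^sup>+ v. f v \<partial>lborel) = (\<integral>\<^sup>+ w. ?g w \<partial>lborel)"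
    by (subst lborel_frame3[OF assms(1), symmetric]) (simp add: nn_integral_distr)
  also have "\<dots> = (\<integral>\<^sup>+ a. \<integral>\<^sup>+ bc. ?g (a, bc) \<partial>lborel \<partial>lborel)"
    by (rule nn_integral_lborel_pair(1)) measurable
  also have "\<dots> = (\<integral>\<^sup>+ bc. \<integral>\<^sup>+ a. ?g (a, bc) \<partial>lborel \<partial>lborel)"
    by (subst nn_integral_lborel_pair(1)[symmetric], measurable) (rule nn_integral_lborel_pair(2), measurable)
  also have "\<dots> = (\<integral>\<^sup>+ c. \<integral>\<^sup>+ b. \<integral>\<^sup>+ a. ?g (a, b, c) \<partial>lborel \<partial>lborel \<partial>lborel)"
    by (rule nn_integral_lborel_pair(2)) measurable
  also have "\<dots> = (\<integral>\<^sup>+ c. \<integral>\<^sup>+ a. \<integral>\<^sup>+ b. ?g (a, b, c) \<partial>lborel \<partial>lborel \<partial>lborel)"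
    by (intro nn_integral_cong lborel_pair.Fubini') measurable
  finally show ?thesis by (simp add: frame3_def)
qed

text \<open>The substitution \<open>y = x t\<close>: polar coordinates with the slope in place of the angle.\<close>

lemma nn_integral_slope:
  fixes h :: "real \<Rightarrow> real \<Rightarrow> ennreal"
  assumes [measurable]: "case_prod h \<in> borel_measurable (borel \<Otimes>\<^sub>M borel)"
  shows "(\<integral>\<^sup>+ x. \<integral>\<^sup>+ y. h x y \<partial>lborel \<partial>lborel) =
    (\<integral>\<^sup>+ t. \<integral>\<^sup>+ x. ennreal \<bar>x\<bar> * h x (x * t) \<partial>lborel \<partial>lborel)"
proof -
  have "(\<integral>\<^sup>+ y. h x y \<partial>lborel) = (\<integral>\<^sup>+ t. ennreal \<bar>x\<bar> * h x (x * t) \<partial>lborel)" if "x \<noteq> 0" for x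
  proof -
    have "(\<integral>\<^sup>+ y. h x y \<partial>lborel) = ennreal \<bar>x\<bar> * (\<integral>\<^sup>+ t. h x (0 + x * t) \<partial>lborel)"
      by (rule nn_integral_real_affine[OF _ that]) measurable
    also have "\<dots> = (\<integral>\<^sup>+ t. ennreal \<bar>x\<bar> * h x (0 + x * t) \<partial>lborel)"
      by (rule nn_integral_cmult[symmetric]) measurable
    finally show ?thesis unfolding add_0 .
  qed
  then have "(\<integral>\<^sup>+ x. \<integral>\<^sup>+ y. h x y \<partial>lborel \<partial>lborel) =
      (\<integral>\<^sup>+ x. \<integral>\<^sup>+ t. ennreal \<bar>x\<bar> * h x (x * t) \<partial>lborel \<partial>lborel)"
    \<comment> \<open>The substitution fails only at \<open>x = 0\<close>, a null set.\<close>
    by (intro nn_integral_cong_AE, rule_tac eventually_mono[OF AE_lborel_singleton[of 0]]) auto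
  also have "\<dots> = (\<integral>\<^sup>+ t. \<integral>\<^sup>+ x. ennreal \<bar>x\<bar> * h x (x * t) \<partial>lborel \<partial>lborel)"
    by (rule lborel_pair.Fubini') measurable
  finally show ?thesis .
qed

section \<open>The Hausdorff area integrand of the metric\<close>

lemma nn_integral_halves:
  fixes f :: "real \<Rightarrow> ennreal"
  assumes [measurable]: "f \<in> borel_measurable borel"
  shows "(\<integral>\<^sup>+ x. f x \<partial>lborel) =
    (\<integral>\<^sup>+ x \<in> {0..}. f x \<partial>lborel) + (\<integral>\<^sup>+ x \<in> {0..}. f (- x) \<partial>lborel)"
proof -
  have "(\<integral>\<^sup>+ x. f x \<partial>lborel) = (\<integral>\<^sup>+ x. f x * indicator {0..} x + f x * indicator {..0} x \<partial>lborel)"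
    by (intro nn_integral_cong_AE, rule_tac eventually_mono[OF AE_lborel_singleton[of 0]])
       (auto simp: indicator_def)
  also have "\<dots> = (\<integral>\<^sup>+ x \<in> {0..}. f x \<partial>lborel) + (\<integral>\<^sup>+ x \<in> {..0}. f x \<partial>lborel)"
    by (rule nn_integral_add) measurable
  also have "(\<integral>\<^sup>+ x \<in> {..0}. f x \<partial>lborel) =
      ennreal \<bar>-1\<bar> * (\<integral>\<^sup>+ x. f (0 + (-1) * x) * indicator {..0} (0 + (-1) * x) \<partial>lborel)"
    by (rule nn_integral_real_affine) auto
  also have "\<dots> = (\<integral>\<^sup>+ x \<in> {0..}. f (- x) \<partial>lborel)"
    by (auto intro!: nn_integral_cong simp: indicator_def)
  finally show ?thesis .
qed

text \<open>The line is cut at 0 and the left half reflected: \<open>- F (- x)\<close> is an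
  antiderivative of \<open>f (- x)\<close> with limit \<open>- B\<close> at infinity. The two
  boundary values at 0 cancel.\<close>

lemma nn_integral_FTC_UNIV:
  fixes f F :: "real \<Rightarrow> real"
  assumes [measurable]: "f \<in> borel_measurable borel"
    and F: "\<And>x. DERIV F x :> f x" and f: "\<And>x. 0 \<le> f x"
    and T: "(F \<longlongrightarrow> T) at_top" and B: "(F \<longlongrightarrow> B) at_bot"
  shows "(\<integral>\<^sup>+ x. ennreal (f x) \<partial>lborel) = ennreal (T - B)"
proof -
  have mono: "F x \<le> F y" if "x \<le> y" for x y
    using DERIV_nonneg_imp_nondecreasing[OF that] F f by blast
  have T0: "F 0 \<le> T"
    by (rule tendsto_lowerbound[OF T]) (auto intro: eventually_mono[OF eventually_ge_at_top[of 0]] mono)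
  have B0: "B \<le> F 0"
    by (rule tendsto_upperbound[OF B]) (auto intro: eventually_mono[OF eventually_le_at_bot[of 0]] mono)
  have pos: "(\<integral>\<^sup>+ x. ennreal (f x) * indicator {0..} x \<partial>lborel) = ennreal (T - F 0)"
    by (rule nn_integral_FTC_atLeast) (use F f T in auto)
  have G: "((\<lambda>x. - F (- x)) \<longlongrightarrow> - B) at_top"
    using B by (intro tendsto_minus) (simp add: filterlim_at_top_mirror[symmetric] filterlim_at_bot_mirror)
  have "DERIV (\<lambda>x. - F (- x)) x :> f (- x)" for x
    using DERIV_minus[OF DERIV_chain2[OF F DERIV_minus[OF DERIV_ident]], of x] by simp
  then have neg: "(\<integral>\<^sup>+ x. ennreal (f (- x)) * indicator {0..} x \<partial>lborel) = ennreal (- B - - F (- 0))"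
    by (intro nn_integral_FTC_atLeast[OF _ _ _ G]) (use f in auto)
  show ?thesis
    by (subst nn_integral_halves, measurable)
       (use T0 B0 in \<open>simp add: pos neg[simplified] ennreal_plus[symmetric] del: ennreal_plus\<close>)
qed

lemma nn_integral_abs_indicator:
  assumes "0 \<le> m"
  shows "(\<integral>\<^sup>+ x. ennreal \<bar>x\<bar> * indicator {-m..m} x \<partial>lborel) = ennreal (m\<^sup>2)"
proof -
  have half: "(\<integral>\<^sup>+ x. ennreal x * indicator {0..m} x \<partial>lborel) = ennreal (m\<^sup>2 / 2 - 0\<^sup>2 / 2)"
    by (rule nn_integral_FTC_Icc) (auto intro!: derivative_eq_intros simp: assms)
  have "(\<integral>\<^sup>+ x \<in> {0..}. (ennreal \<bar>x\<bar> * indicator {-m..m} x) \<partial>lborel) = ennreal (m\<^sup>2 / 2)"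
    "(\<integral>\<^sup>+ x \<in> {0..}. (ennreal \<bar>- x\<bar> * indicator {-m..m} (- x)) \<partial>lborel) = ennreal (m\<^sup>2 / 2)"
    using assms half by (auto intro!: nn_integral_cong simp: indicator_def elim!: trans[rotated])
  then show ?thesis
    by (subst nn_integral_halves) (simp_all add: ennreal_plus[symmetric] del: ennreal_plus)
qed

text \<open>Gaussian elimination with pivot \<open>p\<close>. Replacing \<open>p * x + r * y\<close>
  by a new variable \<open>x\<close> turns \<open>q * x + s * y\<close> into
  \<open>q / p * x + d * y\<close>, a shear followed by a scaling in \<open>y\<close>, so only
  one-dimensional affine substitutions are needed. The factors \<open>p\<close> and \<open>d\<close>
  multiply to the determinant.\<close>

lemma nn_integral_linear_plane_pivot:
  fixes h :: "real \<Rightarrow> real \<Rightarrow> ennreal"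
  assumes [measurable]: "case_prod h \<in> borel_measurable (borel \<Otimes>\<^sub>M borel)"
    and D: "p * s - q * r \<noteq> 0" and p: "p \<noteq> 0"
  shows "ennreal \<bar>p * s - q * r\<bar> * (\<integral>\<^sup>+ x. \<integral>\<^sup>+ y. h (p * x + r * y) (q * x + s * y) \<partial>lborel \<partial>lborel) =
    (\<integral>\<^sup>+ x. \<integral>\<^sup>+ y. h x y \<partial>lborel \<partial>lborel)"
proof -
  define d where "d = (p * s - q * r) / p"
  have d: "d \<noteq> 0" "\<bar>p * s - q * r\<bar> = \<bar>d\<bar> * \<bar>p\<bar>"
    using D p by (auto simp: d_def abs_divide)
  have eq: "q / p * (r * y + p * x) + d * y = q * x + s * y" for x y
    using p by (simp add: d_def field_simps)
  have x: "ennreal \<bar>p\<bar> * (\<integral>\<^sup>+ x. h (p * x + r * y) (q * x + s * y) \<partial>lborel) =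
      (\<integral>\<^sup>+ x. h x (q / p * x + d * y) \<partial>lborel)" for y
    using nn_integral_real_affine[of "\<lambda>x. h x (q / p * x + d * y)" p "r * y"] p
    unfolding eq by (simp add: add.commute)
  have y: "ennreal \<bar>d\<bar> * (\<integral>\<^sup>+ y. h x (q / p * x + d * y) \<partial>lborel) = (\<integral>\<^sup>+ y. h x y \<partial>lborel)" for x
    using nn_integral_real_affine[of "\<lambda>y. h x y" d "q / p * x"] d by simp
  have sw: "(\<integral>\<^sup>+ x. \<integral>\<^sup>+ y. h (p * x + r * y) (q * x + s * y) \<partial>lborel \<partial>lborel) =
      (\<integral>\<^sup>+ y. \<integral>\<^sup>+ x. h (p * x + r * y) (q * x + s * y) \<partial>lborel \<partial>lborel)"
    by (rule lborel_pair.Fubini'[symmetric]) measurable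
  have "ennreal \<bar>p * s - q * r\<bar> * (\<integral>\<^sup>+ x. \<integral>\<^sup>+ y. h (p * x + r * y) (q * x + s * y) \<partial>lborel \<partial>lborel) =
      ennreal \<bar>d\<bar> * (ennreal \<bar>p\<bar> * (\<integral>\<^sup>+ y. \<integral>\<^sup>+ x. h (p * x + r * y) (q * x + s * y) \<partial>lborel \<partial>lborel))"
    unfolding sw by (simp add: d(2) ennreal_mult mult_ac)
  also have "ennreal \<bar>p\<bar> * (\<integral>\<^sup>+ y. \<integral>\<^sup>+ x. h (p * x + r * y) (q * x + s * y) \<partial>lborel \<partial>lborel) = (\<integral>\<^sup>+ y. \<integral>\<^sup>+ x. h x (q / p * x + d * y) \<partial>lborel \<partial>lborel)"
    by (subst nn_integral_cmult[symmetric], measurable) (simp add: x)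
  also have "\<dots> = (\<integral>\<^sup>+ x. \<integral>\<^sup>+ y. h x (q / p * x + d * y) \<partial>lborel \<partial>lborel)"
    by (rule lborel_pair.Fubini') measurable
  also have "ennreal \<bar>d\<bar> * \<dots> = (\<integral>\<^sup>+ x. \<integral>\<^sup>+ y. h x y \<partial>lborel \<partial>lborel)"
    by (subst nn_integral_cmult[symmetric], measurable) (simp only: y)
  finally show ?thesis .
qed

lemma nn_integral_linear_plane:
  fixes h :: "real \<Rightarrow> real \<Rightarrow> ennreal"
  assumes [measurable]: "case_prod h \<in> borel_measurable (borel \<Otimes>\<^sub>M borel)"
    and D: "p * s - q * r \<noteq> 0"
  shows "ennreal \<bar>p * s - q * r\<bar> * (\<integral>\<^sup>+ x. \<integral>\<^sup>+ y. h (p * x + r * y) (q * x + s * y) \<partial>lborel \<partial>lborel) =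
    (\<integral>\<^sup>+ x. \<integral>\<^sup>+ y. h x y \<partial>lborel \<partial>lborel)"
proof (cases "p = 0")
  case True
  \<comment> \<open>Exchanging \<open>x\<close> and \<open>y\<close> swaps the columns of the
    matrix, which makes \<open>r\<close> the pivot.\<close>
  with D have "r * q - s * p \<noteq> 0" "r \<noteq> 0" by auto
  note pivot = nn_integral_linear_plane_pivot[OF assms(1) this]
  have "(\<integral>\<^sup>+ x. \<integral>\<^sup>+ y. h (p * x + r * y) (q * x + s * y) \<partial>lborel \<partial>lborel) =
      (\<integral>\<^sup>+ y. \<integral>\<^sup>+ x. h (r * y + p * x) (s * y + q * x) \<partial>lborel \<partial>lborel)"
    unfolding add.commute[of "r * _"] add.commute[of "s * _"]
    by (rule lborel_pair.Fubini'[symmetric]) measurable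
  moreover have "\<bar>p * s - q * r\<bar> = \<bar>r * q - s * p\<bar>" by (simp add: abs_minus_commute mult.commute)
  ultimately show ?thesis using pivot by simp
qed (rule nn_integral_linear_plane_pivot[OF assms])

section \<open>Areas of plane sections of the unit ball\<close>

lemma emeasure_plane_measure:
  assumes [measurable]: "S \<in> sets borel"
  shows "emeasure (plane_measure v w) S =
    (\<integral>\<^sup>+ x. \<integral>\<^sup>+ y. indicator S (x *\<^sub>R v + y *\<^sub>R w) \<partial>lborel \<partial>lborel)"
proof -
  let ?f = "\<lambda>(x, y). x *\<^sub>R v + y *\<^sub>R w"
  have [measurable]: "?f \<in> borel_measurable borel"
    by (simp add: split_beta' borel_measurable_continuous_onI continuous_intros)
  have "emeasure (plane_measure v w) S = (\<integral>\<^sup>+ z. indicator S z \<partial>plane_measure v w)"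
    by (simp add: plane_measure_def)
  also have "\<dots> = (\<integral>\<^sup>+ z. indicator S (?f z) \<partial>lborel)"
    unfolding plane_measure_def by (rule nn_integral_distr) measurable
  also have "\<dots> = (\<integral>\<^sup>+ x. \<integral>\<^sup>+ y. indicator S (?f (x, y)) \<partial>lborel \<partial>lborel)"
    by (rule nn_integral_lborel_pair(1)) measurable
  finally show ?thesis by simp
qed

lemma plane_measure_basis_change:
  assumes v: "v1 = p *\<^sub>R e1 + q *\<^sub>R e2" "v2 = r *\<^sub>R e1 + s *\<^sub>R e2"
    and D: "p * s - q * r \<noteq> 0" and [measurable]: "S \<in> sets borel"
  shows "measure (plane_measure v1 v2) S = measure (plane_measure e1 e2) S / \<bar>p * s - q * r\<bar>"
proof -
  have "ennreal \<bar>p * s - q * r\<bar> * (\<integral>\<^sup>+ x. \<integral>\<^sup>+ y. indicator S ((p * x + r * y) *\<^sub>R e1 + (q * x + s * y) *\<^sub>R e2) \<partial>lborel \<partial>lborel) =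
      (\<integral>\<^sup>+ x. \<integral>\<^sup>+ y. indicator S (x *\<^sub>R e1 + y *\<^sub>R e2) \<partial>lborel \<partial>lborel)"
    by (rule nn_integral_linear_plane[OF _ D]) measurable
  moreover have "(p * x + r * y) *\<^sub>R e1 + (q * x + s * y) *\<^sub>R e2 = x *\<^sub>R v1 + y *\<^sub>R v2" for x y
    by (simp add: v algebra_simps)
  ultimately have "ennreal \<bar>p * s - q * r\<bar> * emeasure (plane_measure v1 v2) S = emeasure (plane_measure e1 e2) S"
    by (simp add: emeasure_plane_measure)
  then have "measure (plane_measure e1 e2) S = \<bar>p * s - q * r\<bar> * measure (plane_measure v1 v2) S"
    unfolding measure_def by (metis abs_ge_zero enn2real_ennreal enn2real_mult)
  with D show ?thesis by simp
qed

abbreviation (input) phi_area :: "real \<Rightarrow> area_integrand" where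
  "phi_area a \<equiv> hausdorff_area_integrand (phi_metric a)"

lemma phi_metric_measurable [measurable]: "phi_metric a x \<in> borel_measurable borel"
  unfolding phi_metric_def by measurable

lemma nn_integral_slope_area:
  assumes "A > 0" "C > 0"
  shows "(\<integral>\<^sup>+ t. ennreal ((1 + t\<^sup>2) / (C + A * t\<^sup>2)\<^sup>2) \<partial>lborel) = ennreal (pi * (A + C) / (2 * (A * C) * sqrt (A * C)))"
proof -
  define m where "m = sqrt (A / C)"
  define k where "k = (A + C) / (2 * (A * C) * sqrt (A * C))"
  have m: "m > 0" "m\<^sup>2 = A / C" using assms by (auto simp: m_def)
  have pos: "C + A * t\<^sup>2 > 0" for t :: real
    using assms by (simp add: add_pos_nonneg)
  have "sqrt (A * C) = C * m"
    using assms m(1) by (intro real_sqrt_unique) (simp_all add: power_mult_distrib m(2) power2_eq_square[of C])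
  then have km: "k * m = (A + C) / (2 * A * C\<^sup>2)"
    using assms m(1) by (simp add: k_def power2_eq_square)
  \<comment> \<open>The integrand is a combination of \<open>(C - A t^2) / (C + A t^2)^2\<close>,
    the derivative of \<open>t / (C + A t^2)\<close>, and of \<open>1 / (C + A t^2)\<close>, which
    integrates to an arctangent. Comparing the coefficients of 1 and \<open>t^2\<close> gives
    \<open>c = (1/C - 1/A) / 2\<close> for the first and \<open>(1/C + 1/A) / 2\<close> for the
    second. The rational part vanishes at both ends, so only \<open>k * pi\<close> remains.\<close>
  define c where "c = (A - C) / (2 * A * C)"
  let ?F = "\<lambda>t. c * (t / (C + A * t\<^sup>2)) + k * arctan (m * t)"
  have "(\<integral>\<^sup>+ t. ennreal ((1 + t\<^sup>2) / (C + A * t\<^sup>2)\<^sup>2) \<partial>lborel) = ennreal (k * (pi / 2) - (- k * (pi / 2)))"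
  proof (rule nn_integral_FTC_UNIV[where F = ?F])
    fix t :: real
    have 1: "1 + (m * t)\<^sup>2 = (C + A * t\<^sup>2) / C"
      using assms m by (simp add: power_mult_distrib field_simps)
    have "((\<lambda>t. t / (C + A * t\<^sup>2)) has_real_derivative (C - A * t\<^sup>2) / (C + A * t\<^sup>2)\<^sup>2) (at t)"
      using pos[of t] by (auto intro!: derivative_eq_intros simp: power2_eq_square)
    moreover have "((\<lambda>t. arctan (m * t)) has_real_derivative m * (1 / (1 + (m * t)\<^sup>2))) (at t)"
      by (auto intro!: derivative_eq_intros simp: divide_inverse)
    ultimately have "(?F has_real_derivative
        c * ((C - A * t\<^sup>2) / (C + A * t\<^sup>2)\<^sup>2) + k * (m * (1 / (1 + (m * t)\<^sup>2)))) (at t)"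
      by (intro DERIV_add DERIV_cmult)
    also have "k * (m * (1 / (1 + (m * t)\<^sup>2))) = (A + C) / (2 * A * C) / (C + A * t\<^sup>2)"
      unfolding 1 mult.assoc[symmetric] km using assms pos[of t] by (simp add: power2_eq_square)
    also have "c * ((C - A * t\<^sup>2) / (C + A * t\<^sup>2)\<^sup>2) + (A + C) / (2 * A * C) / (C + A * t\<^sup>2) =
        (c * (C - A * t\<^sup>2) + (A + C) / (2 * A * C) * (C + A * t\<^sup>2)) / (C + A * t\<^sup>2)\<^sup>2"
      using pos[of t] by (simp add: power2_eq_square add_divide_distrib)
    also have "c * (C - A * t\<^sup>2) + (A + C) / (2 * A * C) * (C + A * t\<^sup>2) = 1 + t\<^sup>2"
      using assms by (simp add: c_def field_simps)
    finally show "(?F has_real_derivative (1 + t\<^sup>2) / (C + A * t\<^sup>2)\<^sup>2) (at t)" .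
  next
    have r: "((\<lambda>t. t / (C + A * t\<^sup>2)) \<longlongrightarrow> 0) at_top" "((\<lambda>t. t / (C + A * t\<^sup>2)) \<longlongrightarrow> 0) at_bot"
      using assms by real_asymp+
    have top: "((\<lambda>t. arctan (m * t)) \<longlongrightarrow> pi / 2) at_top"
      using m(1) by (intro filterlim_compose[OF tendsto_arctan_at_top] filterlim_tendsto_pos_mult_at_top[OF tendsto_const] filterlim_ident)
    show "(?F \<longlongrightarrow> k * (pi / 2)) at_top"
      using tendsto_add[OF tendsto_mult_left[OF r(1), of c] tendsto_mult_left[OF top, of k]] by simp
    have bot: "((\<lambda>t. arctan (m * t)) \<longlongrightarrow> - (pi / 2)) at_bot"
      using m(1) by (intro filterlim_compose[OF tendsto_arctan_at_bot] filterlim_tendsto_pos_mult_at_bot[OF tendsto_const] filterlim_ident)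
    show "(?F \<longlongrightarrow> - k * (pi / 2)) at_bot"
      using tendsto_add[OF tendsto_mult_left[OF r(2), of c] tendsto_mult_left[OF bot, of k]] by simp
  qed (use assms in auto)
  then show ?thesis by (simp add: k_def mult.assoc)
qed

text \<open>In the coordinates \<open>s e1 + t e2\<close> the section of the unit ball is \<open>(C s^2 + A t^2)^2 \<le> s^2 + t^2\<close>.\<close>

lemma unit_ball_section_area:
  fixes a :: real
  assumes e: "e1 \<bullet> e1 = 1" "e2 \<bullet> e2 = 1" "e1 \<bullet> e2 = 0" and x: "x \<bullet> e2 = 0"
  defines "A \<equiv> 1 + a\<^sup>2 * (norm x)\<^sup>2" and "C \<equiv> 1 + a\<^sup>2 * (norm x)\<^sup>2 + a\<^sup>2 * (x \<bullet> e1)\<^sup>2"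
  shows "measure (plane_measure e1 e2) ({v. phi_metric a x v \<le> 1} \<inter> span {e1, e2}) =
    pi * (A + C) / (2 * (A * C) * sqrt (A * C))"
proof -
  have AC: "A > 0" "C > 0" by (auto simp: A_def C_def add_pos_nonneg)
  have pos: "C + A * t\<^sup>2 > 0" for t :: real
    using AC by (simp add: add_pos_nonneg)
  have nsq: "(norm (s *\<^sub>R e1 + t *\<^sub>R e2))\<^sup>2 = s\<^sup>2 + t\<^sup>2" for s t
    unfolding power2_norm_eq_inner using e
    by (simp add: inner_add_left inner_add_right inner_commute power2_eq_square)
  then have nrm: "norm (s *\<^sub>R e1 + t *\<^sub>R e2) = sqrt (s\<^sup>2 + t\<^sup>2)" for s t
    by (metis norm_ge_zero real_sqrt_abs abs_of_nonneg)
  have phi: "phi_metric a x (s *\<^sub>R e1 + t *\<^sub>R e2) = (C * s\<^sup>2 + A * t\<^sup>2) / sqrt (s\<^sup>2 + t\<^sup>2)" for s t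
    unfolding phi_metric_def nsq unfolding nrm using x
    by (simp add: inner_add_right A_def C_def power_mult_distrib algebra_simps)
  let ?S = "{v. phi_metric a x v \<le> 1} \<inter> span {e1, e2}"
  have [measurable]: "?S \<in> sets borel"
    using borel_closed[OF closed_subspace[OF subspace_span]] by measurable
  have inS: "s *\<^sub>R e1 + t *\<^sub>R e2 \<in> ?S \<longleftrightarrow> (C * s\<^sup>2 + A * t\<^sup>2) / sqrt (s\<^sup>2 + t\<^sup>2) \<le> 1" for s t
    unfolding phi[symmetric] by (auto intro: span_add span_mul span_base)
  \<comment> \<open>Along the line of slope \<open>t\<close> the metric is proportional to the
    absolute value of \<open>s\<close>, so the section is a symmetric interval. At
    \<open>s = 0\<close> the quotient is 0 by division by zero, in accordance with the value of the
    metric at the zero vector.\<close>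
  have slope: "(C * s\<^sup>2 + A * (s * t)\<^sup>2) / sqrt (s\<^sup>2 + (s * t)\<^sup>2) \<le> 1 \<longleftrightarrow>
      s \<in> {- (sqrt (1 + t\<^sup>2) / (C + A * t\<^sup>2))..sqrt (1 + t\<^sup>2) / (C + A * t\<^sup>2)}" for s t
  proof (cases "s = 0")
    case False
    have "s\<^sup>2 + (s * t)\<^sup>2 = s\<^sup>2 * (1 + t\<^sup>2)" by (simp add: algebra_simps power2_eq_square)
    then have "sqrt (s\<^sup>2 + (s * t)\<^sup>2) = \<bar>s\<bar> * sqrt (1 + t\<^sup>2)" by (simp add: real_sqrt_mult)
    moreover have "C * s\<^sup>2 + A * (s * t)\<^sup>2 = \<bar>s\<bar> * (\<bar>s\<bar> * (C + A * t\<^sup>2))"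
      by (simp add: algebra_simps power2_eq_square)
    ultimately have "(C * s\<^sup>2 + A * (s * t)\<^sup>2) / sqrt (s\<^sup>2 + (s * t)\<^sup>2) = \<bar>s\<bar> * (C + A * t\<^sup>2) / sqrt (1 + t\<^sup>2)"
      using False by simp
    moreover have "sqrt (1 + t\<^sup>2) > 0" by (simp add: add_pos_nonneg)
    ultimately have "(C * s\<^sup>2 + A * (s * t)\<^sup>2) / sqrt (s\<^sup>2 + (s * t)\<^sup>2) \<le> 1 \<longleftrightarrow> \<bar>s\<bar> \<le> sqrt (1 + t\<^sup>2) / (C + A * t\<^sup>2)"
      using pos[of t] by (simp add: pos_divide_le_eq pos_le_divide_eq)
    then show ?thesis by (auto simp: abs_le_iff)
  qed (use pos[of t] in \<open>simp add: add_pos_nonneg less_imp_le\<close>)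
  have "emeasure (plane_measure e1 e2) ?S = (\<integral>\<^sup>+ s. \<integral>\<^sup>+ t. indicator ?S (s *\<^sub>R e1 + t *\<^sub>R e2) \<partial>lborel \<partial>lborel)"
    by (rule emeasure_plane_measure) measurable
  also have "\<dots> = (\<integral>\<^sup>+ t. \<integral>\<^sup>+ s. ennreal \<bar>s\<bar> * indicator ?S (s *\<^sub>R e1 + (s * t) *\<^sub>R e2) \<partial>lborel \<partial>lborel)"
    by (rule nn_integral_slope) measurable
  also have "\<dots> = (\<integral>\<^sup>+ t. ennreal ((sqrt (1 + t\<^sup>2) / (C + A * t\<^sup>2))\<^sup>2) \<partial>lborel)"
  proof (rule nn_integral_cong)
    fix t :: real
    have "(\<integral>\<^sup>+ s. ennreal \<bar>s\<bar> * indicator ?S (s *\<^sub>R e1 + (s * t) *\<^sub>R e2) \<partial>lborel) =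
        (\<integral>\<^sup>+ s. ennreal \<bar>s\<bar> * indicator {- (sqrt (1 + t\<^sup>2) / (C + A * t\<^sup>2))..sqrt (1 + t\<^sup>2) / (C + A * t\<^sup>2)} s \<partial>lborel)"
      using inS slope by (intro nn_integral_cong) (simp add: indicator_def)
    also have "\<dots> = ennreal ((sqrt (1 + t\<^sup>2) / (C + A * t\<^sup>2))\<^sup>2)"
      using pos[of t] by (intro nn_integral_abs_indicator) (simp add: less_imp_le)
    finally show "(\<integral>\<^sup>+ s. ennreal \<bar>s\<bar> * indicator ?S (s *\<^sub>R e1 + (s * t) *\<^sub>R e2) \<partial>lborel) =
      ennreal ((sqrt (1 + t\<^sup>2) / (C + A * t\<^sup>2))\<^sup>2)" .
  qed
  also have "\<dots> = (\<integral>\<^sup>+ t. ennreal ((1 + t\<^sup>2) / (C + A * t\<^sup>2)\<^sup>2) \<partial>lborel)"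
    by (simp add: power_divide)
  also have "\<dots> = ennreal (pi * (A + C) / (2 * (A * C) * sqrt (A * C)))"
    by (rule nn_integral_slope_area[OF AC])
  finally show ?thesis
    using AC by (simp add: measure_def)
qed

text \<open>The condition \<open>x \<bullet> e2 = 0\<close> selects an orthonormal basis of the
  plane that diagonalizes the quadratic form in the numerator of the metric, with eigenvalues
  \<open>C\<close> along \<open>e1\<close> and \<open>A\<close> along \<open>e2\<close>. The
  determinant accounts for the passage from this basis to \<open>v1\<close> and
  \<open>v2\<close>.\<close>

lemma hausdorff_area_integrand_phi:
  fixes a :: real
  assumes e: "e1 \<bullet> e1 = 1" "e2 \<bullet> e2 = 1" "e1 \<bullet> e2 = 0" and x: "x \<bullet> e2 = 0"
    and v: "v1 = p *\<^sub>R e1 + q *\<^sub>R e2" "v2 = r *\<^sub>R e1 + s *\<^sub>R e2" and D: "p * s - q * r \<noteq> 0"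
  defines "A \<equiv> 1 + a\<^sup>2 * (norm x)\<^sup>2" and "C \<equiv> 1 + a\<^sup>2 * (norm x)\<^sup>2 + a\<^sup>2 * (x \<bullet> e1)\<^sup>2"
  shows "phi_area a x v1 v2 =
    \<bar>p * s - q * r\<bar> * (2 * (A * C) * sqrt (A * C) / (A + C))"
proof -
  have sub: "span {v1, v2} = span {e1, e2}"
  proof (rule span_eq[THEN iffD2], intro conjI)
    show "{v1, v2} \<subseteq> span {e1, e2}"
      unfolding v by (auto intro!: span_add span_mul intro: span_base)
    have "(p * s - q * r) *\<^sub>R e1 = s *\<^sub>R v1 - q *\<^sub>R v2" "(p * s - q * r) *\<^sub>R e2 = p *\<^sub>R v2 - r *\<^sub>R v1"
      unfolding v by (simp_all add: algebra_simps)
    then have "e1 = (1 / (p * s - q * r)) *\<^sub>R (s *\<^sub>R v1 - q *\<^sub>R v2)" "e2 = (1 / (p * s - q * r)) *\<^sub>R (p *\<^sub>R v2 - r *\<^sub>R v1)"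
      using D by (metis (no_types) divide_self scaleR_one scaleR_scaleR times_divide_eq_left mult_1)+
    then show "{e1, e2} \<subseteq> span {v1, v2}"
      by (metis empty_subsetI insertCI insert_subset span_base span_diff span_mul)
  qed
  have S: "{v. phi_metric a x v \<le> 1} \<inter> span {e1, e2} \<in> sets borel"
    using borel_closed[OF closed_subspace[OF subspace_span]] by measurable
  have "measure (plane_measure v1 v2) ({v. phi_metric a x v \<le> 1} \<inter> span {e1, e2}) =
      pi * (A + C) / (2 * (A * C) * sqrt (A * C)) / \<bar>p * s - q * r\<bar>"
    unfolding plane_measure_basis_change[OF v D S] unit_ball_section_area[OF e x] A_def C_def ..
  then show ?thesis
    unfolding hausdorff_area_integrand_def sub by simp
qed

section \<open>Measurability of crossing numbers\<close>

lemma nn_integral_line_measure: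
  assumes [measurable]: "h \<in> borel_measurable borel"
  shows "(\<integral>\<^sup>+ l. h l \<partial>line_measure) = 3 * (\<integral>\<^sup>+ x. \<integral>\<^sup>+ y. indicator (cball 0 1) x *
    (indicator {0..1} (y \<bullet> sgn x) * h (sgn x, y - (y \<bullet> sgn x) *\<^sub>R sgn x)) \<partial>lborel \<partial>lborel)"
proof -
  let ?E = "{(x, y::real^3). norm (x::real^3) \<le> 1 \<and> 0 \<le> y \<bullet> sgn x \<and> y \<bullet> sgn x \<le> 1}"
  let ?L = "\<lambda>(x::real^3, y::real^3). (sgn x, y - (y \<bullet> sgn x) *\<^sub>R sgn x)"
  have [measurable]: "?L \<in> borel_measurable borel"
    unfolding split_beta' borel_prod[symmetric] sgn_div_norm by measurable
  have "{w \<in> space borel. norm (fst w :: real^3) \<le> 1 \<and> 0 \<le> snd w \<bullet> sgn (fst w) \<and> snd w \<bullet> sgn (fst w) \<le> 1} \<in> sets borel"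
    unfolding sgn_div_norm borel_prod[symmetric] by measurable
  then have E[measurable]: "?E \<in> sets borel"
    by (simp add: split_beta')
  have "(\<integral>\<^sup>+ l. h l \<partial>line_measure) = 3 * (\<integral>\<^sup>+ w. h (?L w) \<partial>restrict_space lborel ?E)"
    unfolding line_measure_def
    by (subst nn_integral_scale_measure)
       (simp_all add: nn_integral_distr measurable_restrict_space1)
  also have "(\<integral>\<^sup>+ w. h (?L w) \<partial>restrict_space lborel ?E) = (\<integral>\<^sup>+ w. h (?L w) * indicator ?E w \<partial>lborel)"
    by (rule nn_integral_restrict_space) simp
  also have "\<dots> = (\<integral>\<^sup>+ x. \<integral>\<^sup>+ y. h (?L (x, y)) * indicator ?E (x, y) \<partial>lborel \<partial>lborel)"
    by (rule nn_integral_lborel_pair(1)) measurable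
  also have "\<dots> = (\<integral>\<^sup>+ x. \<integral>\<^sup>+ y. indicator (cball 0 1) x *
    (indicator {0..1} (y \<bullet> sgn x) * h (sgn x, y - (y \<bullet> sgn x) *\<^sub>R sgn x)) \<partial>lborel \<partial>lborel)"
    by (intro nn_integral_cong) (auto simp: indicator_def)
  finally show ?thesis .
qed

text \<open>This class is stable under the operations that crossing numbers require: it contains the
  open sets and is closed under countable unions, binary intersections and continuous images. So
  every surface belongs to it, as does the part of a surface inside an open set.\<close>

definition sigma_compact :: "'a::topological_space set \<Rightarrow> bool" where
  "sigma_compact S \<longleftrightarrow> (\<exists>K :: nat \<Rightarrow> 'a set. (\<forall>i. compact (K i)) \<and> S = (\<Union>i. K i))"

lemma sigma_compact_UN:
  assumes "\<And>i::nat. sigma_compact (S i)"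
  shows "sigma_compact (\<Union>i. S i)"
proof -
  have "\<exists>K. \<forall>i. (\<forall>j::nat. compact (K i j)) \<and> S i = (\<Union>j. K i j)"
    using assms unfolding sigma_compact_def by metis
  then obtain K where K: "\<And>i j::nat. compact (K i j)" "\<And>i. S i = (\<Union>j. K i j)" by metis
  have "(\<Union>i. S i) = (\<Union>n. case_prod K (prod_decode n))"
    unfolding K(2) by (auto simp: split_beta') (metis fst_conv snd_conv prod_encode_inverse)
  then show ?thesis
    unfolding sigma_compact_def using K(1)
    by (intro exI[of _ "\<lambda>n. case_prod K (prod_decode n)"]) (auto simp: split_beta')
qed

lemma sigma_compact_open:
  fixes S :: "'a::euclidean_space set"
  assumes "open S"
  shows "sigma_compact S"
proof -
  obtain C :: "nat \<Rightarrow> 'a set" where "\<And>n. compact (C n)" "\<Union>(range C) = S"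
    using open_Union_compact_subsets[OF assms] by metis
  then show ?thesis unfolding sigma_compact_def by auto
qed

lemma sigma_compact_continuous_image:
  assumes "sigma_compact S" "continuous_on S f"
  shows "sigma_compact (f ` S)"
proof -
  obtain K :: "nat \<Rightarrow> 'a set" where K: "\<And>i. compact (K i)" "S = (\<Union>i. K i)"
    using assms(1) unfolding sigma_compact_def by auto
  have "compact (f ` K i)" for i
    using K assms(2) by (intro compact_continuous_image continuous_on_subset[OF assms(2)]) auto
  then show ?thesis
    unfolding sigma_compact_def using K(2) by (intro exI[of _ "\<lambda>i. f ` K i"]) auto
qed

lemma sigma_compact_Int:
  fixes S :: "'a::t2_space set"
  assumes "sigma_compact S" "sigma_compact T"
  shows "sigma_compact (S \<inter> T)"
proof -
  obtain K :: "nat \<Rightarrow> 'a set" where K: "\<And>i. compact (K i)" "S = (\<Union>i. K i)"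
    using assms(1) unfolding sigma_compact_def by auto
  obtain L :: "nat \<Rightarrow> 'a set" where L: "\<And>i. compact (L i)" "T = (\<Union>i. L i)"
    using assms(2) unfolding sigma_compact_def by auto
  have "S \<inter> T = (\<Union>i. \<Union>j. K i \<inter> L j)" using K L by auto
  moreover have "sigma_compact (\<Union>i. \<Union>j. K i \<inter> L j)"
  proof (intro sigma_compact_UN)
    fix i j
    show "sigma_compact (K i \<inter> L j)"
      unfolding sigma_compact_def using K(1) L(1) by (intro exI[of _ "\<lambda>_. K i \<inter> L j"]) (auto intro: compact_Int)
  qed
  ultimately show ?thesis by simp
qed

lemma sigma_compact_surface:
  assumes "surface_atlas N U r"
  shows "sigma_compact N"
proof -
  have N: "N = (\<Union>i. r i ` U i)" and "\<And>i. local_parametrization N (U i) (r i)"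
    using assms unfolding surface_atlas_def by auto
  then have "open (U i)" "smooth_on (U i) (r i)" for i
    unfolding local_parametrization_def by auto
  then show ?thesis
    unfolding N
    by (intro sigma_compact_UN sigma_compact_continuous_image sigma_compact_open smooth_on_C1(3))
qed

text \<open>The set is a projection along the parameter \<open>t\<close> of the line. Over a compact
  range of parameters the projection of a closed set is closed; the ranges
  \<open>{- real n..real n}\<close> and the compact pieces \<open>K i\<close> are countably
  many.\<close>

lemma lines_meeting_borel:
  assumes "sigma_compact S"
  shows "{l. line_points l \<inter> S \<noteq> {}} \<in> sets borel"
proof -
  obtain K :: "nat \<Rightarrow> (real^3) set" where K: "\<And>i. compact (K i)" "S = (\<Union>i. K i)"
    using assms unfolding sigma_compact_def by auto
  have cl: "closed {l. \<exists>t. t \<in> {- real n..real n} \<and> (t, l) \<in> {(t, l). snd l + t *\<^sub>R fst l \<in> K i}}" for i n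
  proof (rule closed_compact_projection)
    have "closed ((\<lambda>w :: real \<times> (real^3) \<times> (real^3). snd (snd w) + fst w *\<^sub>R fst (snd w)) -` K i)"
      using K(1)[of i] by (intro closed_vimage compact_imp_closed continuous_intros)
    then show "closed {(t, l). snd l + t *\<^sub>R fst l \<in> K i}"
      by (simp add: vimage_def split_beta')
  qed simp
  have "{l. line_points l \<inter> S \<noteq> {}} =
      (\<Union>i. \<Union>n. {l. \<exists>t. t \<in> {- real n..real n} \<and> (t, l) \<in> {(t, l). snd l + t *\<^sub>R fst l \<in> K i}})"
  proof (intro set_eqI iffI)
    fix l
    assume "l \<in> {l. line_points l \<inter> S \<noteq> {}}"
    then obtain t i where t: "snd l + t *\<^sub>R fst l \<in> K i"
      unfolding line_points_def K(2) by auto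
    obtain n where "\<bar>t\<bar> \<le> real n" using real_arch_simple by blast
    with t show "l \<in> (\<Union>i. \<Union>n. {l. \<exists>t. t \<in> {- real n..real n} \<and> (t, l) \<in> {(t, l). snd l + t *\<^sub>R fst l \<in> K i}})"
      by (intro UN_I[of i, OF UNIV_I] UN_I[of n, OF UNIV_I]) (auto intro!: exI[of _ t] simp: abs_le_iff)
  next
    fix l
    assume "l \<in> (\<Union>i. \<Union>n. {l. \<exists>t. t \<in> {- real n..real n} \<and> (t, l) \<in> {(t, l). snd l + t *\<^sub>R fst l \<in> K i}})"
    then show "l \<in> {l. line_points l \<inter> S \<noteq> {}}"
      unfolding line_points_def K(2) by auto
  qed
  also have "\<dots> \<in> sets borel"
    by (intro sets.countable_UN) (use cl borel_closed in auto)
  finally show ?thesis .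
qed

section \<open>Counting points by disjoint basic open sets\<close>

lemma finite_disjoint_basic_neighbourhoods:
  fixes F :: "'a::metric_space set"
  assumes B: "topological_basis B" and "finite F"
  obtains b where "\<And>x. x \<in> F \<Longrightarrow> b x \<in> B \<and> x \<in> b x" "disjoint_family_on b F"
proof -
  have "\<forall>x. \<exists>d>0. \<forall>y\<in>F. y \<noteq> x \<longrightarrow> d \<le> dist x y"
    using finite_set_avoid[OF \<open>finite F\<close>] by blast
  then obtain d where d: "\<And>x. d x > 0" "\<And>x y. y \<in> F \<Longrightarrow> y \<noteq> x \<Longrightarrow> d x \<le> dist x y" by metis
  have "\<forall>x. \<exists>b. b \<in> B \<and> x \<in> b \<and> b \<subseteq> ball x (d x / 2)"
    using topological_basisE[OF B open_ball] d(1) centre_in_ball half_gt_zero by metis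
  then obtain b where b: "\<And>x. b x \<in> B" "\<And>x. x \<in> b x" "\<And>x. b x \<subseteq> ball x (d x / 2)" by metis
  have "b x \<inter> b y = {}" if "x \<in> F" "y \<in> F" "x \<noteq> y" for x y
  proof (rule ccontr)
    assume "b x \<inter> b y \<noteq> {}"
    then obtain z where "dist x z < d x / 2" "dist y z < d y / 2" using b(3) by fastforce
    moreover have "d x \<le> dist x y" "d y \<le> dist x y"
      using d(2)[of y x] d(2)[of x y] that by (auto simp: dist_commute)
    ultimately show False
      using dist_triangle2[of x y z] by linarith
  qed
  then have "disjoint_family_on b F" by (auto simp: disjoint_family_on_def)
  with b that show thesis by blast
qed

text \<open>For a countable basis the supremum is countable, which makes the crossing number a measurable
  function of the line.\<close>

lemma emeasure_count_space_SUP: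
  fixes X :: "'a::metric_space set"
  assumes B: "topological_basis B"
  shows "emeasure (count_space UNIV) X =
    (SUP \<F>\<in>{\<F>. finite \<F> \<and> \<F> \<subseteq> B \<and> disjoint \<F>}. \<Sum>b\<in>\<F>. indicator {b. X \<inter> b \<noteq> {}} b)"
    (is "_ = ?S")
proof (rule antisym)
  have le: "ennreal (real (card F)) \<le> ?S" if F: "F \<subseteq> X" "finite F" for F
  proof -
    obtain b where b: "\<And>x. x \<in> F \<Longrightarrow> b x \<in> B \<and> x \<in> b x" "disjoint_family_on b F"
      using finite_disjoint_basic_neighbourhoods[OF B F(2)] by blast
    have inj: "inj_on b F"
    proof (rule inj_onI, rule ccontr)
      fix x y assume "x \<in> F" "y \<in> F" "b x = b y" "x \<noteq> y"
      with b(1)[of x] disjoint_family_onD[OF b(2), of x y] show False by auto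
    qed
    have "disjoint (b ` F)"
      using disjoint_family_onD[OF b(2)] by (fastforce simp: disjoint_def)
    then have mem: "b ` F \<in> {\<F>. finite \<F> \<and> \<F> \<subseteq> B \<and> disjoint \<F>}"
      using b(1) F(2) by auto
    have "(\<Sum>c\<in>b ` F. indicator {c. X \<inter> c \<noteq> {}} c :: ennreal) = (\<Sum>c\<in>b ` F. 1)"
      using b(1) F(1) by (intro sum.cong) (auto simp: indicator_def)
    also have "\<dots> = ennreal (real (card F))"
      by (simp add: card_image[OF inj] ennreal_of_nat_eq_real_of_nat)
    finally show ?thesis
      using SUP_upper[OF mem, of "\<lambda>\<F>. \<Sum>b\<in>\<F>. indicator {b. X \<inter> b \<noteq> {}} b :: ennreal"] by (simp only:)
  qed
  show "emeasure (count_space UNIV) X \<le> ?S"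
  proof (cases "finite X")
    case True
    then show ?thesis
      using le[OF subset_refl True] unfolding ennreal_of_nat_eq_real_of_nat[symmetric]
      by (simp only: emeasure_count_space_finite[OF subset_UNIV True])
  next
    case False
    have "of_nat n \<le> ?S" for n
    proof -
      obtain F where F: "finite F" "card F = n" "F \<subseteq> X"
        using infinite_arbitrarily_large[OF False, of n] by blast
      show ?thesis
        using le[OF F(3,1)] unfolding F(2) ennreal_of_nat_eq_real_of_nat .
    qed
    then have "(SUP n. of_nat n :: ennreal) \<le> ?S"
      by (rule SUP_least)
    then have "?S = top"
      unfolding ennreal_SUP_of_nat_eq_top by (rule top_unique[THEN iffD1])
    then show ?thesis by (simp only: top_greatest)
  qed
  show "?S \<le> emeasure (count_space UNIV) X"
  proof (rule SUP_least)
    fix \<F> assume "\<F> \<in> {\<F>. finite \<F> \<and> \<F> \<subseteq> B \<and> disjoint \<F>}"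
    then have \<F>: "finite \<F>" "disjoint \<F>" by auto
    define \<G> where "\<G> = {b \<in> \<F>. X \<inter> b \<noteq> {}}"
    have "\<forall>b\<in>\<G>. \<exists>x. x \<in> X \<inter> b" by (auto simp: \<G>_def)
    \<comment> \<open>A point of \<open>X\<close> is chosen in every member that meets
      \<open>X\<close>. Disjointness makes the chosen points distinct, so the sum cannot exceed the
      number of points of \<open>X\<close>.\<close>
    then obtain p where p: "\<And>b. b \<in> \<G> \<Longrightarrow> p b \<in> X \<inter> b" by metis
    have inj: "inj_on p \<G>"
    proof (rule inj_onI)
      fix b c assume "b \<in> \<G>" "c \<in> \<G>" "p b = p c"
      then have "p b \<in> b \<inter> c" "b \<in> \<F>" "c \<in> \<F>" using p[of b] p[of c] by (auto simp: \<G>_def)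
      then show "b = c" using \<F>(2) unfolding disjoint_def by blast
    qed
    have fin: "finite \<G>" using \<F>(1) by (simp add: \<G>_def)
    have "(\<Sum>b\<in>\<F>. indicator {b. X \<inter> b \<noteq> {}} b :: ennreal) = (\<Sum>b\<in>\<G>. 1)"
      using \<F>(1) by (intro sum.mono_neutral_cong_right) (auto simp: \<G>_def)
    also have "\<dots> = emeasure (count_space UNIV) (p ` \<G>)"
      using fin by (simp add: emeasure_count_space_finite card_image[OF inj])
    also have "\<dots> \<le> emeasure (count_space UNIV) X"
      using p by (intro emeasure_mono) auto
    finally show "(\<Sum>b\<in>\<F>. indicator {b. X \<inter> b \<noteq> {}} b) \<le> emeasure (count_space UNIV) X" .
  qed
qed

lemma crossing_number_measurable:
  assumes "sigma_compact N"
  shows "(\<lambda>l. crossing_number l N) \<in> borel_measurable borel"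
proof -
  obtain B :: "(real^3) set set" where B: "countable B" "topological_basis B"
    using ex_countable_basis by blast
  have ct: "countable {\<F>. finite \<F> \<and> \<F> \<subseteq> B \<and> disjoint \<F>}"
    by (rule countable_subset[OF _ countable_Collect_finite_subset[OF B(1)]]) auto
  have "(\<lambda>l. \<Sum>b\<in>\<F>. indicator {b. (line_points l \<inter> N) \<inter> b \<noteq> {}} b :: ennreal) \<in> borel_measurable borel"
    if "\<F> \<subseteq> B" for \<F>
  proof (rule borel_measurable_sum)
    fix b assume "b \<in> \<F>"
    then have "sigma_compact (N \<inter> b)"
      using that by (intro sigma_compact_Int assms sigma_compact_open topological_basis_open[OF B(2)]) auto
    then have [measurable]: "{l. line_points l \<inter> (N \<inter> b) \<noteq> {}} \<in> sets borel"
      by (rule lines_meeting_borel)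
    have "(\<lambda>l. indicator {l. line_points l \<inter> (N \<inter> b) \<noteq> {}} l :: ennreal) \<in> borel_measurable borel"
      by measurable
    also have "(\<lambda>l. indicator {l. line_points l \<inter> (N \<inter> b) \<noteq> {}} l :: ennreal) =
        (\<lambda>l. indicator {b. (line_points l \<inter> N) \<inter> b \<noteq> {}} b)"
      by (auto simp: indicator_def fun_eq_iff)
    finally show "(\<lambda>l. indicator {b. (line_points l \<inter> N) \<inter> b \<noteq> {}} b :: ennreal) \<in> borel_measurable borel" .
  qed
  then show ?thesis
    unfolding crossing_number_def emeasure_count_space_SUP[OF B(2)]
    by (intro borel_measurable_SUP ct) auto
qed

section \<open>The set of oriented lines\<close>

lemma closed_oriented_lines: "closed oriented_lines"
proof -
  have "closed {l :: (real^3) \<times> (real^3). norm (fst l) = 1 \<and> fst l \<bullet> snd l = 0}"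
    by (intro closed_Collect_conj closed_Collect_eq continuous_intros)
  then show ?thesis by (simp add: oriented_lines_def split_beta')
qed

lemma sets_oriented_lines [measurable]: "oriented_lines \<in> sets borel"
  using closed_oriented_lines by (rule borel_closed)

lemma sgn_line_oriented:
  fixes x y :: "real^3"
  assumes "x \<noteq> 0"
  shows "(sgn x, y - (y \<bullet> sgn x) *\<^sub>R sgn x) \<in> oriented_lines"
proof -
  have "sgn x \<bullet> sgn x = 1"
    using assms by (simp add: norm_sgn norm_eq_1[symmetric])
  then show ?thesis
    using assms by (simp add: oriented_lines_def norm_sgn inner_diff_right inner_commute)
qed

section \<open>The Cauchy--Crofton formula\<close>

definition perp :: "real^3 \<Rightarrow> real^3 \<Rightarrow> real^3" where
  "perp u v = v - (v \<bullet> u) *\<^sub>R u"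

lemma perp_linear: "linear (perp u)"
  by (auto intro!: linearI simp: perp_def algebra_simps)

lemma norm_perp_le:
  assumes "norm u = 1"
  shows "norm (perp u v) \<le> norm v"
proof -
  have "(norm (perp u v))\<^sup>2 = (norm v)\<^sup>2 - (v \<bullet> u)\<^sup>2"
    using assms unfolding power2_norm_eq_inner perp_def norm_eq_1
    by (simp add: inner_diff_left inner_diff_right inner_commute power2_eq_square)
  then show ?thesis
    by (metis diff_le_eq le_add_same_cancel1 norm_ge_zero power2_le_imp_le zero_le_power2)
qed

lemma perp_perp:
  assumes "norm u = 1"
  shows "perp u (perp u v + c *\<^sub>R u) = perp u v"
  using assms by (simp add: perp_def norm_eq_1 inner_add_left inner_diff_left algebra_simps)

section \<open>Area distortion and local injectivity of a projection\<close>

abbreviation partial_s :: "(real \<times> real \<Rightarrow> real^3) \<Rightarrow> real \<times> real \<Rightarrow> real^3" where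
  "partial_s r w \<equiv> frechet_derivative r (at w) (1, 0)"

abbreviation partial_t :: "(real \<times> real \<Rightarrow> real^3) \<Rightarrow> real \<times> real \<Rightarrow> real^3" where
  "partial_t r w \<equiv> frechet_derivative r (at w) (0, 1)"

text \<open>For a unit vector \<open>u\<close> this is the factor by which the chart followed by the
  projection along \<open>u\<close> distorts area. It vanishes exactly where that composite fails to
  be an immersion.\<close>

definition jac :: "(real \<times> real \<Rightarrow> real^3) \<Rightarrow> real^3 \<Rightarrow> real \<times> real \<Rightarrow> real" where
  "jac r u w = \<bar>u \<bullet> cross3 (partial_s r w) (partial_t r w)\<bar>"

lemma frechet_derivative_partials:
  fixes r :: "real \<times> real \<Rightarrow> real^3"
  assumes "r differentiable at w"
  shows "frechet_derivative r (at w) (a, b) = a *\<^sub>R partial_s r w + b *\<^sub>R partial_t r w"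
proof -
  have lin: "linear (frechet_derivative r (at w))"
    by (rule linear_frechet_derivative[OF assms])
  have "frechet_derivative r (at w) (a, b) = frechet_derivative r (at w) (a *\<^sub>R (1, 0) + b *\<^sub>R (0, 1))" by simp
  then show ?thesis
    unfolding linear_add[OF lin] linear_scale[OF lin] .
qed

lemma smooth_on_differentiable:
  assumes "smooth_on U r" "w \<in> U"
  shows "r differentiable at w"
  using smooth_on_C1(1)[OF assms] by (auto simp: differentiable_def)

text \<open>A nonzero \<open>jac\<close> means that the tangent plane does not contain
  \<open>u\<close>, so the projected derivative is injective and a continuously differentiable map
  is injective nearby. Boundedness of the image is recorded because the measure of the swept image
  has to be finite later.\<close>

lemma locally_injective_projection:
  fixes r :: "real \<times> real \<Rightarrow> real^3"
  assumes U: "open U" "smooth_on U r" "w0 \<in> U" and u: "norm u = 1" and J: "jac r u w0 \<noteq> 0"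
  obtains e where "e > 0" "ball w0 e \<subseteq> U" "inj_on (\<lambda>w. perp u (r w)) (ball w0 e)" "bounded (r ` ball w0 e)"
proof -
  let ?f' = "\<lambda>w v. perp u (frechet_derivative r (at w) v)"
  have bl: "bounded_linear (perp u)"
    using perp_linear by (simp add: linear_conv_bounded_linear)
  have der: "((\<lambda>w. perp u (r w)) has_derivative ?f' w) (at w)" if "w \<in> U" for w
    by (rule bounded_linear.has_derivative[OF bl smooth_on_C1(1)[OF U(2) that]])
  have lin: "linear (?f' w)" if "w \<in> U" for w
    using der[OF that] has_derivative_linear by blast
  define \<alpha> \<beta> where "\<alpha> = partial_s r w0" and "\<beta> = partial_t r w0"
  have inj: "inj (?f' w0)"
  proof (subst linear_injective_0[OF lin[OF U(3)]], intro allI impI)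
    fix v assume v: "?f' w0 v = 0"
    obtain a b where ab: "v = (a, b)" by (cases v)
    from v have eq: "a *\<^sub>R \<alpha> + b *\<^sub>R \<beta> = ((a *\<^sub>R \<alpha> + b *\<^sub>R \<beta>) \<bullet> u) *\<^sub>R u"
      unfolding ab frechet_derivative_partials[OF smooth_on_differentiable[OF U(2,3)], of a b] perp_def \<alpha>_def \<beta>_def
      by (simp only: right_minus_eq)
    \<comment> \<open>Pairing a vanishing projected combination with \<open>cross3 \<beta> u\<close>
      removes both \<open>\<beta>\<close> and the direction \<open>u\<close> and leaves
      \<open>a\<close> times the nonzero triple product; \<open>cross3 \<alpha> u\<close> isolates
      \<open>b\<close> in the same way.\<close>
    have t: "\<alpha> \<bullet> cross3 \<beta> u = u \<bullet> cross3 \<alpha> \<beta>" "\<beta> \<bullet> cross3 \<alpha> u = - (u \<bullet> cross3 \<alpha> \<beta>)"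
      by (simp_all add: cross3_simps)
    have "a * (\<alpha> \<bullet> cross3 \<beta> u) = 0"
      using arg_cong[OF eq, of "\<lambda>x. x \<bullet> cross3 \<beta> u"] by (simp add: inner_add_left dot_cross_self)
    moreover have "b * (\<beta> \<bullet> cross3 \<alpha> u) = 0"
      using arg_cong[OF eq, of "\<lambda>x. x \<bullet> cross3 \<alpha> u"] by (simp add: inner_add_left dot_cross_self)
    ultimately show "v = 0"
      using J unfolding t jac_def \<alpha>_def[symmetric] \<beta>_def[symmetric] by (simp add: ab zero_prod_def)
  qed
  obtain g' where g': "linear g'" "g' \<circ> ?f' w0 = id"
    using linear_injective_left_inverse[OF lin[OF U(3)] inj] by blast
  \<comment> \<open>Continuity of the derivative in operator norm, assembled from the continuity of
    the two partial derivatives. Each contributes at most \<open>e / 3\<close>, which leaves the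
    slack for the strict inequality.\<close>
  have cont: "\<exists>d>0. \<forall>x. dist w0 x < d \<longrightarrow> onorm (\<lambda>v. ?f' x v - ?f' w0 v) < e" if "e > 0" for e
  proof -
    have at: "isCont (partial_s r) w0" "isCont (partial_t r) w0"
      using smooth_on_C1(2)[OF U(2)] U(1,3) continuous_on_eq_continuous_at by blast+
    obtain d1 where d1: "d1 > 0" "\<And>x. dist x w0 < d1 \<Longrightarrow> dist (partial_s r x) \<alpha> < e / 3"
      using at(1) \<open>e > 0\<close> unfolding continuous_at_eps_delta \<alpha>_def dist_norm
      by (metis divide_pos_pos zero_less_numeral)
    obtain d2 where d2: "d2 > 0" "\<And>x. dist x w0 < d2 \<Longrightarrow> dist (partial_t r x) \<beta> < e / 3"
      using at(2) \<open>e > 0\<close> unfolding continuous_at_eps_delta \<beta>_def dist_norm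
      by (metis divide_pos_pos zero_less_numeral)
    obtain d3 where d3: "d3 > 0" "ball w0 d3 \<subseteq> U"
      using U(1,3) open_contains_ball by blast
    show ?thesis
    proof (intro exI[of _ "min d1 (min d2 d3)"] conjI allI impI)
      fix x assume x: "dist w0 x < min d1 (min d2 d3)"
      then have xU: "x \<in> U" using d3(2) by auto
      have "norm (?f' x v - ?f' w0 v) \<le> (2 * e / 3) * norm v" for v
      proof -
        obtain a b where ab: "v = (a, b)" by (cases v)
        have n: "norm (partial_s r x - \<alpha>) \<le> e / 3" "norm (partial_t r x - \<beta>) \<le> e / 3"
          using d1(2)[of x] d2(2)[of x] x by (auto simp: dist_norm dist_commute norm_minus_commute)
        have "?f' x v - ?f' w0 v = perp u (a *\<^sub>R (partial_s r x - \<alpha>) + b *\<^sub>R (partial_t r x - \<beta>))"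
          unfolding ab frechet_derivative_partials[OF smooth_on_differentiable[OF U(2,3)], of a b]
            frechet_derivative_partials[OF smooth_on_differentiable[OF U(2) xU], of a b] \<alpha>_def \<beta>_def
            linear_diff[OF perp_linear, symmetric] by (simp add: algebra_simps)
        then have "norm (?f' x v - ?f' w0 v) \<le> norm (a *\<^sub>R (partial_s r x - \<alpha>) + b *\<^sub>R (partial_t r x - \<beta>))"
          by (simp add: norm_perp_le[OF u])
        also have "\<dots> \<le> \<bar>a\<bar> * norm (partial_s r x - \<alpha>) + \<bar>b\<bar> * norm (partial_t r x - \<beta>)"
          by (rule norm_triangle_le) simp
        also have "\<dots> \<le> norm v * (e / 3) + norm v * (e / 3)"
          using norm_fst_le[of a b] norm_snd_le[of b a] n unfolding ab
          by (intro add_mono mult_mono) auto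
        finally show ?thesis by (simp add: algebra_simps)
      qed
      then have "onorm (\<lambda>v. ?f' x v - ?f' w0 v) \<le> 2 * e / 3" by (rule onorm_le)
      also have "\<dots> < e" using \<open>e > 0\<close> by simp
      finally show "onorm (\<lambda>v. ?f' x v - ?f' w0 v) < e" .
    qed (use d1(1) d2(1) d3(1) in auto)
  qed
  obtain e1 where e1: "e1 > 0" "ball w0 e1 \<subseteq> U" "inj_on (\<lambda>w. perp u (r w)) (ball w0 e1)"
    using has_derivative_locally_injective[OF U(3,1) _ g'(2) der cont] g'(1)
    by (metis linear_conv_bounded_linear)
  have "isCont r w0"
    using smooth_on_C1(3)[OF U(2)] U(1,3) continuous_on_eq_continuous_at by blast
  then obtain e2 where e2: "e2 > 0" "\<And>x. dist x w0 < e2 \<Longrightarrow> dist (r x) (r w0) < 1"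
    unfolding continuous_at_eps_delta dist_norm by (metis zero_less_one)
  have "r ` ball w0 e2 \<subseteq> ball (r w0) 1"
    using e2(2) by (auto simp: dist_commute)
  then have "bounded (r ` ball w0 e2)"
    using bounded_ball bounded_subset by blast
  then show thesis
    using e1 e2(1) by (intro that[of "min e1 e2"])
      (auto intro: bounded_subset[of "r ` ball w0 e2"] inj_on_subset[OF e1(3)])
qed

section \<open>Projected area as a volume\<close>

text \<open>\<open>sweep r u\<close> extends the projection of the surface along \<open>u\<close> by a coordinate in the direction \<open>u\<close>,
  so that the projected area becomes a volume in \<open>real^3\<close>, where the change of variables theorem and
  Sard's theorem are available.\<close>

definition sweep :: "(real \<times> real \<Rightarrow> real^3) \<Rightarrow> real^3 \<Rightarrow> real^3 \<Rightarrow> real^3" where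
  "sweep r u z = perp u (r (z$1, z$2)) + (z$3) *\<^sub>R u"

text \<open>The height range from 0 to 1 matches the cylinder of height 1 by which
  \<open>line_measure\<close> expresses area in the complement of \<open>u\<close>.\<close>

definition slab :: "(real \<times> real) set \<Rightarrow> (real^3) set" where
  "slab V = {z. (z$1, z$2) \<in> V \<and> 0 \<le> z$3 \<and> z$3 \<le> 1}"

definition sweep' :: "(real \<times> real \<Rightarrow> real^3) \<Rightarrow> real^3 \<Rightarrow> real^3 \<Rightarrow> real^3 \<Rightarrow> real^3" where
  "sweep' r u z = (\<lambda>h. perp u (frechet_derivative r (at (z$1, z$2)) (h$1, h$2)) + (h$3) *\<^sub>R u)"

lemma sweep_has_derivative:
  assumes "r differentiable at (z$1, z$2)"
  shows "(sweep r u has_derivative sweep' r u z) (at z within S)"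
proof -
  have bl: "bounded_linear (perp u)"
    using perp_linear by (simp add: linear_conv_bounded_linear)
  have p: "((\<lambda>z::real^3. (z$1, z$2)) has_derivative (\<lambda>z. (z$1, z$2))) (at z)"
    by (intro has_derivative_Pair bounded_linear_imp_has_derivative bounded_linear_vec_nth)
  have "((\<lambda>z. r (z$1, z$2)) has_derivative (\<lambda>h. frechet_derivative r (at (z$1, z$2)) (h$1, h$2))) (at z)"
    using has_derivative_compose[OF p frechet_derivative_works[THEN iffD1, OF assms]] .
  then have "((\<lambda>z. perp u (r (z$1, z$2)) + (z$3) *\<^sub>R u) has_derivative sweep' r u z) (at z)"
    unfolding sweep'_def
    by (intro has_derivative_add bounded_linear.has_derivative[OF bl] has_derivative_scaleR_left
        bounded_linear_imp_has_derivative bounded_linear_vec_nth)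
  then show ?thesis
    unfolding sweep_def[abs_def] by (rule has_derivative_at_withinI)
qed

text \<open>The columns are the projections of the two partial derivatives and \<open>u\<close>
  itself. The components along \<open>u\<close> that the projections remove are multiples of the
  third column, so the determinant is the full triple product up to sign.\<close>

lemma det_sweep':
  assumes "r differentiable at (z$1, z$2)"
  shows "\<bar>det (matrix (sweep' r u z))\<bar> = jac r u (z$1, z$2)"
proof -
  define \<alpha> \<beta> where "\<alpha> = partial_s r (z$1, z$2)" and "\<beta> = partial_t r (z$1, z$2)"
  have d: "sweep' r u z h = perp u (h$1 *\<^sub>R \<alpha> + h$2 *\<^sub>R \<beta>) + (h$3) *\<^sub>R u" for h
    unfolding sweep'_def frechet_derivative_partials[OF assms, of "h$1" "h$2"] \<alpha>_def \<beta>_def ..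
  have c: "sweep' r u z (axis 1 1) = perp u \<alpha>" "sweep' r u z (axis 2 1) = perp u \<beta>" "sweep' r u z (axis 3 1) = u"
    unfolding d by (simp_all add: axis_def perp_def)
  have "det (matrix (sweep' r u z)) = perp u \<alpha> \<bullet> cross3 (perp u \<beta>) u"
    unfolding det_3 matrix_def using c by (simp add: cross3_def inner_vec_def sum_3 algebra_simps)
  also have "\<dots> = u \<bullet> cross3 \<alpha> \<beta>"
  proof -
    have "cross3 (perp u \<beta>) u = cross3 \<beta> u"
      unfolding perp_def by (simp add: cross3_simps)
    moreover have "perp u \<alpha> \<bullet> cross3 \<beta> u = \<alpha> \<bullet> cross3 \<beta> u"
      unfolding perp_def by (simp add: inner_diff_left dot_cross_self)
    moreover have "\<alpha> \<bullet> cross3 \<beta> u = u \<bullet> cross3 \<alpha> \<beta>" by (simp add: cross3_simps)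
    ultimately show ?thesis by simp
  qed
  finally show ?thesis by (simp add: jac_def \<alpha>_def \<beta>_def)
qed

lemma slab_borel:
  assumes [measurable]: "V \<in> sets borel"
  shows "slab V \<in> sets borel"
proof -
  have [measurable]: "(\<lambda>z::real^3. (z$1, z$2)) \<in> borel_measurable borel"
    by (intro borel_measurable_continuous_onI continuous_intros)
  have "slab V = (\<lambda>z. (z$1, z$2)) -` V \<inter> {z. 0 \<le> z$3} \<inter> {z. z$3 \<le> 1}"
    by (auto simp: slab_def)
  also have "\<dots> \<in> sets borel"
    using measurable_sets_borel[of "\<lambda>z::real^3. (z$1, z$2)" borel V]
    by (intro sets.Int) (auto intro!: borel_closed closed_Collect_le continuous_intros)
  finally show ?thesis .
qed

lemma nn_integral_slab:
  assumes [measurable]: "V \<in> sets borel" and [measurable]: "g \<in> borel_measurable borel"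
  shows "(\<integral>\<^sup>+ z. g (z$1, z$2) * indicator (slab V) z \<partial>lborel) = (\<integral>\<^sup>+ w. g w * indicator V w \<partial>lborel)"
proof -
  have [measurable]: "slab V \<in> sets borel" by (rule slab_borel[OF assms(1)])
  have [measurable]: "(\<lambda>z::real^3. (z$1, z$2)) \<in> borel_measurable borel"
    by (intro borel_measurable_continuous_onI continuous_intros)
  have v: "(a *\<^sub>R axis 1 1 + b *\<^sub>R axis 2 1 + c *\<^sub>R axis 3 1 :: real^3) $ 1 = a"
    "(a *\<^sub>R axis 1 1 + b *\<^sub>R axis 2 1 + c *\<^sub>R axis 3 1 :: real^3) $ 2 = b"
    "(a *\<^sub>R axis 1 1 + b *\<^sub>R axis 2 1 + c *\<^sub>R axis 3 1 :: real^3) $ 3 = c" for a b c :: real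
    by (simp_all add: axis_def)
  have "(\<integral>\<^sup>+ z. g (z$1, z$2) * indicator (slab V) z \<partial>lborel) =
    (\<integral>\<^sup>+ c. \<integral>\<^sup>+ a. \<integral>\<^sup>+ b. g (a, b) * indicator (slab V) (a *\<^sub>R axis 1 1 + b *\<^sub>R axis 2 1 + c *\<^sub>R axis 3 1) \<partial>lborel \<partial>lborel \<partial>lborel)"
    by (subst nn_integral_frame3[OF orthonormal3_axis]) (simp_all only: v, measurable)
  also have "\<dots> = (\<integral>\<^sup>+ c. \<integral>\<^sup>+ a. \<integral>\<^sup>+ b. indicator {0..1::real} c * (g (a, b) * indicator V (a, b)) \<partial>lborel \<partial>lborel \<partial>lborel)"
    by (intro nn_integral_cong) (auto simp: slab_def v indicator_def simp del: vector_add_component vector_scaleR_component)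
  also have "\<dots> = (\<integral>\<^sup>+ c. indicator {0..1::real} c * (\<integral>\<^sup>+ a. \<integral>\<^sup>+ b. g (a, b) * indicator V (a, b) \<partial>lborel \<partial>lborel) \<partial>lborel)"
    by (simp add: nn_integral_cmult borel_prod[symmetric])
  also have "\<dots> = (\<integral>\<^sup>+ w. g w * indicator V w \<partial>lborel)"
    by (subst nn_integral_lborel_pair(1)) (simp_all add: nn_integral_multc)
  finally show ?thesis .
qed

lemma jac_continuous:
  assumes "smooth_on U r"
  shows "continuous_on U (jac r u)"
  unfolding jac_def
  by (intro continuous_intros continuous_on_cross smooth_on_C1(2)[OF assms])

lemma jac_indicator_measurable:
  assumes "smooth_on U r" "V \<subseteq> U" "V \<in> sets borel"
  shows "(\<lambda>w. ennreal (jac r u w) * indicator V w) \<in> borel_measurable borel"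
proof -
  have "(\<lambda>w. indicator V w *\<^sub>R jac r u w) \<in> borel_measurable borel"
    using borel_measurable_continuous_on_indicator[OF assms(3) continuous_on_subset[OF jac_continuous[OF assms(1)] assms(2)]] .
  then have "(\<lambda>w. ennreal (indicator V w *\<^sub>R jac r u w)) \<in> borel_measurable borel" by measurable
  also have "(\<lambda>w. ennreal (indicator V w *\<^sub>R jac r u w)) = (\<lambda>w. ennreal (jac r u w) * indicator V w)"
    by (auto simp: indicator_def)
  finally show ?thesis .
qed

lemma emeasure_count_space_inj_image:
  assumes "inj_on f A"
  shows "emeasure (count_space UNIV) (f ` A) = emeasure (count_space UNIV) A"
  using assms by (cases "finite A") (simp_all add: finite_image_iff emeasure_count_space_finite card_image)

lemma sweep_inner:
  assumes "norm u = 1"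
  shows "sweep r u z \<bullet> u = z$3" "perp u (sweep r u z) = perp u (r (z$1, z$2))"
  using assms by (simp_all add: sweep_def perp_perp) (simp add: perp_def norm_eq_1 inner_add_left inner_diff_left)

lemma vec3_eqI: "x$1 = y$1 \<Longrightarrow> x$2 = y$2 \<Longrightarrow> x$3 = y$3 \<Longrightarrow> x = (y :: 'a^3)"
  by (simp add: vec_eq_iff forall_3)

lemma sweep_image_slab:
  assumes u: "norm u = 1"
  shows "y \<in> sweep r u ` slab V \<longleftrightarrow> y \<bullet> u \<in> {0..1} \<and> (\<exists>w\<in>V. perp u (r w) = perp u y)"
proof
  assume "y \<in> sweep r u ` slab V"
  then obtain z where z: "y = sweep r u z" "z \<in> slab V" by blast
  then show "y \<bullet> u \<in> {0..1} \<and> (\<exists>w\<in>V. perp u (r w) = perp u y)"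
    using sweep_inner[OF u, of r z] by (auto simp: slab_def)
next
  assume "y \<bullet> u \<in> {0..1} \<and> (\<exists>w\<in>V. perp u (r w) = perp u y)"
  then obtain w where w: "w \<in> V" "perp u (r w) = perp u y" "y \<bullet> u \<in> {0..1}" by blast
  define z :: "real^3" where "z = vector [fst w, snd w, y \<bullet> u]"
  have "sweep r u z = y"
    using w(2) by (simp add: sweep_def z_def perp_def)
  moreover have "z \<in> slab V"
    using w(1,3) by (simp add: slab_def z_def)
  ultimately show "y \<in> sweep r u ` slab V" by blast
qed

text \<open>Injectivity of the projection on \<open>V\<close> and the separate height coordinate
  make the sweep injective on the slab, so the change of variables theorem gives the volume of its
  image. Since the slab has height 1, the volume integral reduces to a plane integral.\<close>

lemma sweep_image_injective:
  assumes U: "smooth_on U r" "V \<subseteq> U" "V \<in> sets borel" and u: "norm u = 1"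
    and inj: "inj_on (\<lambda>w. perp u (r w)) V" and bd: "bounded (r ` V)"
  shows "sweep r u ` slab V \<in> sets lebesgue"
    and "emeasure lebesgue (sweep r u ` slab V) = (\<integral>\<^sup>+ w. ennreal (jac r u w) * indicator V w \<partial>lborel)"
proof -
  let ?S = "slab V" and ?F = "sweep r u"
  have S: "?S \<in> sets lebesgue" using slab_borel[OF U(3)] by simp
  have diff: "r differentiable at (z$1, z$2)" if "z \<in> ?S" for z
    using that U(2) smooth_on_differentiable[OF U(1)] by (auto simp: slab_def)
  have der: "(?F has_derivative sweep' r u z) (at z within ?S)" if "z \<in> ?S" for z
    by (rule sweep_has_derivative[OF diff[OF that]])
  show leb: "?F ` ?S \<in> sets lebesgue"
    using der by (intro differentiable_image_in_sets_lebesgue S) (auto simp: differentiable_on_def differentiable_def)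
  have inj': "inj_on ?F ?S"
  proof (rule inj_onI)
    fix z z' assume z: "z \<in> ?S" "z' \<in> ?S" "?F z = ?F z'"
    then have "z$3 = z'$3" "perp u (r (z$1, z$2)) = perp u (r (z'$1, z'$2))"
      using sweep_inner[OF u, of r z] sweep_inner[OF u, of r z'] by metis+
    moreover from this have "(z$1, z$2) = (z'$1, z'$2)"
      using z inj by (auto simp: slab_def inj_on_def)
    ultimately show "z = z'" by (intro vec3_eqI) auto
  qed
  \<comment> \<open>A bounded image has finite measure, as the change of variables theorem for
    \<open>has_integral\<close> demands; the slab itself may be unbounded.\<close>
  obtain M where M: "\<And>w. w \<in> V \<Longrightarrow> norm (r w) \<le> M"
    using bd unfolding bounded_iff by auto
  have "norm (?F z) \<le> M + 1" if "z \<in> ?S" for z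
  proof -
    have "norm (?F z) \<le> norm (perp u (r (z$1, z$2))) + norm ((z$3) *\<^sub>R u)"
      unfolding sweep_def by (rule norm_triangle_ineq)
    also have "\<dots> \<le> M + 1"
      using that M norm_perp_le[OF u, of "r (z$1, z$2)"] u
      by (intro add_mono order_trans[OF norm_perp_le[OF u]]) (auto simp: slab_def)
    finally show ?thesis .
  qed
  then have "bounded (?F ` ?S)" unfolding bounded_iff by blast
  then have lm: "?F ` ?S \<in> lmeasurable"
    using leb bounded_set_imp_lmeasurable by blast
  then have hi: "((\<lambda>z. \<bar>det (matrix (sweep' r u z))\<bar>) has_integral measure lebesgue (?F ` ?S)) ?S"
    using has_measure_differentiable_image[OF S der inj'] by blast
  have "emeasure lebesgue (?F ` ?S) = ennreal (measure lebesgue (?F ` ?S))"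
    using lm by (simp add: emeasure_eq_measure2)
  also have "\<dots> = (\<integral>\<^sup>+ z. ennreal \<bar>det (matrix (sweep' r u z))\<bar> * indicator ?S z \<partial>lborel)"
    by (rule nn_integral_has_integral_lebesgue'[OF _ hi, symmetric]) simp
  also have "\<dots> = (\<integral>\<^sup>+ z. (ennreal (jac r u (z$1, z$2)) * indicator V (z$1, z$2)) * indicator ?S z \<partial>lborel)"
  proof (rule nn_integral_cong)
    fix z :: "real^3"
    show "ennreal \<bar>det (matrix (sweep' r u z))\<bar> * indicator ?S z =
        (ennreal (jac r u (z$1, z$2)) * indicator V (z$1, z$2)) * indicator ?S z"
      by (cases "z \<in> ?S") (auto simp: det_sweep'[OF diff], simp add: slab_def)
  qed
  also have "\<dots> = (\<integral>\<^sup>+ w. (ennreal (jac r u w) * indicator V w) * indicator V w \<partial>lborel)"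
    by (rule nn_integral_slab[OF U(3) jac_indicator_measurable[OF U]])
  also have "\<dots> = (\<integral>\<^sup>+ w. ennreal (jac r u w) * indicator V w \<partial>lborel)"
    by (intro nn_integral_cong) (auto simp: indicator_def)
  finally show "emeasure lebesgue (?F ` ?S) = (\<integral>\<^sup>+ w. ennreal (jac r u w) * indicator V w \<partial>lborel)" .
qed

text \<open>Points where the surface is tangent to \<open>u\<close> may be hit by lines of direction
  \<open>u\<close> arbitrarily often, but by Sard's theorem almost no line of this direction meets
  them.\<close>

lemma sweep_image_critical:
  assumes U: "smooth_on U r" "V \<subseteq> U" and J: "\<And>w. w \<in> V \<Longrightarrow> jac r u w = 0"
  shows "negligible (sweep r u ` slab V)"
proof (rule baby_Sard)
  fix z assume z: "z \<in> slab V"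
  then have "r differentiable at (z$1, z$2)"
    using U(2) smooth_on_differentiable[OF U(1)] by (auto simp: slab_def)
  note d = this
  show "(sweep r u has_derivative sweep' r u z) (at z within slab V)"
    by (rule sweep_has_derivative[OF d])
  show "rank (matrix (sweep' r u z)) < CARD(3)"
    unfolding det_eq_0_rank[symmetric] using det_sweep'[OF d, of u] J z by (auto simp: slab_def)
qed simp

section \<open>The area formula for the projection along a fixed direction\<close>

lemma countable_injective_cover:
  assumes U: "open U" "smooth_on U r" and u: "norm u = 1"
  obtains B :: "nat \<Rightarrow> (real \<times> real) set" where
    "\<And>j. open (B j)" "\<And>j. B j \<subseteq> U" "\<And>j. inj_on (\<lambda>w. perp u (r w)) (B j)" "\<And>j. bounded (r ` B j)"
    "{w \<in> U. jac r u w \<noteq> 0} \<subseteq> (\<Union>j. B j)"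
proof -
  define \<B> where "\<B> = {B. open B \<and> B \<subseteq> U \<and> inj_on (\<lambda>w. perp u (r w)) B \<and> bounded (r ` B)}"
  obtain \<B>' where B': "\<B>' \<subseteq> \<B>" "countable \<B>'" "\<Union>\<B>' = \<Union>\<B>"
    using Lindelof[of \<B>] unfolding \<B>_def by blast
  define \<C> where "\<C> = insert {} \<B>'"
  have C: "\<C> \<subseteq> \<B>" "countable \<C>" "\<C> \<noteq> {}" "\<Union>\<C> = \<Union>\<B>"
    using B' by (auto simp: \<C>_def \<B>_def)
  have mem: "from_nat_into \<C> j \<in> \<B>" for j
    using from_nat_into[OF C(3)] C(1) by blast
  show thesis
  proof (rule that[of "from_nat_into \<C>"])
    show "{w \<in> U. jac r u w \<noteq> 0} \<subseteq> (\<Union>j. from_nat_into \<C> j)"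
    proof
      fix w assume "w \<in> {w \<in> U. jac r u w \<noteq> 0}"
      then obtain e where "e > 0" "ball w e \<subseteq> U" "inj_on (\<lambda>w. perp u (r w)) (ball w e)" "bounded (r ` ball w e)"
        using locally_injective_projection[OF U _ u] by blast
      then have "ball w e \<in> \<B>" "w \<in> ball w e" by (auto simp: \<B>_def)
      then have "w \<in> \<Union>\<C>" using C(4) by blast
      then show "w \<in> (\<Union>j. from_nat_into \<C> j)"
        using range_from_nat_into[OF C(3,2)] by simp
    qed
  qed (use mem in \<open>auto simp: \<B>_def\<close>)
qed

lemma crossing_number_image:
  assumes u: "norm u = 1" and inj: "inj_on r V"
  shows "crossing_number (u, perp u y) (r ` V) = emeasure (count_space UNIV) {w \<in> V. perp u (r w) = perp u y}"
proof -
  have "q \<in> line_points (u, perp u y) \<longleftrightarrow> perp u q = perp u y" for q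
  proof
    assume "q \<in> line_points (u, perp u y)"
    then show "perp u q = perp u y"
      using perp_perp[OF u] by (auto simp: line_points_def)
  next
    assume "perp u q = perp u y"
    then have "q = perp u y + (q \<bullet> u) *\<^sub>R u" by (simp add: perp_def algebra_simps)
    then show "q \<in> line_points (u, perp u y)" unfolding line_points_def by auto
  qed
  then have "line_points (u, perp u y) \<inter> r ` V = r ` {w \<in> V. perp u (r w) = perp u y}" by auto
  then show ?thesis
    unfolding crossing_number_def
    using emeasure_count_space_inj_image[OF inj_on_subset[OF inj]] by auto
qed

lemma projection_area_formula:
  assumes U: "open U" "smooth_on U r" "inj_on r U" and V: "V \<subseteq> U" "V \<in> sets borel" and u: "norm u = 1"
  obtains g where "g \<in> borel_measurable lebesgue"
    "AE y in lebesgue. indicator {0..1} (y \<bullet> u) * crossing_number (u, perp u y) (r ` V) = g y"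
    "(\<integral>\<^sup>+ y. g y \<partial>lebesgue) = (\<integral>\<^sup>+ w. ennreal (jac r u w) * indicator V w \<partial>lborel)"
proof -
  obtain B :: "nat \<Rightarrow> (real \<times> real) set" where
    B: "\<And>j. open (B j)" "\<And>j. B j \<subseteq> U" "\<And>j. inj_on (\<lambda>w. perp u (r w)) (B j)" "\<And>j. bounded (r ` B j)"
    "{w \<in> U. jac r u w \<noteq> 0} \<subseteq> (\<Union>j. B j)"
    using countable_injective_cover[OF U(1,2) u] by blast
  define W where "W j = V \<inter> disjointed B j" for j
  define Z where "Z = V - (\<Union>j. B j)"
  have "disjointed B j \<in> sets borel" for j
  proof -
    have "range B \<subseteq> sets borel" using B(1) borel_open by blast
    then show ?thesis using sets.range_disjointed_sets'[of B borel] by blast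
  qed
  then have W: "W j \<in> sets borel" "W j \<subseteq> U" "W j \<subseteq> B j" "W j \<subseteq> V" for j
    using V disjointed_subset[of B j] by (auto simp: W_def)
  have Wdisj: "disjoint_family W"
    using disjoint_family_disjointed[of B] by (auto simp: disjoint_family_on_def W_def)
  have VW: "V = (\<Union>j. W j) \<union> Z"
    unfolding W_def Z_def using UN_disjointed_eq[of B] by auto
  have Winj: "inj_on (\<lambda>w. perp u (r w)) (W j)" "bounded (r ` W j)" for j
    using inj_on_subset[OF B(3) W(3)] bounded_subset[OF B(4) image_mono[OF W(3)]] by auto
  have J0: "jac r u w = 0" if "w \<in> Z" for w
    using that B(5) V(1) by (auto simp: Z_def)
  let ?A = "\<lambda>j. sweep r u ` slab (W j)"
  have A: "?A j \<in> sets lebesgue"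
    "emeasure lebesgue (?A j) = (\<integral>\<^sup>+ w. ennreal (jac r u w) * indicator (W j) w \<partial>lborel)" for j
    using sweep_image_injective[OF U(2) W(2,1) u Winj] by auto
  have null: "sweep r u ` slab Z \<in> null_sets lebesgue"
  proof -
    have "Z \<subseteq> U" using V(1) by (auto simp: Z_def)
    from sweep_image_critical[OF U(2) this J0] show ?thesis
      unfolding negligible_iff_null_sets .
  qed
  show thesis
  proof (rule that)
    show "(\<lambda>y. \<Sum>j. indicator (?A j) y :: ennreal) \<in> borel_measurable lebesgue"
      using A(1) by measurable
    have eq: "indicator {0..1} (y \<bullet> u) * crossing_number (u, perp u y) (r ` V) = (\<Sum>j. indicator (?A j) y)"
      if y: "y \<notin> sweep r u ` slab Z" for y
    proof (cases "y \<bullet> u \<in> {0..1}")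
      case False
      then have "y \<notin> ?A j" for j
        unfolding sweep_image_slab[OF u] by blast
      then have "(\<Sum>j. indicator (?A j) y :: ennreal) = 0" by simp
      with False show ?thesis by simp
    next
      case True
      let ?P = "\<lambda>T. {w \<in> T. perp u (r w) = perp u y}"
      have "?P Z = {}" using y True by (auto simp: sweep_image_slab[OF u])
      then have "?P V = (\<Union>j. ?P (W j))" using VW by auto
      moreover have "disjoint_family (\<lambda>j. ?P (W j))"
        using Wdisj by (auto simp: disjoint_family_on_def)
      ultimately have "emeasure (count_space UNIV) (?P V) = (\<Sum>j. emeasure (count_space UNIV) (?P (W j)))"
        by (simp add: suminf_emeasure[symmetric])
      also have "\<dots> = (\<Sum>j. indicator (?A j) y)"
      proof (rule suminf_cong)
        fix j
        show "emeasure (count_space UNIV) (?P (W j)) = indicator (?A j) y"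
        proof (cases "\<exists>w\<in>W j. perp u (r w) = perp u y")
          case True
          then obtain w where "w \<in> W j" "perp u (r w) = perp u y" by blast
          then have "?P (W j) = {w}"
            using Winj(1)[of j] by (auto simp: inj_on_def)
          then show ?thesis
            using True \<open>y \<bullet> u \<in> {0..1}\<close> by (simp add: sweep_image_slab[OF u] indicator_def)
        next
          case False
          then have none: "?P (W j) = {}" by blast
          have "y \<notin> ?A j" using False by (simp add: sweep_image_slab[OF u])
          then show ?thesis unfolding none by simp
        qed
      qed
      finally show ?thesis
        using True by (simp add: crossing_number_image[OF u inj_on_subset[OF U(3) V(1)]])
    qed
    show "AE y in lebesgue. indicator {0..1} (y \<bullet> u) * crossing_number (u, perp u y) (r ` V) = (\<Sum>j. indicator (?A j) y)"
      by (rule AE_I'[OF null]) (use eq in blast)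
    have "(\<integral>\<^sup>+ y. (\<Sum>j. indicator (?A j) y) \<partial>lebesgue) = (\<Sum>j. emeasure lebesgue (?A j))"
      using A(1) by (subst nn_integral_suminf) (simp_all add: borel_measurable_indicator)
    also have "\<dots> = (\<Sum>j. \<integral>\<^sup>+ w. ennreal (jac r u w) * indicator (W j) w \<partial>lborel)"
      by (simp add: A(2))
    also have "\<dots> = (\<integral>\<^sup>+ w. (\<Sum>j. ennreal (jac r u w) * indicator (W j) w) \<partial>lborel)"
      by (rule nn_integral_suminf[symmetric]) (simp add: jac_indicator_measurable[OF U(2) W(2,1)])
    also have "\<dots> = (\<integral>\<^sup>+ w. ennreal (jac r u w) * indicator V w \<partial>lborel)"
    proof (rule nn_integral_cong)
      fix w
      have "(\<Sum>j. indicator (W j) w :: ennreal) = indicator (\<Union>j. W j) w"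
        by (rule suminf_indicator[OF Wdisj])
      then show "(\<Sum>j. ennreal (jac r u w) * indicator (W j) w) = ennreal (jac r u w) * indicator V w"
        using J0 VW by (auto simp: indicator_def split: if_splits)
    qed
    finally show "(\<integral>\<^sup>+ y. (\<Sum>j. indicator (?A j) y) \<partial>lebesgue) = (\<integral>\<^sup>+ w. ennreal (jac r u w) * indicator V w \<partial>lborel)" .
  qed
qed

section \<open>Averaging over all directions\<close>

lemma orthonormal3_cross:
  assumes "e1 \<bullet> e1 = 1" "e2 \<bullet> e2 = 1" "e1 \<bullet> e2 = 0"
  shows "orthonormal3 e1 e2 (cross3 e1 e2)"
  using assms by (simp add: orthonormal3_def dot_cross dot_cross_self inner_commute)

lemma unit_orthogonal_vector:
  fixes e1 :: "real^3"
  obtains e2 where "e2 \<bullet> e2 = 1" "e1 \<bullet> e2 = 0"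
proof -
  obtain y where y: "y \<noteq> 0" "orthogonal e1 y"
    using orthogonal_to_vector_exists[of e1] by auto
  show thesis
  proof (rule that[of "sgn y"])
    show "sgn y \<bullet> sgn y = 1"
      unfolding norm_eq_1[symmetric] norm_sgn using y(1) by simp
    show "e1 \<bullet> sgn y = 0"
      using y(2) by (simp add: orthogonal_def sgn_div_norm)
  qed
qed

lemma sets_cball [measurable]: "cball (a :: real^3) e \<in> sets borel"
  by (simp add: borel_closed)

lemma sgn_vec_measurable [measurable]: "(sgn :: real^3 \<Rightarrow> real^3) \<in> borel_measurable borel"
  unfolding sgn_div_norm[abs_def] by measurable

text \<open>The integral over the unit sphere of the absolute cosine of the angle to a fixed axis,
  with the sphere measured by cones as in \<open>line_measure\<close>. Its value is
  \<open>2 * pi\<close>; the arguments below rely on its being finite and positive.\<close>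

definition crofton_const :: ennreal where
  "crofton_const = 3 * (\<integral>\<^sup>+ x. indicator (cball 0 1) x * ennreal \<bar>sgn x \<bullet> (axis 1 1 :: real^3)\<bar> \<partial>lborel)"

lemma nn_integral_abs_cosine:
  "3 * (\<integral>\<^sup>+ x. indicator (cball 0 1) x * ennreal \<bar>sgn x \<bullet> n\<bar> \<partial>lborel) = crofton_const * ennreal (norm (n :: real^3))"
proof (cases "n = 0")
  case False
  have [measurable]: "(\<lambda>x. indicator (cball 0 1) x * ennreal \<bar>sgn x \<bullet> e\<bar>) \<in> borel_measurable borel" for e :: "real^3"
    by measurable
  \<comment> \<open>In coordinates the integral no longer mentions the frame. Comparing a frame that
    starts with \<open>sgn n\<close> with the standard one shows that it does not depend on the
    direction of \<open>n\<close>.\<close>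
  have frame: "(\<integral>\<^sup>+ x. indicator (cball 0 1) x * ennreal \<bar>sgn x \<bullet> e1\<bar> \<partial>lborel) =
      (\<integral>\<^sup>+ c. \<integral>\<^sup>+ a. \<integral>\<^sup>+ b. indicator {..1} (sqrt (a\<^sup>2 + b\<^sup>2 + c\<^sup>2)) * ennreal \<bar>a / sqrt (a\<^sup>2 + b\<^sup>2 + c\<^sup>2)\<bar> \<partial>lborel \<partial>lborel \<partial>lborel)"
    if e: "orthonormal3 e1 e2 e3" for e1 e2 e3
  proof -
    have n: "norm (a *\<^sub>R e1 + b *\<^sub>R e2 + c *\<^sub>R e3) = sqrt (a\<^sup>2 + b\<^sup>2 + c\<^sup>2)" for a b c
      using norm_frame3[OF e, of a b c] by (simp add: frame3_def)
    have i: "(a *\<^sub>R e1 + b *\<^sub>R e2 + c *\<^sub>R e3) \<bullet> e1 = a" for a b c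
      using e by (simp add: orthonormal3_def inner_add_left inner_commute[of e2 e1] inner_commute[of e3 e1])
    show ?thesis
      by (subst nn_integral_frame3[OF e], measurable)
         (simp add: sgn_div_norm n i indicator_def divide_inverse_commute)
  qed
  have "sgn n \<bullet> sgn n = 1" using False by (simp add: norm_sgn norm_eq_1[symmetric])
  moreover obtain e2 where "e2 \<bullet> e2 = 1" "sgn n \<bullet> e2 = 0" by (rule unit_orthogonal_vector)
  ultimately have on: "orthonormal3 (sgn n) e2 (cross3 (sgn n) e2)" by (rule orthonormal3_cross)
  have eq: "(\<integral>\<^sup>+ x. indicator (cball 0 1) x * ennreal \<bar>sgn x \<bullet> sgn n\<bar> \<partial>lborel) =
      (\<integral>\<^sup>+ x. indicator (cball 0 1) x * ennreal \<bar>sgn x \<bullet> (axis 1 1 :: real^3)\<bar> \<partial>lborel)"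
    by (rule trans[OF frame[OF on] frame[OF orthonormal3_axis, symmetric]])
  have "n = norm n *\<^sub>R sgn n" using False by (simp add: sgn_div_norm)
  then have "\<bar>sgn x \<bullet> n\<bar> = norm n * \<bar>sgn x \<bullet> sgn n\<bar>" for x
    by (metis abs_mult abs_norm_cancel inner_scaleR_right)
  then have "(\<integral>\<^sup>+ x. indicator (cball 0 1) x * ennreal \<bar>sgn x \<bullet> n\<bar> \<partial>lborel) =
      (\<integral>\<^sup>+ x. ennreal (norm n) * (indicator (cball 0 1) x * ennreal \<bar>sgn x \<bullet> sgn n\<bar>) \<partial>lborel)"
    by (intro nn_integral_cong) (simp add: ennreal_mult mult_ac)
  also have "\<dots> = ennreal (norm n) * (\<integral>\<^sup>+ x. indicator (cball 0 1) x * ennreal \<bar>sgn x \<bullet> sgn n\<bar> \<partial>lborel)"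
    by (rule nn_integral_cmult) measurable
  finally show ?thesis
    unfolding eq crofton_const_def by (simp add: mult_ac)
qed simp

lemma AE_not_orthogonal:
  fixes e :: "'a::euclidean_space"
  assumes "e \<noteq> 0"
  shows "AE x in lborel. e \<bullet> x \<noteq> 0"
proof -
  have "negligible {x. e \<bullet> x = 0}" using assms by (intro negligible_hyperplane) simp
  then have "AE x in lebesgue. e \<bullet> x \<noteq> 0"
    unfolding negligible_iff_null_sets by (auto intro: AE_I')
  then show ?thesis by (simp add: AE_completion_iff)
qed

lemma crofton_const_finite_pos: "crofton_const < \<infinity>" "0 < crofton_const"
proof -
  let ?e = "axis 1 1 :: real^3"
  have [measurable]: "(\<lambda>x. indicator (cball 0 1) x * ennreal \<bar>sgn x \<bullet> ?e\<bar>) \<in> borel_measurable borel"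
    by measurable
  have "\<bar>sgn x \<bullet> ?e\<bar> \<le> 1" for x :: "real^3"
    using Cauchy_Schwarz_ineq2[of "sgn x" ?e] by (simp add: norm_sgn split: if_splits)
  then have "(\<integral>\<^sup>+ x. indicator (cball 0 1) x * ennreal \<bar>sgn x \<bullet> ?e\<bar> \<partial>lborel) \<le> (\<integral>\<^sup>+ x. indicator (cball 0 1 :: (real^3) set) x \<partial>lborel)"
    by (intro nn_integral_mono) (auto simp: indicator_def)
  also have "\<dots> < \<infinity>" using emeasure_lborel_cball_finite[of "0::real^3" 1] by simp
  finally show "crofton_const < \<infinity>"
    unfolding crofton_const_def by (auto intro: ennreal_mult_less_top[THEN iffD2] simp: ennreal_mult_less_top)
  show "0 < crofton_const"
  proof (rule ccontr)
    assume "\<not> 0 < crofton_const"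
    then have "(\<integral>\<^sup>+ x. indicator (cball 0 1) x * ennreal \<bar>sgn x \<bullet> ?e\<bar> \<partial>lborel) = 0"
      by (simp add: crofton_const_def not_gr_zero)
    then have "AE x in lborel. indicator (cball 0 1) x * ennreal \<bar>sgn x \<bullet> ?e\<bar> = 0"
      by (subst (asm) nn_integral_0_iff_AE) auto
    moreover have "AE x in lborel. ?e \<bullet> x \<noteq> 0"
      by (rule AE_not_orthogonal) (simp add: axis_eq_0_iff)
    ultimately have "AE x in lborel. x \<notin> cball (0::real^3) 1"
      by eventually_elim (auto simp: sgn_div_norm indicator_def inner_commute split: if_splits)
    then have "emeasure lborel (cball (0::real^3) 1) = 0"
      by (subst (asm) AE_iff_measurable[of "cball 0 1"]) auto
    then show False
      by (simp add: emeasure_cball unit_ball_vol_pos[THEN less_imp_neq, symmetric] unit_ball_vol_3)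
  qed
qed

text \<open>The images of the earlier charts are relatively open in \<open>N\<close>, so the part
  removed from \<open>U i\<close> is open and the remaining piece is Borel.\<close>

lemma atlas_piece:
  assumes "surface_atlas N U r"
  defines "V \<equiv> \<lambda>i. U i - r i -` (\<Union>j<i. r j ` U j)"
  shows "V i \<in> sets borel" "V i \<subseteq> U i" "N = (\<Union>i. r i ` V i)" "disjoint_family (\<lambda>i. r i ` V i)"
proof -
  have N: "N = (\<Union>i. r i ` U i)" and lp: "\<And>i. local_parametrization N (U i) (r i)"
    using assms unfolding surface_atlas_def by auto
  have U: "open (U i)" "continuous_on (U i) (r i)" "openin (top_of_set N) (r i ` U i)" for i
    using lp[of i] smooth_on_C1(3) unfolding local_parametrization_def by auto
  have "openin (top_of_set N) (\<Union>j<i. r j ` U j)" using U(3) by auto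
  then obtain T where T: "open T" "(\<Union>j<i. r j ` U j) = N \<inter> T" unfolding openin_open by blast
  have "V i = U i - (U i \<inter> r i -` T)"
    unfolding V_def T(2) using N by auto
  moreover have "open (U i \<inter> r i -` T)"
    by (rule continuous_open_preimage[OF U(2,1) T(1)])
  ultimately show "V i \<in> sets borel" using U(1)[of i] by simp
  show "V i \<subseteq> U i" by (auto simp: V_def)
  have "\<exists>i. x \<in> r i ` V i" if "x \<in> N" for x
  proof -
    define k where "k = (LEAST i. x \<in> r i ` U i)"
    have "\<exists>i. x \<in> r i ` U i" using that N by auto
    then have "x \<in> r k ` U k" unfolding k_def by (rule LeastI_ex)
    moreover have "x \<notin> r j ` U j" if "j < k" for j
      using not_less_Least that unfolding k_def by blast
    ultimately show ?thesis unfolding V_def by blast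
  qed
  moreover have "r i ` V i \<subseteq> N" for i using N by (auto simp: V_def)
  ultimately show "N = (\<Union>i. r i ` V i)" by blast
  have "r i ` V i \<inter> r j ` V j = {}" if "i < j" for i j
  proof (rule ccontr)
    assume "r i ` V i \<inter> r j ` V j \<noteq> {}"
    then obtain w w' where "w \<in> V i" "w' \<in> V j" "r i w = r j w'" by auto
    then have "r j w' \<in> r i ` U i" "r j w' \<notin> (\<Union>k<j. r k ` U k)"
      unfolding V_def by (auto intro: rev_image_eqI)
    then show False using that by blast
  qed
  then show "disjoint_family (\<lambda>i. r i ` V i)"
    unfolding disjoint_family_on_def by (metis Int_commute linorder_neqE_nat)
qed

lemma cauchy_crofton:
  assumes atlas: "surface_atlas N U r"
  shows "(\<integral>\<^sup>+ l \<in> oriented_lines. crossing_number l N \<partial>line_measure) =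
    crofton_const * (\<Sum>i. \<integral>\<^sup>+ w \<in> U i - r i -` (\<Union>j<i. r j ` U j). ennreal (norm (cross3 (partial_s (r i) w) (partial_t (r i) w))) \<partial>lborel)"
proof -
  define V where "V i = U i - r i -` (\<Union>j<i. r j ` U j)" for i
  note V = atlas_piece[OF atlas, folded V_def]
  have lp: "open (U i)" "smooth_on (U i) (r i)" "inj_on (r i) (U i)" for i
  proof -
    have "local_parametrization N (U i) (r i)"
      using atlas unfolding surface_atlas_def by blast
    then obtain g where "open (U i)" "smooth_on (U i) (r i)" "homeomorphism (U i) (r i ` U i) (r i) g"
      unfolding local_parametrization_def by blast
    then show "open (U i)" "smooth_on (U i) (r i)" "inj_on (r i) (U i)"
      by (auto intro: inj_on_inverseI[of _ g] homeomorphism_apply1)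
  qed
  \<comment> \<open>The normal vector weighted by the area element, extended by zero so that it is
    Borel on the whole parameter plane and Tonelli applies there.\<close>
  define c where "c i w = indicator (V i) w *\<^sub>R cross3 (partial_s (r i) w) (partial_t (r i) w)" for i w
  have c[measurable]: "c i \<in> borel_measurable borel" for i
    unfolding c_def
    by (intro borel_measurable_continuous_on_indicator V(1) continuous_on_cross
        continuous_on_subset[OF smooth_on_C1(2)[OF lp(2)] V(2)])
  have [measurable]: "(\<lambda>l. crossing_number l N) \<in> borel_measurable borel"
    by (rule crossing_number_measurable[OF sigma_compact_surface[OF atlas]])
  have cr: "crossing_number l N = (\<Sum>i. crossing_number l (r i ` V i))" for l
  proof -
    have eq: "line_points l \<inter> N = (\<Union>i. line_points l \<inter> r i ` V i)" using V(3) by auto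
    have "disjoint_family (\<lambda>i. line_points l \<inter> r i ` V i)"
      using V(4) by (auto simp: disjoint_family_on_def)
    then show ?thesis
      unfolding crossing_number_def eq by (intro suminf_emeasure[symmetric]) auto
  qed
  \<comment> \<open>The formula for a single direction. The exceptional null sets of the countably
    many pieces are united, and \<open>u \<bullet> c i w\<close> carries the area distortion of the
    projection along \<open>u\<close>.\<close>
  have dir: "(\<integral>\<^sup>+ y. indicator {0..1} (y \<bullet> u) * crossing_number (u, perp u y) N \<partial>lborel) =
      (\<Sum>i. \<integral>\<^sup>+ w. ennreal \<bar>u \<bullet> c i w\<bar> \<partial>lborel)" if u: "norm u = 1" for u
  proof -
    have "\<exists>g. g \<in> borel_measurable lebesgue \<and>
        (AE y in lebesgue. indicator {0..1} (y \<bullet> u) * crossing_number (u, perp u y) (r i ` V i) = g y) \<and>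
        (\<integral>\<^sup>+ y. g y \<partial>lebesgue) = (\<integral>\<^sup>+ w. ennreal (jac (r i) u w) * indicator (V i) w \<partial>lborel)" for i
      by (rule projection_area_formula[OF lp[of i] V(2)[of i] V(1)[of i] u], intro exI conjI)
    from choice[OF allI[OF this]] obtain g where "\<forall>i. g i \<in> borel_measurable lebesgue \<and>
        (AE y in lebesgue. indicator {0..1} (y \<bullet> u) * crossing_number (u, perp u y) (r i ` V i) = g i y) \<and>
        (\<integral>\<^sup>+ y. g i y \<partial>lebesgue) = (\<integral>\<^sup>+ w. ennreal (jac (r i) u w) * indicator (V i) w \<partial>lborel)"
      by (rule exE)
    then have g: "\<And>i. g i \<in> borel_measurable lebesgue"
        "\<And>i. AE y in lebesgue. indicator {0..1} (y \<bullet> u) * crossing_number (u, perp u y) (r i ` V i) = g i y"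
        "\<And>i. (\<integral>\<^sup>+ y. g i y \<partial>lebesgue) = (\<integral>\<^sup>+ w. ennreal (jac (r i) u w) * indicator (V i) w \<partial>lborel)"
      by simp_all
    have "(\<integral>\<^sup>+ y. indicator {0..1} (y \<bullet> u) * crossing_number (u, perp u y) N \<partial>lborel) =
        (\<integral>\<^sup>+ y. (\<Sum>i. indicator {0..1} (y \<bullet> u) * crossing_number (u, perp u y) (r i ` V i)) \<partial>lebesgue)"
      unfolding nn_integral_completion by (simp add: cr)
    also have "\<dots> = (\<integral>\<^sup>+ y. (\<Sum>i. g i y) \<partial>lebesgue)"
    proof (rule nn_integral_cong_AE)
      have "AE y in lebesgue. \<forall>i. indicator {0..1} (y \<bullet> u) * crossing_number (u, perp u y) (r i ` V i) = g i y"
        unfolding AE_all_countable using g(2) by blast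
      then show "AE y in lebesgue. (\<Sum>i. indicator {0..1} (y \<bullet> u) * crossing_number (u, perp u y) (r i ` V i)) = (\<Sum>i. g i y)"
        by eventually_elim simp
    qed
    also have "\<dots> = (\<Sum>i. \<integral>\<^sup>+ y. g i y \<partial>lebesgue)"
      by (rule nn_integral_suminf) (rule g(1))
    also have "\<dots> = (\<Sum>i. \<integral>\<^sup>+ w. ennreal \<bar>u \<bullet> c i w\<bar> \<partial>lborel)"
      unfolding g(3) by (intro suminf_cong nn_integral_cong) (simp add: c_def jac_def indicator_def)
    finally show ?thesis .
  qed
  have "(\<integral>\<^sup>+ l \<in> oriented_lines. crossing_number l N \<partial>line_measure) =
      3 * (\<integral>\<^sup>+ x. \<integral>\<^sup>+ y. indicator (cball 0 1) x * (indicator {0..1} (y \<bullet> sgn x) *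
        (crossing_number (sgn x, y - (y \<bullet> sgn x) *\<^sub>R sgn x) N *
         indicator oriented_lines (sgn x, y - (y \<bullet> sgn x) *\<^sub>R sgn x))) \<partial>lborel \<partial>lborel)"
    by (rule nn_integral_line_measure) measurable
  also have "(\<integral>\<^sup>+ x. \<integral>\<^sup>+ y. indicator (cball 0 1) x * (indicator {0..1} (y \<bullet> sgn x) *
        (crossing_number (sgn x, y - (y \<bullet> sgn x) *\<^sub>R sgn x) N *
         indicator oriented_lines (sgn x, y - (y \<bullet> sgn x) *\<^sub>R sgn x))) \<partial>lborel \<partial>lborel) =
      (\<integral>\<^sup>+ x. (\<Sum>i. \<integral>\<^sup>+ w. indicator (cball 0 1) x * ennreal \<bar>sgn x \<bullet> c i w\<bar> \<partial>lborel) \<partial>lborel)"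
  \<comment> \<open>The vector 0 determines no direction and is discarded as a null set.\<close>
  proof (intro nn_integral_cong_AE, rule_tac eventually_mono[OF AE_lborel_singleton[of 0]])
    fix x :: "real^3" assume x: "x \<noteq> 0"
    then have u: "norm (sgn x) = 1" by (simp add: norm_sgn)
    show "(\<integral>\<^sup>+ y. indicator (cball 0 1) x * (indicator {0..1} (y \<bullet> sgn x) *
        (crossing_number (sgn x, y - (y \<bullet> sgn x) *\<^sub>R sgn x) N *
         indicator oriented_lines (sgn x, y - (y \<bullet> sgn x) *\<^sub>R sgn x))) \<partial>lborel) =
      (\<Sum>i. \<integral>\<^sup>+ w. indicator (cball 0 1) x * ennreal \<bar>sgn x \<bullet> c i w\<bar> \<partial>lborel)"
      using dir[OF u] by (cases "x \<in> cball 0 1") (simp_all add: sgn_line_oriented[OF x] perp_def)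
  qed
  also have "\<dots> = (\<Sum>i. \<integral>\<^sup>+ x. \<integral>\<^sup>+ w. indicator (cball 0 1) x * ennreal \<bar>sgn x \<bullet> c i w\<bar> \<partial>lborel \<partial>lborel)"
    by (rule nn_integral_suminf) measurable
  also have "\<dots> = (\<Sum>i. \<integral>\<^sup>+ w. \<integral>\<^sup>+ x. indicator (cball 0 1) x * ennreal \<bar>sgn x \<bullet> c i w\<bar> \<partial>lborel \<partial>lborel)"
    by (intro suminf_cong lborel_pair.Fubini'[symmetric]) measurable
  also have "3 * \<dots> = (\<Sum>i. \<integral>\<^sup>+ w. 3 * (\<integral>\<^sup>+ x. indicator (cball 0 1) x * ennreal \<bar>sgn x \<bullet> c i w\<bar> \<partial>lborel) \<partial>lborel)"
    by (simp add: nn_integral_cmult)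
  also have "\<dots> = (\<Sum>i. \<integral>\<^sup>+ w. crofton_const * ennreal (norm (c i w)) \<partial>lborel)"
    unfolding nn_integral_abs_cosine ..
  also have "\<dots> = crofton_const * (\<Sum>i. \<integral>\<^sup>+ w. ennreal (norm (c i w)) \<partial>lborel)"
    by (simp add: nn_integral_cmult)
  also have "(\<Sum>i. \<integral>\<^sup>+ w. ennreal (norm (c i w)) \<partial>lborel) =
      (\<Sum>i. \<integral>\<^sup>+ w \<in> V i. ennreal (norm (cross3 (partial_s (r i) w) (partial_t (r i) w))) \<partial>lborel)"
    by (intro suminf_cong nn_integral_cong) (simp add: c_def indicator_def)
  finally show ?thesis unfolding V_def .
qed

section \<open>The Euclidean case \<open>a = 0\<close>\<close>

lemma norm_cross_orthonormal_combination:
  assumes e: "e1 \<bullet> e1 = 1" "e2 \<bullet> e2 = 1" "e1 \<bullet> e2 = 0"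
  shows "norm (cross3 (p *\<^sub>R e1 + q *\<^sub>R e2) (r *\<^sub>R e1 + s *\<^sub>R e2)) = \<bar>p * s - q * r\<bar>"
proof -
  have "cross3 (p *\<^sub>R e1 + q *\<^sub>R e2) (r *\<^sub>R e1 + s *\<^sub>R e2) = (p * s - q * r) *\<^sub>R cross3 e1 e2"
    by (simp add: cross3_simps)
  moreover have "norm (cross3 e1 e2) = 1"
    unfolding norm_eq_1 using orthonormal3_cross[OF e] by (simp add: orthonormal3_def)
  ultimately show ?thesis by simp
qed

lemma hausdorff_area_integrand_0:
  assumes "cross3 v1 v2 \<noteq> 0"
  shows "phi_area 0 x v1 v2 = norm (cross3 v1 v2)"
proof -
  define e1 where "e1 = sgn v1"
  define y where "y = v2 - (v2 \<bullet> e1) *\<^sub>R e1"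
  define e2 where "e2 = sgn y"
  have "v1 \<noteq> 0" using assms by auto
  then have v1: "v1 = norm v1 *\<^sub>R e1" "v1 \<noteq> 0"
    by (auto simp: e1_def sgn_div_norm)
  have y0: "y \<noteq> 0"
  proof
    assume "y = 0"
    then have "v2 = ((v2 \<bullet> e1) / norm v1) *\<^sub>R v1"
      using v1 by (simp add: y_def e1_def sgn_div_norm field_simps)
    then show False
      using assms by (metis cross_mult_right cross_refl scaleR_zero_right)
  qed
  have e1: "e1 \<bullet> e1 = 1"
    unfolding norm_eq_1[symmetric] using v1(2) by (simp add: e1_def norm_sgn)
  have e2: "e2 \<bullet> e2 = 1"
    unfolding norm_eq_1[symmetric] using y0 by (simp add: e2_def norm_sgn)
  have "e1 \<bullet> y = 0" using e1 by (simp add: y_def inner_diff_right inner_commute[of v2])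
  then have e12: "e1 \<bullet> e2 = 0" by (simp add: e2_def sgn_div_norm)
  have v2: "v2 = (v2 \<bullet> e1) *\<^sub>R e1 + norm y *\<^sub>R e2"
    using y0 by (simp add: e2_def sgn_div_norm y_def)
  have v1': "v1 = norm v1 *\<^sub>R e1 + 0 *\<^sub>R e2" using v1(1) by simp
  \<comment> \<open>For \<open>a = 0\<close> the metric ignores the base point. Moving it to the
    origin makes the orthogonality condition on the base point trivial for the Gram-Schmidt basis
    \<open>e1\<close>, \<open>e2\<close>.\<close>
  have "phi_area 0 x v1 v2 = phi_area 0 0 v1 v2"
    by (simp add: hausdorff_area_integrand_def phi_metric_def)
  also have "\<dots> = \<bar>norm v1 * norm y - 0 * (v2 \<bullet> e1)\<bar>"
    using hausdorff_area_integrand_phi[OF e1 e2 e12 _ v1' v2, of 0 0] v1(2) y0 by simp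
  also have "\<dots> = norm (cross3 v1 v2)"
    using norm_cross_orthonormal_combination[OF e1 e2 e12, of "norm v1" 0 "v2 \<bullet> e1" "norm y"] v1' v2 by simp
  finally show ?thesis .
qed

lemma cross_partials_nonzero:
  assumes d: "r differentiable at w" and inj: "inj (frechet_derivative r (at w))"
  shows "cross3 (partial_s r w) (partial_t r w) \<noteq> 0"
proof
  note fd = frechet_derivative_partials[OF d]
  have lin: "linear (frechet_derivative r (at w))" by (rule linear_frechet_derivative[OF d])
  have z: "v = 0" if "frechet_derivative r (at w) v = 0" for v
    using that inj linear_injective_0[OF lin] by blast
  assume "cross3 (partial_s r w) (partial_t r w) = 0"
  then consider "partial_s r w = 0" | "partial_t r w = 0" | c where "partial_t r w = c *\<^sub>R partial_s r w"
    unfolding cross_eq_0 collinear_lemma by blast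
  then show False
  proof cases
    case 1
    from z[OF this] show False by (simp add: zero_prod_def)
  next
    case 2
    from z[OF this] show False by (simp add: zero_prod_def)
  next
    case 3
    have "frechet_derivative r (at w) (- c, 1) = 0"
      using fd[of "- c" 1] 3 by simp
    from z[OF this] show False by (simp add: zero_prod_def)
  qed
qed

lemma crossing_integral_euclidean:
  assumes "has_surface_integral (phi_area 0) N I"
  shows "(\<integral>\<^sup>+ l \<in> oriented_lines. crossing_number l N \<partial>line_measure) = crofton_const * I"
    and "sigma_compact N"
proof -
  obtain U r where atlas: "surface_atlas N U r" and
    I: "I = (\<Sum>i. \<integral>\<^sup>+ w \<in> U i - r i -` (\<Union>j<i. r j ` U j).
               ennreal (phi_area 0 (r i w) (partial_s (r i) w) (partial_t (r i) w)) \<partial>lborel)"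
    using assms unfolding has_surface_integral_def by blast
  have "phi_area 0 (r i w) (partial_s (r i) w) (partial_t (r i) w) =
      norm (cross3 (partial_s (r i) w) (partial_t (r i) w))" if "w \<in> U i" for i w
  proof (rule hausdorff_area_integrand_0, rule cross_partials_nonzero)
    have lp: "local_parametrization N (U i) (r i)"
      using atlas unfolding surface_atlas_def by blast
    then show "r i differentiable at w"
      using that smooth_on_differentiable unfolding local_parametrization_def by blast
    show "inj (frechet_derivative (r i) (at w))"
      using lp that unfolding local_parametrization_def by blast
  qed
  then have "I = (\<Sum>i. \<integral>\<^sup>+ w \<in> U i - r i -` (\<Union>j<i. r j ` U j). ennreal (norm (cross3 (partial_s (r i) w) (partial_t (r i) w))) \<partial>lborel)"
    unfolding I by (intro suminf_cong nn_integral_cong) (simp add: indicator_def)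
  then show "(\<integral>\<^sup>+ l \<in> oriented_lines. crossing_number l N \<partial>line_measure) = crofton_const * I"
    using cauchy_crofton[OF atlas] by simp
  show "sigma_compact N" by (rule sigma_compact_surface[OF atlas])
qed

lemma crossing_integral_euclidean_cmult:
  assumes "has_surface_integral (phi_area 0) N I"
  shows "(\<integral>\<^sup>+ l. c * (crossing_number l N * indicator oriented_lines l) \<partial>line_measure) = c * (crofton_const * I)"
proof -
  have [measurable]: "(\<lambda>l. crossing_number l N) \<in> borel_measurable borel"
    by (rule crossing_number_measurable[OF crossing_integral_euclidean(2)[OF assms]])
  have sl: "sets line_measure = sets borel" by (simp add: line_measure_def)
  have [measurable]: "(\<lambda>l. crossing_number l N * indicator oriented_lines l) \<in> borel_measurable line_measure"
    unfolding measurable_cong_sets[OF sl refl] by measurable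
  show ?thesis
    unfolding crossing_integral_euclidean(1)[OF assms, symmetric] by (rule nn_integral_cmult) measurable
qed

lemma euclidean_admits_crofton: "admits_crofton_formula (phi_area 0)"
  unfolding admits_crofton_formula_def
proof (intro exI[of _ "\<lambda>_. 1 / enn2real crofton_const"] conjI allI impI)
  define c where "c = 1 / enn2real crofton_const"
  have c: "ennreal c * crofton_const = 1" "c \<ge> 0"
  proof -
    have "crofton_const = ennreal (enn2real crofton_const)" "enn2real crofton_const > 0"
      using crofton_const_finite_pos by (simp_all add: enn2real_positive_iff)
    then show "ennreal c * crofton_const = 1" "c \<ge> 0"
      by (metis c_def ennreal_1 ennreal_mult'' less_imp_le nonzero_eq_divide_eq less_irrefl) (simp add: c_def)
  qed
  show "smooth_line_density (\<lambda>_. 1 / enn2real crofton_const)"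
    unfolding smooth_line_density_def using smooth_on_const by blast
  fix N I
  assume "embedded_surface N \<and> has_surface_integral (phi_area 0) N I \<and>
    (crossing_integral_pos (\<lambda>_. 1 / enn2real crofton_const) N < \<infinity> \<or> crossing_integral_pos (\<lambda>l. - (1 / enn2real crofton_const)) N < \<infinity>)"
  then have I: "has_surface_integral (phi_area 0) N I" by blast
  have "crossing_integral_pos (\<lambda>_. c) N = (\<integral>\<^sup>+ l. ennreal c * (crossing_number l N * indicator oriented_lines l) \<partial>line_measure)"
    unfolding crossing_integral_pos_def by (simp add: mult.assoc)
  also have "\<dots> = I"
    unfolding crossing_integral_euclidean_cmult[OF I] by (simp add: mult.assoc[symmetric] c)
  finally have pos: "crossing_integral_pos (\<lambda>_. c) N = I" .
  have neg: "crossing_integral_pos (\<lambda>_. - c) N = 0"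
    using c(2) by (simp add: crossing_integral_pos_def ennreal_neg)
  show "enn2ereal I = enn2ereal (crossing_integral_pos (\<lambda>_. 1 / enn2real crofton_const) N) -
      enn2ereal (crossing_integral_pos (\<lambda>l. - (1 / enn2real crofton_const)) N)"
    unfolding c_def[symmetric] pos neg by (simp add: zero_ennreal.rep_eq)
qed

section \<open>Discs and spheres\<close>

lemma Ck_on_subset: "Ck_on k S f \<Longrightarrow> T \<subseteq> S \<Longrightarrow> Ck_on k T f"
  by (induction k arbitrary: f) (auto intro: continuous_on_subset)

lemma smooth_on_subset: "smooth_on S f \<Longrightarrow> T \<subseteq> S \<Longrightarrow> smooth_on T f"
  unfolding smooth_on_def using Ck_on_subset by blast

lemma local_parametrization_empty: "local_parametrization N {} r"
proof -
  have "Ck_on k {} r" for k by (induction k arbitrary: r) simp_all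
  then show ?thesis
    by (simp add: local_parametrization_def smooth_on_def homeomorphism_def)
qed

text \<open>The second chart only completes the atlas: it adds a null set of parameters, so one
  chart computes the integral. For the disc it is empty; for the sphere it is the stereographic
  chart that omits the opposite pole.\<close>

lemma has_surface_integral_chart:
  assumes lp: "local_parametrization N U r" "local_parametrization N U' r'" and N: "N = r ` U \<union> r' ` U'"
    and null: "U' - r' -` (r ` U) \<in> null_sets lborel"
  shows "has_surface_integral \<Phi> N (\<integral>\<^sup>+ w \<in> U. ennreal (\<Phi> (r w) (partial_s r w) (partial_t r w)) \<partial>lborel)"
proof -
  define V where "V i = (if i = 0 then U else if i = 1 then U' else {})" for i :: nat
  define s where "s i = (if i = 0 then r else r')" for i :: nat
  have atlas: "surface_atlas N V s"
    unfolding surface_atlas_def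
  proof
    show "\<forall>i. local_parametrization N (V i) (s i)"
      using lp local_parametrization_empty by (simp add: V_def s_def)
    have 1: "s i ` V i \<subseteq> N" for i by (auto simp: N V_def s_def)
    have "N \<subseteq> s 0 ` V 0 \<union> s 1 ` V 1" by (simp add: N V_def s_def)
    also have "\<dots> \<subseteq> (\<Union>i. s i ` V i)" by (intro Un_least UN_upper UNIV_I)
    finally show "N = (\<Union>i. s i ` V i)" using 1 by (intro subset_antisym UN_least)
  qed
  let ?I = "\<lambda>i. \<integral>\<^sup>+ w \<in> V i - s i -` (\<Union>j<i. s j ` V j). ennreal (\<Phi> (s i w) (partial_s (s i) w) (partial_t (s i) w)) \<partial>lborel"
  have "?I i = 0" if "i \<noteq> 0" for i
  proof (cases "i = 1")
    case True
    have "AE w in lborel. w \<notin> U' - r' -` (r ` U)" by (rule AE_not_in[OF null])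
    then have "(\<integral>\<^sup>+ w \<in> (U' - r' -` (r ` U)). ennreal (\<Phi> (r' w) (partial_s r' w) (partial_t r' w)) \<partial>lborel) =
        integral\<^sup>N lborel (\<lambda>w :: real \<times> real. 0)"
      by (intro nn_integral_cong_AE) (auto elim: eventually_mono)
    moreover have "V 1 - s 1 -` (\<Union>j<1. s j ` V j) = U' - r' -` (r ` U)"
      by (auto simp: V_def s_def)
    ultimately show ?thesis
      unfolding True by (simp add: s_def)
  qed (use that in \<open>simp add: V_def\<close>)
  then have "(\<Sum>i. ?I i) = (\<Sum>i\<in>{0}. ?I i)"
    by (intro suminf_finite) auto
  also have "\<dots> = (\<integral>\<^sup>+ w \<in> U. ennreal (\<Phi> (r w) (partial_s r w) (partial_t r w)) \<partial>lborel)"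
    by (simp add: V_def s_def)
  finally show ?thesis
    unfolding has_surface_integral_def using atlas by (intro exI[of _ V] exI[of _ s]) simp
qed

text \<open>The inequality is strict so that there is no boundary. The normal is not of unit length
  because averages over it are taken in the unit ball; \<open>n = 0\<close> gives an open ball
  instead of a disc and has to be left out as a null set.\<close>

definition disc :: "real^3 \<Rightarrow> (real^3) set" where
  "disc n = {x. x \<bullet> n = 0 \<and> norm x < 1}"

text \<open>The density with respect to Euclidean area on a plane through the origin, at distance
  \<open>\<rho>\<close> from it. The base point lies in the plane, so the radial direction has
  eigenvalue \<open>C\<close> and the tangential one \<open>A\<close>.\<close>

definition disc_integrand :: "real \<Rightarrow> real \<Rightarrow> real" where
  "disc_integrand a \<rho> = (let A = 1 + a\<^sup>2 * \<rho>\<^sup>2; C = 1 + 2 * a\<^sup>2 * \<rho>\<^sup>2 in 2 * (A * C) * sqrt (A * C) / (A + C))"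

lemma hausdorff_area_integrand_radial:
  assumes e: "e1 \<bullet> e1 = 1" "e2 \<bullet> e2 = 1" "e1 \<bullet> e2 = 0"
  shows "phi_area a (s *\<^sub>R e1 + t *\<^sub>R e2) e1 e2 = disc_integrand a (norm (s, t))"
proof -
  define \<rho> where "\<rho> = norm (s, t)"
  have \<rho>: "\<rho>\<^sup>2 = s\<^sup>2 + t\<^sup>2" by (simp add: \<rho>_def norm_Pair)
  \<comment> \<open>Polar coordinates of the base point; at the origin any direction will do. The
    basis \<open>f1\<close>, \<open>f2\<close> below is radial and tangential, and it arises by a
    rotation, whose determinant is 1.\<close>
  obtain c d where cd: "c\<^sup>2 + d\<^sup>2 = 1" "s = \<rho> * c" "t = \<rho> * d"
  proof (cases "\<rho> = 0")
    case True
    then have "s = 0" "t = 0" by (auto simp: \<rho>_def zero_prod_def)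
    then show ?thesis using that[of 1 0] True by simp
  next
    case False
    then have "(s / \<rho>)\<^sup>2 + (t / \<rho>)\<^sup>2 = 1"
      by (simp add: power_divide add_divide_distrib[symmetric] \<rho>[symmetric])
    then show ?thesis using that[of "s / \<rho>" "t / \<rho>"] False by simp
  qed
  define f1 f2 where "f1 = c *\<^sub>R e1 + d *\<^sub>R e2" and "f2 = (- d) *\<^sub>R e1 + c *\<^sub>R e2"
  have e21: "e2 \<bullet> e1 = 0" using e(3) by (simp add: inner_commute)
  have f: "f1 \<bullet> f1 = 1" "f2 \<bullet> f2 = 1" "f1 \<bullet> f2 = 0"
    using cd(1) by (simp_all add: f1_def f2_def inner_add_left inner_add_right e e21 power2_eq_square algebra_simps)
  let ?x = "s *\<^sub>R e1 + t *\<^sub>R e2"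
  have x: "?x = \<rho> *\<^sub>R f1" by (simp add: cd(2,3) f1_def algebra_simps)
  have "norm f1 = 1" unfolding norm_eq_1 by (rule f(1))
  then have nx: "norm ?x = \<rho>" unfolding x by (simp add: \<rho>_def)
  have xf: "?x \<bullet> f2 = 0" "?x \<bullet> f1 = \<rho>" unfolding x by (simp_all add: f)
  have "c *\<^sub>R f1 + (- d) *\<^sub>R f2 = (c\<^sup>2 + d\<^sup>2) *\<^sub>R e1" "d *\<^sub>R f1 + c *\<^sub>R f2 = (c\<^sup>2 + d\<^sup>2) *\<^sub>R e2"
    by (simp_all add: f1_def f2_def algebra_simps power2_eq_square)
  then have e': "e1 = c *\<^sub>R f1 + (- d) *\<^sub>R f2" "e2 = d *\<^sub>R f1 + c *\<^sub>R f2"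
    unfolding cd(1) by simp_all
  have det: "c * c - (- d) * d = 1" using cd(1) by (simp add: power2_eq_square)
  have C: "1 + a\<^sup>2 * \<rho>\<^sup>2 + a\<^sup>2 * \<rho>\<^sup>2 = 1 + 2 * a\<^sup>2 * \<rho>\<^sup>2" by simp
  have "c * c - (- d) * d \<noteq> 0" using det by simp
  from hausdorff_area_integrand_phi[OF f xf(1) e' this, of a] show ?thesis
    unfolding nx xf(2) det C disc_integrand_def \<rho>_def[symmetric] Let_def by simp
qed

lemma disc_has_surface_integral:
  assumes n: "n \<noteq> 0"
  shows "has_surface_integral (phi_area a) (disc n)
    (\<integral>\<^sup>+ w \<in> ball (0 :: real \<times> real) 1. ennreal (disc_integrand a (norm w)) \<partial>lborel)"
proof -
  define m where "m = sgn n"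
  have m: "m \<bullet> m = 1" unfolding norm_eq_1[symmetric] using n by (simp add: m_def norm_sgn)
  obtain e1 where e1: "e1 \<bullet> e1 = 1" "m \<bullet> e1 = 0" by (rule unit_orthogonal_vector)
  define e2 where "e2 = cross3 m e1"
  have on: "orthonormal3 m e1 e2"
    unfolding e2_def by (rule orthonormal3_cross[OF m e1])
  then have e: "e1 \<bullet> e1 = 1" "e2 \<bullet> e2 = 1" "e1 \<bullet> e2 = 0" "e2 \<bullet> e1 = 0" "e1 \<bullet> m = 0" "e2 \<bullet> m = 0" "m \<bullet> e1 = 0" "m \<bullet> e2 = 0"
    by (auto simp: orthonormal3_def inner_commute)
  define r where "r = (\<lambda>w::real\<times>real. fst w *\<^sub>R e1 + snd w *\<^sub>R e2)"
  have r: "r = (\<lambda>w. fst w *\<^sub>R e1 + snd w *\<^sub>R e2 + 0 *\<^sub>R 0)" by (simp add: r_def)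
  have "smooth_on UNIV r"
    unfolding r by (rule smooth_on_rational[OF rational_fun.rf_fst rational_fun.rf_snd rational_fun.rf_const])
  then have sm: "smooth_on (ball 0 1) r" by (rule smooth_on_subset) simp
  have "(r has_derivative r) (at w)" for w
    unfolding r_def by (auto intro!: derivative_eq_intros)
  then have fd: "frechet_derivative r (at w) = r" for w
    using frechet_derivative_at by metis
  have ri: "r w \<bullet> e1 = fst w" "r w \<bullet> e2 = snd w" "r w \<bullet> m = 0" for w
    by (simp_all add: r_def inner_add_left e)
  have nr: "norm (r w) = norm w" for w
  proof -
    have "r w \<bullet> r w = (fst w)\<^sup>2 + (snd w)\<^sup>2"
      by (simp add: r_def inner_add_left inner_add_right e power2_eq_square)
    then show ?thesis by (simp add: norm_eq_sqrt_inner[of "r w"] norm_prod_def)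
  qed
  have inj: "inj r"
    by (rule injI) (metis ri(1,2) prod_eqI)
  have "x \<bullet> n = norm n * (x \<bullet> m)" for x
    using n by (simp add: m_def sgn_div_norm)
  then have disc: "disc n = {x. x \<bullet> m = 0 \<and> norm x < 1}"
    using n by (simp add: disc_def)
  have exp: "x = r (x \<bullet> e1, x \<bullet> e2)" if "x \<bullet> m = 0" for x
  proof -
    define y where "y = x - r (x \<bullet> e1, x \<bullet> e2)"
    have y0: "y \<bullet> m = 0" "y \<bullet> e1 = 0" "y \<bullet> e2 = 0"
      using that by (simp_all add: y_def inner_diff_left ri)
    \<comment> \<open>The remainder \<open>y\<close> is orthogonal to \<open>m\<close> and
      \<open>e1\<close>, hence parallel to their cross product \<open>e2\<close>. As it is
      orthogonal to \<open>e2\<close> as well, it vanishes.\<close>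
    have "cross3 (cross3 m e1) y = 0"
      using y0 by (subst cross_skew) (simp add: Lagrange)
    then have "norm y = 0"
      using norm_cross_dot[of e2 y] y0(3) e(2) by (simp add: e2_def[symmetric] inner_commute norm_eq_sqrt_inner[of e2])
    then show ?thesis by (simp add: y_def)
  qed
  have img: "disc n = r ` ball 0 1"
  proof
    show "disc n \<subseteq> r ` ball 0 1"
    proof
      fix x assume "x \<in> disc n"
      then have "x \<bullet> m = 0" "norm x < 1" by (auto simp: disc)
      with exp[of x] nr[of "(x \<bullet> e1, x \<bullet> e2)"] show "x \<in> r ` ball 0 1"
        by (intro image_eqI[of _ _ "(x \<bullet> e1, x \<bullet> e2)"]) auto
    qed
    show "r ` ball 0 1 \<subseteq> disc n"
      by (auto simp: disc ri nr)
  qed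
  have lp: "local_parametrization (disc n) (ball 0 1) r"
    unfolding local_parametrization_def
  proof (intro conjI ballI)
    show "inj (frechet_derivative r (at w))" for w
      unfolding fd by (rule inj)
    show "openin (top_of_set (disc n)) (r ` ball 0 1)" unfolding img by simp
    show "\<exists>g. homeomorphism (ball 0 1) (r ` ball 0 1) r g"
    proof (rule exI[of _ "\<lambda>x. (x \<bullet> e1, x \<bullet> e2)"])
      show "homeomorphism (ball 0 1) (r ` ball 0 1) r (\<lambda>x. (x \<bullet> e1, x \<bullet> e2))"
        unfolding homeomorphism_def
        by (simp add: ri image_image continuous_intros smooth_on_C1(3)[OF sm])
    qed
  qed (use sm in auto)
  have val: "phi_area a (r w) (partial_s r w) (partial_t r w) = disc_integrand a (norm w)" for w
    unfolding fd using hausdorff_area_integrand_radial[OF e(1-3), of a "fst w" "snd w"] by (simp add: r_def)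
  have "has_surface_integral (phi_area a) (disc n)
    (\<integral>\<^sup>+ w \<in> ball 0 1. ennreal (phi_area a (r w) (partial_s r w) (partial_t r w)) \<partial>lborel)"
    by (rule has_surface_integral_chart[OF lp local_parametrization_empty]) (simp_all add: img)
  then show ?thesis unfolding val .
qed

section \<open>Stereographic charts of the sphere\<close>

abbreviation std_frame :: "real \<times> real \<times> real \<Rightarrow> real^3" where
  "std_frame \<equiv> frame3 (axis 1 1) (axis 2 1) (axis 3 1)"

lemmas std_frame_inner = frame3_inner[OF orthonormal3_axis]

lemma std_frame_nth: "std_frame (x, y, z) $ 1 = x" "std_frame (x, y, z) $ 2 = y" "std_frame (x, y, z) $ 3 = z"
  by (simp_all add: frame3_def axis_def)

text \<open>The radius \<open>R\<close> may be negative: \<open>stereo (- R)\<close> is the chart that omits the antipodal point.\<close>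

definition stereo :: "real \<Rightarrow> real \<times> real \<Rightarrow> real^3" where
  "stereo R w = (let q = inverse (1 + (fst w)\<^sup>2 + (snd w)\<^sup>2) in
     std_frame (2 * R * (fst w * q), 2 * R * (snd w * q), R + (- 2 * R) * q))"

lemma smooth_on_stereo: "smooth_on UNIV (stereo R)"
proof -
  have eq: "stereo R = (\<lambda>w. (2 * R * (fst w * inverse (1 + (fst w)\<^sup>2 + (snd w)\<^sup>2))) *\<^sub>R axis 1 1 +
      (2 * R * (snd w * inverse (1 + (fst w)\<^sup>2 + (snd w)\<^sup>2))) *\<^sub>R axis 2 1 +
      (R + (- 2 * R) * inverse (1 + (fst w)\<^sup>2 + (snd w)\<^sup>2)) *\<^sub>R axis 3 1)"
    by (simp add: stereo_def frame3_def Let_def fun_eq_iff)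
  note rf = rational_fun.rf_const rational_fun.rf_inv rational_fun.rf_fst rational_fun.rf_snd
  show ?thesis
    unfolding eq
    by (rule smooth_on_rational[OF rational_fun.rf_mult[OF rf(1) rational_fun.rf_mult[OF rf(3,2)]]
          rational_fun.rf_mult[OF rf(1) rational_fun.rf_mult[OF rf(4,2)]]
          rational_fun.rf_add[OF rf(1) rational_fun.rf_mult[OF rf(1,2)]]])
qed

lemma stereo_derivative:
  defines "q \<equiv> \<lambda>w. inverse (1 + (fst w)\<^sup>2 + (snd w :: real)\<^sup>2)"
  shows "frechet_derivative (stereo R) (at w) v =
    std_frame (2 * R * (fst w * (- 2 * ((fst w * fst v + snd w * snd v) * (q w * q w))) + fst v * q w),
      2 * R * (snd w * (- 2 * ((fst w * fst v + snd w * snd v) * (q w * q w))) + snd v * q w),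
      (- 2 * R) * (- 2 * ((fst w * fst v + snd w * snd v) * (q w * q w))))"
proof -
  have eq: "stereo R = (\<lambda>w. (2 * R * (fst w * q w)) *\<^sub>R axis 1 1 +
      (2 * R * (snd w * q w)) *\<^sub>R axis 2 1 + (R + (- 2 * R) * q w) *\<^sub>R axis 3 1)"
    by (simp add: stereo_def frame3_def Let_def q_def fun_eq_iff)
  define q' where "q' v = - 2 * ((fst w * fst v + snd w * snd v) * (q w * q w))" for v
  have q': "(q has_derivative q') (at w)"
    unfolding q'_def[abs_def] q_def by (rule inverse_quadratic_has_derivative)
  have D: "(stereo R has_derivative (\<lambda>v. (2 * R * (fst w * q' v + fst v * q w)) *\<^sub>R axis 1 1 +
      (2 * R * (snd w * q' v + snd v * q w)) *\<^sub>R axis 2 1 + (0 + (- 2 * R) * q' v) *\<^sub>R axis 3 1)) (at w)"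
    unfolding eq
    by (intro has_derivative_add has_derivative_scaleR_left has_derivative_mult_right has_derivative_mult
        has_derivative_const has_derivative_fst has_derivative_snd has_derivative_ident q')
  show ?thesis
    unfolding frechet_derivative_at[OF D, symmetric] by (simp add: frame3_def q'_def)
qed

text \<open>Stereographic projection is conformal, and the tangent plane of the sphere is orthogonal
  to the position vector. Dividing the partial derivatives by \<open>2 * R * q w\<close> therefore
  gives the orthonormal basis in which the integrand is evaluated.\<close>

lemma stereo_geometry:
  fixes R :: real
  defines "q \<equiv> \<lambda>w. inverse (1 + (fst w)\<^sup>2 + (snd w :: real)\<^sup>2)"
  shows "partial_s (stereo R) w \<bullet> partial_s (stereo R) w = (2 * R * q w)\<^sup>2"
    and "partial_t (stereo R) w \<bullet> partial_t (stereo R) w = (2 * R * q w)\<^sup>2"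
    and "partial_s (stereo R) w \<bullet> partial_t (stereo R) w = 0"
    and "stereo R w \<bullet> partial_s (stereo R) w = 0"
    and "stereo R w \<bullet> partial_t (stereo R) w = 0"
    and "stereo R w \<bullet> stereo R w = R\<^sup>2"
proof -
  obtain s t where w: "w = (s, t)" by (cases w)
  define p where "p = q w"
  \<comment> \<open>Modulo this relation all six claims are polynomial identities in
    \<open>s\<close>, \<open>t\<close>, \<open>p\<close> and \<open>R\<close>.\<close>
  have p: "p * (1 + s\<^sup>2 + t\<^sup>2) = 1"
    using one_plus_squares_pos[of s t] by (simp add: p_def q_def w)
  have pq: "inverse (1 + (fst w)\<^sup>2 + (snd w)\<^sup>2) = p" by (simp add: p_def q_def)
  have st: "stereo R w = std_frame (2 * R * (s * p), 2 * R * (t * p), R + (- 2 * R) * p)"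
    by (simp add: stereo_def Let_def p_def q_def w)
  have ds: "partial_s (stereo R) w = std_frame (2 * R * (p - 2 * s * s * p * p), 2 * R * (- 2 * s * t * p * p), 4 * R * (s * p * p))"
    unfolding stereo_derivative pq by (simp add: w algebra_simps)
  have dt: "partial_t (stereo R) w = std_frame (2 * R * (- 2 * s * t * p * p), 2 * R * (p - 2 * t * t * p * p), 4 * R * (t * p * p))"
    unfolding stereo_derivative pq by (simp add: w algebra_simps)
  show "partial_s (stereo R) w \<bullet> partial_s (stereo R) w = (2 * R * q w)\<^sup>2"
    unfolding ds std_frame_inner p_def[symmetric] using p by algebra
  show "partial_t (stereo R) w \<bullet> partial_t (stereo R) w = (2 * R * q w)\<^sup>2"
    unfolding dt std_frame_inner p_def[symmetric] using p by algebra
  show "partial_s (stereo R) w \<bullet> partial_t (stereo R) w = 0"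
    unfolding ds dt std_frame_inner using p by algebra
  show "stereo R w \<bullet> partial_s (stereo R) w = 0"
    unfolding ds st std_frame_inner using p by algebra
  show "stereo R w \<bullet> partial_t (stereo R) w = 0"
    unfolding dt st std_frame_inner using p by algebra
  show "stereo R w \<bullet> stereo R w = R\<^sup>2"
    unfolding st std_frame_inner using p by algebra
qed

lemma stereo_inverse:
  assumes R: "R \<noteq> 0"
  defines "g \<equiv> \<lambda>x::real^3. (x$1 / (R - x$3), x$2 / (R - x$3))"
  shows "g (stereo R w) = w"
    and "norm x = \<bar>R\<bar> \<Longrightarrow> x$3 \<noteq> R \<Longrightarrow> stereo R (g x) = x"
    and "stereo R w $ 3 \<noteq> R"
proof -
  have q: "inverse (1 + (fst w)\<^sup>2 + (snd w)\<^sup>2) \<noteq> 0"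
    using one_plus_squares_pos[of "fst w" "snd w"] by simp
  show "stereo R w $ 3 \<noteq> R"
    using q R by (simp add: stereo_def Let_def std_frame_nth)
  show "g (stereo R w) = w"
    using q R by (simp add: g_def stereo_def Let_def std_frame_nth prod_eq_iff)
  assume x: "norm x = \<bar>R\<bar>" "x$3 \<noteq> R"
  have "(x$1)\<^sup>2 + (x$2)\<^sup>2 + (x$3)\<^sup>2 = x \<bullet> x"
    by (simp add: inner_vec_def sum_3 power2_eq_square)
  then have xs: "(x$1)\<^sup>2 + (x$2)\<^sup>2 + (x$3)\<^sup>2 = R\<^sup>2"
    using x(1) by (simp add: dot_square_norm)
  define d where "d = R - x$3"
  have d: "d \<noteq> 0" using x(2) by (simp add: d_def)
  define X where "X = 1 + (x$1 / d)\<^sup>2 + (x$2 / d)\<^sup>2"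
  have "X * d * d = d\<^sup>2 + (x$1)\<^sup>2 + (x$2)\<^sup>2"
    using d by (simp add: X_def power2_eq_square distrib_right)
  also have "\<dots> = 2 * R * d" using xs unfolding d_def by algebra
  finally have "X * d = 2 * R" using d by simp
  then have "X = 2 * R / d" using d by (simp add: field_simps)
  then have "inverse X = d / (2 * R)" by simp
  then have "stereo R (g x) = std_frame (2 * R * (x$1 / d * (d / (2 * R))), 2 * R * (x$2 / d * (d / (2 * R))), R + (- 2 * R) * (d / (2 * R)))"
    by (simp add: stereo_def g_def Let_def d_def[symmetric] X_def)
  also have "\<dots> = x"
    using d R by (intro vec3_eqI) (simp_all add: std_frame_nth, simp add: d_def)
  finally show "stereo R (g x) = x" .
qed

lemma stereo_range:
  assumes R: "R \<noteq> 0"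
  shows "range (stereo R) = sphere 0 \<bar>R\<bar> - {std_frame (0, 0, R)}"
proof
  show "range (stereo R) \<subseteq> sphere 0 \<bar>R\<bar> - {std_frame (0, 0, R)}"
    using stereo_inverse(3)[OF R] stereo_geometry(6)[of R]
    by (auto simp: norm_eq_sqrt_inner std_frame_nth) (metis std_frame_nth(3))
  show "sphere 0 \<bar>R\<bar> - {std_frame (0, 0, R)} \<subseteq> range (stereo R)"
  proof
    fix x assume x: "x \<in> sphere 0 \<bar>R\<bar> - {std_frame (0, 0, R)}"
    then have n: "norm x = \<bar>R\<bar>" by simp
    have "x$3 \<noteq> R"
    proof
      assume x3: "x$3 = R"
      have "(x$1)\<^sup>2 + (x$2)\<^sup>2 + (x$3)\<^sup>2 = x \<bullet> x"
        by (simp add: inner_vec_def sum_3 power2_eq_square)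
      then have "(x$1)\<^sup>2 + (x$2)\<^sup>2 = 0"
        using n x3 by (simp add: dot_square_norm)
      then have "x = std_frame (0, 0, R)"
        using x3 by (intro vec3_eqI) (simp_all add: std_frame_nth sum_power2_eq_zero_iff)
      with x show False by simp
    qed
    from stereo_inverse(2)[OF R n this] show "x \<in> range (stereo R)"
      by (metis rangeI)
  qed
qed

lemma stereo_local_parametrization:
  assumes R: "R \<noteq> 0"
  shows "local_parametrization (sphere 0 \<bar>R\<bar>) UNIV (stereo R)"
  unfolding local_parametrization_def
proof (intro conjI ballI)
  fix w :: "real \<times> real"
  have d: "stereo R differentiable at w"
    using smooth_on_differentiable[OF smooth_on_stereo] by blast
  have q: "2 * R * inverse (1 + (fst w)\<^sup>2 + (snd w)\<^sup>2) \<noteq> 0"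
    using one_plus_squares_pos[of "fst w" "snd w"] R by simp
  show "inj (frechet_derivative (stereo R) (at w))"
  proof (subst linear_injective_0[OF linear_frechet_derivative[OF d]], intro allI impI)
    fix v assume v: "frechet_derivative (stereo R) (at w) v = 0"
    obtain c e where ce: "v = (c, e)" by (cases v)
    have "c *\<^sub>R partial_s (stereo R) w + e *\<^sub>R partial_t (stereo R) w = 0"
      using v unfolding ce frechet_derivative_partials[OF d, of c e] .
    then have "(c *\<^sub>R partial_s (stereo R) w + e *\<^sub>R partial_t (stereo R) w) \<bullet> partial_s (stereo R) w = 0"
      "(c *\<^sub>R partial_s (stereo R) w + e *\<^sub>R partial_t (stereo R) w) \<bullet> partial_t (stereo R) w = 0" by simp_all
    then show "v = 0"
      using q by (simp add: inner_add_left stereo_geometry inner_commute[of "partial_t (stereo R) w" "partial_s (stereo R) w"] ce zero_prod_def)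
  qed
next
  have "openin (top_of_set (sphere 0 \<bar>R\<bar>)) (sphere 0 \<bar>R\<bar> \<inter> - {std_frame (0, 0, R)})"
    by (intro openin_open_Int) auto
  then show "openin (top_of_set (sphere 0 \<bar>R\<bar>)) (range (stereo R))"
    unfolding stereo_range[OF R] Diff_eq .
  show "\<exists>g. homeomorphism UNIV (range (stereo R)) (stereo R) g"
  proof
    show "homeomorphism UNIV (range (stereo R)) (stereo R) (\<lambda>x. (x$1 / (R - x$3), x$2 / (R - x$3)))"
      unfolding homeomorphism_def
    proof (intro conjI)
      show "continuous_on (range (stereo R)) (\<lambda>x. (x$1 / (R - x$3), x$2 / (R - x$3)))"
        using stereo_inverse(3)[OF R] by (intro continuous_intros) (auto dest: sym)
    qed (auto simp: stereo_inverse[OF R] image_image smooth_on_C1(3)[OF smooth_on_stereo])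
  qed
qed (auto simp: smooth_on_stereo)

text \<open>The position vector is normal to the sphere, so the term with
  \<open>x \<bullet> v\<close> vanishes on the tangent plane. Both eigenvalues are then
  \<open>A = 1 + a^2 R^2\<close>, and the area density collapses to \<open>A^2\<close>.\<close>

lemma hausdorff_area_integrand_sphere:
  assumes R: "R \<noteq> 0"
  shows "phi_area a (stereo R w) (partial_s (stereo R) w) (partial_t (stereo R) w) =
    4 * R\<^sup>2 * (1 + a\<^sup>2 * R\<^sup>2)\<^sup>2 / (1 + (norm w)\<^sup>2)\<^sup>2"
proof -
  define k where "k = 2 * R * inverse (1 + (fst w)\<^sup>2 + (snd w)\<^sup>2)"
  have k: "k \<noteq> 0" using one_plus_squares_pos[of "fst w" "snd w"] R by (simp add: k_def)
  define e1 e2 where "e1 = (1 / k) *\<^sub>R partial_s (stereo R) w" and "e2 = (1 / k) *\<^sub>R partial_t (stereo R) w"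
  note geo = stereo_geometry[of R w, folded k_def]
  have e: "e1 \<bullet> e1 = 1" "e2 \<bullet> e2 = 1" "e1 \<bullet> e2 = 0"
    using k by (simp_all add: e1_def e2_def geo power2_eq_square)
  have x: "stereo R w \<bullet> e2 = 0" "stereo R w \<bullet> e1 = 0" by (simp_all add: e1_def e2_def geo)
  have nx: "(norm (stereo R w))\<^sup>2 = R\<^sup>2" unfolding power2_norm_eq_inner geo ..
  have v: "partial_s (stereo R) w = k *\<^sub>R e1 + 0 *\<^sub>R e2" "partial_t (stereo R) w = 0 *\<^sub>R e1 + k *\<^sub>R e2"
    using k by (simp_all add: e1_def e2_def)
  have D: "k * k - 0 * 0 \<noteq> 0" using k by simp
  define A where "A = 1 + a\<^sup>2 * R\<^sup>2"
  have A: "A > 0" "A + a\<^sup>2 * 0\<^sup>2 = A" by (simp_all add: A_def add_pos_nonneg)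
  have "2 * (A * A) * sqrt (A * A) / (A + A) = A\<^sup>2"
    using A(1) by (simp add: power2_eq_square mult_2[symmetric] del: mult_2)
  then have "phi_area a (stereo R w) (partial_s (stereo R) w) (partial_t (stereo R) w) =
      \<bar>k * k\<bar> * A\<^sup>2"
    using hausdorff_area_integrand_phi[OF e x(1) v D, of a]
    unfolding nx x(2) A_def[symmetric] A(2) by simp
  also have "\<bar>k * k\<bar> = 4 * R\<^sup>2 / (1 + (norm w)\<^sup>2)\<^sup>2"
  proof -
    have "1 + (norm w)\<^sup>2 = 1 + (fst w)\<^sup>2 + (snd w)\<^sup>2"
      by (simp add: norm_prod_def)
    then have "k = 2 * R / (1 + (norm w)\<^sup>2)" by (simp add: k_def divide_inverse)
    then show ?thesis unfolding abs_mult_self_eq by (simp add: power2_eq_square)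
  qed
  finally show ?thesis by (simp add: A_def)
qed

section \<open>Radial integrals and the integral over a sphere\<close>

lemma nn_integral_cauchy: "(\<integral>\<^sup>+ t. ennreal (1 / (1 + t\<^sup>2)) \<partial>lborel) = ennreal pi"
proof -
  have "(\<integral>\<^sup>+ t. ennreal (1 / (1 + t\<^sup>2)) \<partial>lborel) = ennreal (pi / 2 - (- (pi / 2)))"
    by (rule nn_integral_FTC_UNIV[OF _ _ _ tendsto_arctan_at_top tendsto_arctan_at_bot])
       (auto intro!: derivative_eq_intros simp: field_simps add_pos_nonneg)
  then show ?thesis by simp
qed

lemma nn_integral_radial:
  fixes h :: "real \<Rightarrow> ennreal"
  assumes [measurable]: "h \<in> borel_measurable borel"
  shows "(\<integral>\<^sup>+ w. h (norm w) \<partial>(lborel :: (real \<times> real) measure)) =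
    ennreal (2 * pi) * (\<integral>\<^sup>+ x \<in> {0..}. (ennreal x * h x) \<partial>lborel)"
proof -
  define J where "J = (\<integral>\<^sup>+ x. ennreal \<bar>x\<bar> * h \<bar>x\<bar> \<partial>lborel)"
  have "(\<integral>\<^sup>+ w. h (norm w) \<partial>(lborel :: (real \<times> real) measure)) =
      (\<integral>\<^sup>+ x. \<integral>\<^sup>+ y. h (sqrt (x\<^sup>2 + y\<^sup>2)) \<partial>lborel \<partial>lborel)"
    by (subst nn_integral_lborel_pair(1)) (simp_all add: norm_Pair)
  also have "\<dots> = (\<integral>\<^sup>+ t. \<integral>\<^sup>+ x. ennreal \<bar>x\<bar> * h (sqrt (x\<^sup>2 + (x * t)\<^sup>2)) \<partial>lborel \<partial>lborel)"
    by (rule nn_integral_slope) measurable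
  also have "\<dots> = (\<integral>\<^sup>+ t. ennreal (1 / (1 + t\<^sup>2)) * J \<partial>lborel)"
  proof (rule nn_integral_cong)
    fix t :: real
    \<comment> \<open>On the line of slope \<open>t\<close> the distance from the origin is the
      absolute value of \<open>c * x\<close>. Rescaling gives \<open>1 / c\<close> from the weight
      and \<open>1 / c\<close> from the measure, together \<open>1 / (1 + t^2)\<close>. The slopes
      integrate to \<open>pi\<close>, half a turn, and the two signs of \<open>x\<close> supply the
      factor 2.\<close>
    define c where "c = sqrt (1 + t\<^sup>2)"
    have c: "c > 0" "c * c = 1 + t\<^sup>2" by (simp_all add: c_def add_pos_nonneg)
    have "sqrt (x\<^sup>2 + (x * t)\<^sup>2) = \<bar>c * x\<bar>" for x
    proof -
      have "(c * x)\<^sup>2 = (c * c) * x\<^sup>2" by (simp add: power2_eq_square)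
      then have "x\<^sup>2 + (x * t)\<^sup>2 = (c * x)\<^sup>2" unfolding c(2) by (simp add: power2_eq_square algebra_simps)
      then show ?thesis by simp
    qed
    then have "(\<integral>\<^sup>+ x. ennreal \<bar>x\<bar> * h (sqrt (x\<^sup>2 + (x * t)\<^sup>2)) \<partial>lborel) =
        (\<integral>\<^sup>+ x. ennreal (1 / c) * (ennreal \<bar>0 + c * x\<bar> * h \<bar>0 + c * x\<bar>) \<partial>lborel)"
      using c(1) by (intro nn_integral_cong) (simp add: mult.assoc[symmetric] ennreal_mult[symmetric] abs_mult)
    also have "\<dots> = ennreal (1 / c) * (\<integral>\<^sup>+ x. ennreal \<bar>0 + c * x\<bar> * h \<bar>0 + c * x\<bar> \<partial>lborel)"
      by (rule nn_integral_cmult) measurable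
    also have "\<dots> = ennreal (1 / (1 + t\<^sup>2)) * (ennreal \<bar>c\<bar> * (\<integral>\<^sup>+ x. ennreal \<bar>0 + c * x\<bar> * h \<bar>0 + c * x\<bar> \<partial>lborel))"
      using c by (simp add: mult.assoc[symmetric] ennreal_mult[symmetric] c(2)[symmetric])
    also have "ennreal \<bar>c\<bar> * (\<integral>\<^sup>+ x. ennreal \<bar>0 + c * x\<bar> * h \<bar>0 + c * x\<bar> \<partial>lborel) = J"
      unfolding J_def by (rule nn_integral_real_affine[symmetric]) (use c in auto)
    finally show "(\<integral>\<^sup>+ x. ennreal \<bar>x\<bar> * h (sqrt (x\<^sup>2 + (x * t)\<^sup>2)) \<partial>lborel) = ennreal (1 / (1 + t\<^sup>2)) * J" .
  qed
  also have "\<dots> = (\<integral>\<^sup>+ t. ennreal (1 / (1 + t\<^sup>2)) \<partial>lborel) * J"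
    by (rule nn_integral_multc) measurable
  also note nn_integral_cauchy
  also have "J = (\<integral>\<^sup>+ x \<in> {0..}. (ennreal \<bar>x\<bar> * h \<bar>x\<bar>) \<partial>lborel) + (\<integral>\<^sup>+ x \<in> {0..}. (ennreal \<bar>- x\<bar> * h \<bar>- x\<bar>) \<partial>lborel)"
    unfolding J_def by (rule nn_integral_halves) measurable
  also have "(\<integral>\<^sup>+ x \<in> {0..}. (ennreal \<bar>- x\<bar> * h \<bar>- x\<bar>) \<partial>lborel) = (\<integral>\<^sup>+ x \<in> {0..}. (ennreal \<bar>x\<bar> * h \<bar>x\<bar>) \<partial>lborel)"
    by simp
  also have "(\<integral>\<^sup>+ x \<in> {0..}. (ennreal \<bar>x\<bar> * h \<bar>x\<bar>) \<partial>lborel) = (\<integral>\<^sup>+ x \<in> {0..}. (ennreal x * h x) \<partial>lborel)"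
    by (intro nn_integral_cong) (simp add: indicator_def)
  finally have "(\<integral>\<^sup>+ w. h (norm w) \<partial>(lborel :: (real \<times> real) measure)) =
      ennreal pi * ((\<integral>\<^sup>+ x \<in> {0..}. (ennreal x * h x) \<partial>lborel) + (\<integral>\<^sup>+ x \<in> {0..}. (ennreal x * h x) \<partial>lborel))" .
  moreover have "ennreal (2 * pi) = ennreal pi * 2"
    by (simp add: ennreal_mult mult.commute)
  ultimately show ?thesis
    by (simp only: mult_2[symmetric] mult.assoc)
qed

lemma sphere_has_surface_integral:
  assumes R: "R > 0"
  shows "has_surface_integral (phi_area a) (sphere 0 R)
    (ennreal (4 * pi * R\<^sup>2 * (1 + a\<^sup>2 * R\<^sup>2)\<^sup>2))"
proof -
  have lp: "local_parametrization (sphere 0 R) UNIV (stereo R)" "local_parametrization (sphere 0 R) UNIV (stereo (- R))"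
    using stereo_local_parametrization[of R] stereo_local_parametrization[of "- R"] R by auto
  have rg: "range (stereo R) = sphere 0 R - {std_frame (0, 0, R)}" "range (stereo (- R)) = sphere 0 R - {std_frame (0, 0, - R)}"
    using stereo_range[of R] stereo_range[of "- R"] R by auto
  have ne: "std_frame (0, 0, R) \<noteq> std_frame (0, 0, - R)"
  proof
    assume "std_frame (0, 0, R) = std_frame (0, 0, - R)"
    from arg_cong[OF this, of "\<lambda>x. x$3"] R show False by (simp add: std_frame_nth)
  qed
  have N: "sphere 0 R = range (stereo R) \<union> range (stereo (- R))"
    unfolding rg using ne by auto
  \<comment> \<open>The first chart misses only its pole, so the second one adds the single
    parameter that is mapped to this pole.\<close>
  have "w = (\<lambda>x. (x$1 / (- R - x$3), x$2 / (- R - x$3))) (std_frame (0, 0, R))"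
    if "w \<in> UNIV - stereo (- R) -` range (stereo R)" for w
  proof -
    have "stereo (- R) w \<in> sphere 0 R" using N by blast
    then have "stereo (- R) w = std_frame (0, 0, R)" using that unfolding rg by simp
    then show ?thesis using stereo_inverse(1)[of "- R" w] R by simp
  qed
  then have "UNIV - stereo (- R) -` range (stereo R) \<subseteq> {(\<lambda>x. (x$1 / (- R - x$3), x$2 / (- R - x$3))) (std_frame (0, 0, R))}"
    by blast
  then have "finite (UNIV - stereo (- R) -` range (stereo R))"
    using finite_subset by blast
  then have null: "UNIV - stereo (- R) -` range (stereo R) \<in> null_sets lborel"
    by (rule finite_imp_null_set_lborel)
  have "has_surface_integral (phi_area a) (sphere 0 R)
    (\<integral>\<^sup>+ w \<in> UNIV. ennreal (phi_area a (stereo R w) (partial_s (stereo R) w) (partial_t (stereo R) w)) \<partial>lborel)"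
    by (rule has_surface_integral_chart[OF lp N null])
  moreover have "(\<integral>\<^sup>+ w \<in> UNIV. ennreal (phi_area a (stereo R w) (partial_s (stereo R) w) (partial_t (stereo R) w)) \<partial>lborel) =
      ennreal (4 * pi * R\<^sup>2 * (1 + a\<^sup>2 * R\<^sup>2)\<^sup>2)"
  proof -
    define K where "K = 4 * R\<^sup>2 * (1 + a\<^sup>2 * R\<^sup>2)\<^sup>2"
    have K: "K \<ge> 0" by (simp add: K_def)
    define L where "L = K / 2"
    have KL: "K = 2 * L" by (simp add: L_def)
    have lim: "((\<lambda>x. - L / (1 + x\<^sup>2)) \<longlongrightarrow> 0) at_top"
      by real_asymp
    have "(\<integral>\<^sup>+ x. ennreal (x * (K / (1 + x\<^sup>2)\<^sup>2)) * indicator {0..} x \<partial>lborel) = ennreal (0 - (- L / (1 + 0\<^sup>2)))"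
    proof (rule nn_integral_FTC_atLeast[OF _ _ _ lim])
      fix x :: real
      have "1 + x\<^sup>2 \<noteq> 0" by (metis add_pos_nonneg less_irrefl zero_le_power2 zero_less_one)
      then show "DERIV (\<lambda>x. - L / (1 + x\<^sup>2)) x :> x * (K / (1 + x\<^sup>2)\<^sup>2)"
        unfolding KL by (auto intro!: derivative_eq_intros simp: power2_eq_square)
    qed (use K in auto)
    moreover have "ennreal x * ennreal (K / (1 + x\<^sup>2)\<^sup>2) * indicator {0..} x = ennreal (x * (K / (1 + x\<^sup>2)\<^sup>2)) * indicator {0..} x" for x
      using K by (auto simp: indicator_def ennreal_mult[symmetric])
    ultimately have r: "(\<integral>\<^sup>+ x \<in> {0..}. (ennreal x * ennreal (K / (1 + x\<^sup>2)\<^sup>2)) \<partial>lborel) = ennreal (K / 2)"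
      by (simp add: L_def)
    have "(\<integral>\<^sup>+ w \<in> UNIV. ennreal (phi_area a (stereo R w) (partial_s (stereo R) w) (partial_t (stereo R) w)) \<partial>lborel) =
        (\<integral>\<^sup>+ w. ennreal (K / (1 + (norm w)\<^sup>2)\<^sup>2) \<partial>(lborel :: (real \<times> real) measure))"
      using R by (intro nn_integral_cong) (simp add: hausdorff_area_integrand_sphere K_def)
    also have "\<dots> = ennreal (2 * pi) * ennreal (K / 2)"
      unfolding r[symmetric] by (rule nn_integral_radial) measurable
    also have "\<dots> = ennreal (4 * pi * R\<^sup>2 * (1 + a\<^sup>2 * R\<^sup>2)\<^sup>2)"
      using K by (simp add: ennreal_mult[symmetric] K_def mult_ac)
    finally show ?thesis .
  qed
  ultimately show ?thesis by simp
qed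

section \<open>Averaging crossing numbers\<close>

lemma fst_borel_measurable [measurable]:
  "(fst :: 'a::second_countable_topology \<times> 'b::second_countable_topology \<Rightarrow> 'a) \<in> borel_measurable borel"
  by (intro borel_measurable_continuous_onI continuous_intros)

lemma snd_borel_measurable [measurable]:
  "(snd :: 'a::second_countable_topology \<times> 'b::second_countable_topology \<Rightarrow> 'b) \<in> borel_measurable borel"
  by (intro borel_measurable_continuous_onI continuous_intros)

text \<open>With \<open>line_weight\<close> this turns integrals over lines into integrals against
  \<open>lborel\<close>, where the order of integration can be exchanged.\<close>

definition line_of :: "(real^3) \<times> (real^3) \<Rightarrow> (real^3) \<times> (real^3)" where
  "line_of w = (sgn (fst w), snd w - (snd w \<bullet> sgn (fst w)) *\<^sub>R sgn (fst w))"

definition line_weight :: "(real^3) \<times> (real^3) \<Rightarrow> ennreal" where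
  "line_weight w = 3 * (indicator (cball 0 1) (fst w) * indicator {0..1} (snd w \<bullet> sgn (fst w)))"

lemma line_of_measurable [measurable]: "line_of \<in> borel_measurable borel"
  unfolding line_of_def[abs_def] borel_prod[symmetric] by measurable

lemma line_weight_measurable [measurable]: "line_weight \<in> borel_measurable borel"
  unfolding line_weight_def[abs_def] by measurable

lemma nn_integral_line_measure_weight:
  assumes [measurable]: "h \<in> borel_measurable borel"
  shows "(\<integral>\<^sup>+ l. h l \<partial>line_measure) = (\<integral>\<^sup>+ w. line_weight w * h (line_of w) \<partial>lborel)"
proof -
  have "(\<integral>\<^sup>+ w. line_weight w * h (line_of w) \<partial>lborel) =
      (\<integral>\<^sup>+ w. 3 * (indicator (cball 0 1) (fst w) * (indicator {0..1} (snd w \<bullet> sgn (fst w)) * h (line_of w))) \<partial>lborel)"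
    by (simp add: line_weight_def mult.assoc)
  also have "\<dots> = 3 * (\<integral>\<^sup>+ w. indicator (cball 0 1) (fst w) * (indicator {0..1} (snd w \<bullet> sgn (fst w)) * h (line_of w)) \<partial>lborel)"
    by (rule nn_integral_cmult) measurable
  also have "(\<integral>\<^sup>+ w. indicator (cball 0 1) (fst w) * (indicator {0..1} (snd w \<bullet> sgn (fst w)) * h (line_of w)) \<partial>lborel) =
      (\<integral>\<^sup>+ x. \<integral>\<^sup>+ y. indicator (cball 0 1) (fst (x, y)) * (indicator {0..1} (snd (x, y) \<bullet> sgn (fst (x, y))) * h (line_of (x, y))) \<partial>lborel \<partial>lborel)"
    by (rule nn_integral_lborel_pair(1)) measurable
  finally show ?thesis
    unfolding nn_integral_line_measure[OF assms] by (simp add: line_of_def)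
qed

section \<open>Crossings of a line with spheres and discs\<close>

lemma oriented_line_norm:
  assumes "l \<in> oriented_lines"
  shows "(norm (snd l + t *\<^sub>R fst l))\<^sup>2 = (norm (snd l))\<^sup>2 + t\<^sup>2"
  using assms unfolding power2_norm_eq_inner oriented_lines_def
  by (auto simp: inner_add_left inner_add_right inner_commute norm_eq_1 power2_eq_square)

lemma crossing_number_parameters:
  assumes "l \<in> oriented_lines"
  shows "crossing_number l N = emeasure (count_space UNIV) {t. snd l + t *\<^sub>R fst l \<in> N}"
proof -
  have "fst l \<noteq> 0" using assms by (auto simp: oriented_lines_def)
  then have inj: "inj_on (\<lambda>t. snd l + t *\<^sub>R fst l) {t. snd l + t *\<^sub>R fst l \<in> N}"
    by (auto simp: inj_on_def)
  have "line_points l \<inter> N = (\<lambda>t. snd l + t *\<^sub>R fst l) ` {t. snd l + t *\<^sub>R fst l \<in> N}"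
    by (auto simp: line_points_def)
  then show ?thesis
    unfolding crossing_number_def using emeasure_count_space_inj_image[OF inj] by simp
qed

definition sphere_crossings :: "real \<Rightarrow> (real^3) \<times> (real^3) \<Rightarrow> ennreal" where
  "sphere_crossings R l = (if norm (snd l) < R then 2 else if norm (snd l) = R then 1 else 0)"

lemma crossing_number_sphere:
  assumes l: "l \<in> oriented_lines" and R: "R > 0"
  shows "crossing_number l (sphere 0 R) = sphere_crossings R l"
proof -
  let ?d = "R\<^sup>2 - (norm (snd l))\<^sup>2"
  have "snd l + t *\<^sub>R fst l \<in> sphere 0 R \<longleftrightarrow> t\<^sup>2 = ?d" for t
  proof -
    have "norm (snd l + t *\<^sub>R fst l) = R \<longleftrightarrow> (norm (snd l + t *\<^sub>R fst l))\<^sup>2 = R\<^sup>2"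
      using R by (simp add: power2_eq_iff_nonneg)
    then show ?thesis unfolding oriented_line_norm[OF l] by auto
  qed
  then have eq: "crossing_number l (sphere 0 R) = emeasure (count_space UNIV) {t. t\<^sup>2 = ?d}"
    unfolding crossing_number_parameters[OF l] by simp
  consider "norm (snd l) < R" | "norm (snd l) = R" | "norm (snd l) > R" by linarith
  then show ?thesis
  proof cases
    case 1
    then have d: "?d > 0" by (simp add: power_strict_mono)
    define e where "e = sqrt ?d"
    have e: "?d = e\<^sup>2" "e > 0" using d by (simp_all add: e_def)
    have "{t. t\<^sup>2 = e\<^sup>2} = {e, - e}" by (auto simp: power2_eq_iff)
    then show ?thesis
      unfolding eq e(1) using 1 e(2) by (simp add: sphere_crossings_def)
  next
    case 2
    then have "{t. t\<^sup>2 = ?d} = {0}" by auto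
    then show ?thesis unfolding eq using 2 by (simp add: sphere_crossings_def)
  next
    case 3
    then have "?d < 0" using R by (simp add: power_strict_mono)
    then have "t\<^sup>2 \<noteq> ?d" for t :: real using zero_le_power2[of t] by linarith
    then have none: "{t. t\<^sup>2 = ?d} = {}" by blast
    show ?thesis unfolding eq none using 3 by (simp add: sphere_crossings_def)
  qed
qed

text \<open>A transversal line reaches the plane at the parameter
  \<open>- (snd l \<bullet> n) / (fst l \<bullet> n)\<close>, and the distance from the origin
  follows by Pythagoras. A line inside the plane may share a whole chord with the disc, hence the
  infinite value.\<close>

definition disc_crossings :: "real^3 \<Rightarrow> (real^3) \<times> (real^3) \<Rightarrow> ennreal" where
  "disc_crossings n l =
     (if fst l \<bullet> n \<noteq> 0 then (if (norm (snd l))\<^sup>2 + ((snd l \<bullet> n) / (fst l \<bullet> n))\<^sup>2 < 1 then 1 else 0)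
      else if snd l \<bullet> n = 0 \<and> norm (snd l) < 1 then \<infinity> else 0)"

lemma crossing_number_disc:
  assumes l: "l \<in> oriented_lines"
  shows "crossing_number l (disc n) = disc_crossings n l"
proof -
  have in_disc: "snd l + t *\<^sub>R fst l \<in> disc n \<longleftrightarrow> snd l \<bullet> n + t * (fst l \<bullet> n) = 0 \<and> (norm (snd l))\<^sup>2 + t\<^sup>2 < 1" for t
  proof -
    have "norm (snd l + t *\<^sub>R fst l) < 1 \<longleftrightarrow> (norm (snd l + t *\<^sub>R fst l))\<^sup>2 < 1"
      by (simp add: power_less_one_iff abs_square_less_1[symmetric])
    then show ?thesis
      unfolding oriented_line_norm[OF l] by (simp add: disc_def inner_add_left)
  qed
  have eq: "crossing_number l (disc n) =
      emeasure (count_space UNIV) {t. snd l \<bullet> n + t * (fst l \<bullet> n) = 0 \<and> (norm (snd l))\<^sup>2 + t\<^sup>2 < 1}"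
    unfolding crossing_number_parameters[OF l] in_disc ..
  show ?thesis
  proof (cases "fst l \<bullet> n = 0")
    case False
    then have "snd l \<bullet> n + t * (fst l \<bullet> n) = 0 \<longleftrightarrow> t = - ((snd l \<bullet> n) / (fst l \<bullet> n))" for t
      by (simp add: field_simps add_eq_0_iff)
    then have "{t. snd l \<bullet> n + t * (fst l \<bullet> n) = 0 \<and> (norm (snd l))\<^sup>2 + t\<^sup>2 < 1} =
        (if (norm (snd l))\<^sup>2 + ((snd l \<bullet> n) / (fst l \<bullet> n))\<^sup>2 < 1 then {- ((snd l \<bullet> n) / (fst l \<bullet> n))} else {})"
      by auto
    then show ?thesis
      unfolding eq using False by (simp add: disc_crossings_def)
  next
    case True
    show ?thesis
    proof (cases "snd l \<bullet> n = 0 \<and> norm (snd l) < 1")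
      case in1: True
      then have "(norm (snd l))\<^sup>2 < 1" by (simp add: abs_square_less_1)
      define d where "d = sqrt (1 - (norm (snd l))\<^sup>2)"
      have d: "d > 0" using \<open>(norm (snd l))\<^sup>2 < 1\<close> by (simp add: d_def)
      have "{0<..<d} \<subseteq> {t. snd l \<bullet> n + t * (fst l \<bullet> n) = 0 \<and> (norm (snd l))\<^sup>2 + t\<^sup>2 < 1}"
      proof
        fix t assume t: "t \<in> {0<..<d}"
        then have "t\<^sup>2 < d\<^sup>2" by (intro power_strict_mono) auto
        also have "d\<^sup>2 = 1 - (norm (snd l))\<^sup>2" using \<open>(norm (snd l))\<^sup>2 < 1\<close> by (simp add: d_def)
        finally show "t \<in> {t. snd l \<bullet> n + t * (fst l \<bullet> n) = 0 \<and> (norm (snd l))\<^sup>2 + t\<^sup>2 < 1}"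
          using True in1 by simp
      qed
      then have "infinite {t. snd l \<bullet> n + t * (fst l \<bullet> n) = 0 \<and> (norm (snd l))\<^sup>2 + t\<^sup>2 < 1}"
        using infinite_Ioo[OF d] infinite_super by blast
      then show ?thesis
        unfolding eq using True in1 by (simp add: disc_crossings_def)
    next
      case False
      have "{t. snd l \<bullet> n + t * (fst l \<bullet> n) = 0 \<and> (norm (snd l))\<^sup>2 + t\<^sup>2 < 1} = {}"
      proof -
        have "norm (snd l) < 1" if "(norm (snd l))\<^sup>2 + t\<^sup>2 < 1" for t
        proof -
          have "(norm (snd l))\<^sup>2 < 1" using that zero_le_power2[of t] by linarith
          then show ?thesis by (simp add: abs_square_less_1)
        qed
        then show ?thesis using False True by auto
      qed
      then show ?thesis unfolding eq using True False by (auto simp: disc_crossings_def)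
    qed
  qed
qed

text \<open>What remains of the unit ball when the slope is split off: after rescaling, the integral
  over the other two variables is the same for every slope. Its value is
  \<open>4 / 3\<close>.\<close>

definition slope_mass :: ennreal where
  "slope_mass = (\<integral>\<^sup>+ c. \<integral>\<^sup>+ x. ennreal \<bar>x\<bar> * indicator {..1::real} (x\<^sup>2 + c\<^sup>2) \<partial>lborel \<partial>lborel)"

text \<open>For a random vector in the unit ball the quotient of two orthogonal coordinates is Cauchy distributed.\<close>

lemma slope_average:
  assumes e: "orthonormal3 e1 e2 e3" and [measurable]: "k \<in> borel_measurable borel"
  shows "(\<integral>\<^sup>+ n. indicator (cball 0 1) n * k ((e2 \<bullet> n) / (e1 \<bullet> n)) \<partial>lborel) =
    slope_mass * (\<integral>\<^sup>+ t. ennreal (1 / (1 + t\<^sup>2)) * k t \<partial>lborel)"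
proof -
  let ?v = "\<lambda>a b c. a *\<^sub>R e1 + b *\<^sub>R e2 + c *\<^sub>R e3"
  let ?k = "\<lambda>t. ennreal (1 / (1 + t\<^sup>2)) * k t"
  have n: "norm (a *\<^sub>R e1 + b *\<^sub>R e2 + c *\<^sub>R e3) = sqrt (a\<^sup>2 + b\<^sup>2 + c\<^sup>2)" for a b c
    using norm_frame3[OF e, of a b c] by (simp add: frame3_def)
  have i: "e1 \<bullet> (a *\<^sub>R e1 + b *\<^sub>R e2 + c *\<^sub>R e3) = a" "e2 \<bullet> (a *\<^sub>R e1 + b *\<^sub>R e2 + c *\<^sub>R e3) = b" for a b c
    using e by (simp_all add: orthonormal3_def inner_add_right inner_commute[of e2 e1])
  define q where "q c = (\<integral>\<^sup>+ x. ennreal \<bar>x\<bar> * indicator {..1::real} (x\<^sup>2 + c\<^sup>2) \<partial>lborel)" for c :: real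
  have [measurable]: "q \<in> borel_measurable borel" unfolding q_def by measurable
  have "(\<integral>\<^sup>+ n. indicator (cball 0 1) n * k ((e2 \<bullet> n) / (e1 \<bullet> n)) \<partial>lborel) =
      (\<integral>\<^sup>+ c. \<integral>\<^sup>+ a. \<integral>\<^sup>+ b. indicator (cball 0 1) (?v a b c) *
        k ((e2 \<bullet> (?v a b c)) / (e1 \<bullet> (?v a b c))) \<partial>lborel \<partial>lborel \<partial>lborel)"
    by (rule nn_integral_frame3[OF e]) measurable
  also have "\<dots> = (\<integral>\<^sup>+ c. \<integral>\<^sup>+ a. \<integral>\<^sup>+ b. indicator {..1} (a\<^sup>2 + b\<^sup>2 + c\<^sup>2) * k (b / a) \<partial>lborel \<partial>lborel \<partial>lborel)"
    by (simp add: n i indicator_def)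
  also have "\<dots> = (\<integral>\<^sup>+ c. q c * (\<integral>\<^sup>+ t. ?k t \<partial>lborel) \<partial>lborel)"
  proof (rule nn_integral_cong)
    fix c :: real
    let ?q = "\<lambda>x. ennreal \<bar>x\<bar> * indicator {..1::real} (x\<^sup>2 + c\<^sup>2)"
    have "(\<integral>\<^sup>+ a. \<integral>\<^sup>+ b. indicator {..1} (a\<^sup>2 + b\<^sup>2 + c\<^sup>2) * k (b / a) \<partial>lborel \<partial>lborel) =
        (\<integral>\<^sup>+ t. \<integral>\<^sup>+ a. ennreal \<bar>a\<bar> * (indicator {..1} (a\<^sup>2 + (a * t)\<^sup>2 + c\<^sup>2) * k (a * t / a)) \<partial>lborel \<partial>lborel)"
      by (rule nn_integral_slope) measurable
    also have "\<dots> = (\<integral>\<^sup>+ t. q c * (?k t) \<partial>lborel)"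
    proof (rule nn_integral_cong)
      fix t :: real
      \<comment> \<open>Rescaling \<open>a\<close> by \<open>d\<close> makes the condition of lying
        in the ball independent of \<open>t\<close>; the weight and the measure each give up a
        factor \<open>1 / d\<close>, which produces the Cauchy density.\<close>
      define d where "d = sqrt (1 + t\<^sup>2)"
      have d: "d > 0" "d * d = 1 + t\<^sup>2" by (simp_all add: d_def add_pos_nonneg)
      have sq: "a\<^sup>2 + (a * t)\<^sup>2 = (0 + d * a)\<^sup>2" for a
      proof -
        have "(0 + d * a)\<^sup>2 = (d * d) * a\<^sup>2" by (simp add: power2_eq_square)
        then show ?thesis unfolding d(2) by (simp add: power2_eq_square algebra_simps)
      qed
      have "(\<integral>\<^sup>+ a. ennreal \<bar>a\<bar> * (indicator {..1} (a\<^sup>2 + (a * t)\<^sup>2 + c\<^sup>2) * k (a * t / a)) \<partial>lborel) =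
          (\<integral>\<^sup>+ a. (ennreal (1 / d) * k t) * (?q (0 + d * a)) \<partial>lborel)"
      proof (rule nn_integral_cong)
        fix a :: real
        have eq: "ennreal \<bar>a\<bar> = ennreal (1 / d) * ennreal \<bar>0 + d * a\<bar>"
          using d(1) by (simp add: ennreal_mult[symmetric] abs_mult)
        show "ennreal \<bar>a\<bar> * (indicator {..1} (a\<^sup>2 + (a * t)\<^sup>2 + c\<^sup>2) * k (a * t / a)) =
            (ennreal (1 / d) * k t) * (?q (0 + d * a))"
        \<comment> \<open>At \<open>a = 0\<close> the quotient \<open>a * t / a\<close> is not
          \<open>t\<close>, but the weight vanishes there.\<close>
        proof (cases "a = 0")
          case False
          then have at: "a * t / a = t" by simp
          show ?thesis unfolding sq at eq by (simp only: mult_ac)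
        qed simp
      qed
      also have "\<dots> = (ennreal (1 / d) * k t) * (\<integral>\<^sup>+ a. ?q (0 + d * a) \<partial>lborel)"
        by (rule nn_integral_cmult) measurable
      also have "\<dots> = (?k t) * (ennreal \<bar>d\<bar> * (\<integral>\<^sup>+ a. ?q (0 + d * a) \<partial>lborel))"
      proof -
        have "ennreal (1 / d) = ennreal (1 / (1 + t\<^sup>2)) * ennreal \<bar>d\<bar>"
          using d by (simp add: ennreal_mult[symmetric] d(2)[symmetric])
        then show ?thesis by (simp only: mult_ac)
      qed
      also have "ennreal \<bar>d\<bar> * (\<integral>\<^sup>+ a. ?q (0 + d * a) \<partial>lborel) = q c"
        unfolding q_def by (rule nn_integral_real_affine[symmetric]) (use d in auto)
      finally show "(\<integral>\<^sup>+ a. ennreal \<bar>a\<bar> * (indicator {..1} (a\<^sup>2 + (a * t)\<^sup>2 + c\<^sup>2) * k (a * t / a)) \<partial>lborel) =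
          q c * (?k t)" by (simp only: mult_ac)
    qed
    also have "\<dots> = q c * (\<integral>\<^sup>+ t. ?k t \<partial>lborel)"
      by (rule nn_integral_cmult) measurable
    finally show "(\<integral>\<^sup>+ a. \<integral>\<^sup>+ b. indicator {..1} (a\<^sup>2 + b\<^sup>2 + c\<^sup>2) * k (b / a) \<partial>lborel \<partial>lborel) =
        q c * (\<integral>\<^sup>+ t. ?k t \<partial>lborel)" .
  qed
  also have "\<dots> = slope_mass * (\<integral>\<^sup>+ t. ?k t \<partial>lborel)"
    unfolding slope_mass_def q_def[symmetric] by (rule nn_integral_multc) measurable
  finally show ?thesis .
qed

lemma slope_mass:
  "slope_mass * ennreal pi = emeasure lborel (cball (0::real^3) 1)"
  "slope_mass \<noteq> 0" "slope_mass \<noteq> \<infinity>"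
proof -
  show eq: "slope_mass * ennreal pi = emeasure lborel (cball (0::real^3) 1)"
    using slope_average[OF orthonormal3_axis, of "\<lambda>_. 1"] by (simp add: nn_integral_cauchy)
  have v: "emeasure lborel (cball (0::real^3) 1) = ennreal (4 / 3 * pi)"
    by (simp add: emeasure_cball unit_ball_vol_3)
  show "slope_mass \<noteq> 0" using eq unfolding v by auto
  show "slope_mass \<noteq> \<infinity>"
    using eq unfolding v by (auto simp: ennreal_top_mult)
qed

text \<open>Let \<open>r\<close> be the distance of the line from the origin and \<open>e2\<close>
  the direction of its closest point. The disc with normal \<open>n\<close> is crossed when
  \<open>r^2 (1 + t^2) < 1\<close> for \<open>t = (e2 \<bullet> n) / (u \<bullet> n)\<close>, which
  says that the line enters the sphere of radius \<open>1 / sqrt (1 + t^2)\<close>. The line crosses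
  that sphere twice, hence the factor 2, and \<open>t\<close> is Cauchy distributed when
  \<open>n\<close> is averaged over the ball.\<close>

lemma crossing_average:
  assumes l: "l \<in> oriented_lines"
  shows "2 * (\<integral>\<^sup>+ n. indicator (cball 0 1) n * disc_crossings n l \<partial>lborel) =
    slope_mass * (\<integral>\<^sup>+ t. ennreal (1 / (1 + t\<^sup>2)) * sphere_crossings (1 / sqrt (1 + t\<^sup>2)) l \<partial>lborel)"
proof -
  define r where "r = norm (snd l)"
  obtain u p where up: "l = (u, p)" by (cases l)
  have u: "u \<bullet> u = 1" "u \<bullet> p = 0"
    using l by (auto simp: oriented_lines_def up norm_eq_1)
  obtain e2 where e2: "e2 \<bullet> e2 = 1" "u \<bullet> e2 = 0" "p = r *\<^sub>R e2"
  proof (cases "p = 0")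
    case True
    obtain e2 where "e2 \<bullet> e2 = 1" "u \<bullet> e2 = 0" by (rule unit_orthogonal_vector)
    then show ?thesis using that True by (simp add: r_def up)
  next
    case False
    have "sgn p \<bullet> sgn p = 1" unfolding norm_eq_1[symmetric] norm_sgn using False by simp
    then show ?thesis using that[of "sgn p"] False u(2) by (simp add: r_def up sgn_div_norm)
  qed
  have on: "orthonormal3 u e2 (cross3 u e2)" by (rule orthonormal3_cross[OF u(1) e2(1,2)])
  define k where "k t = (if r\<^sup>2 * (1 + t\<^sup>2) < 1 then 1 else 0 :: ennreal)" for t
  have [measurable]: "k \<in> borel_measurable borel" unfolding k_def by measurable
  have "AE n in lborel. u \<bullet> n \<noteq> 0"
    using u by (intro AE_not_orthogonal) auto
  then have "(\<integral>\<^sup>+ n. indicator (cball 0 1) n * disc_crossings n l \<partial>lborel) =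
      (\<integral>\<^sup>+ n. indicator (cball 0 1) n * k ((e2 \<bullet> n) / (u \<bullet> n)) \<partial>lborel)"
  proof (intro nn_integral_cong_AE, eventually_elim)
    fix n assume n: "u \<bullet> n \<noteq> 0"
    have "(norm p)\<^sup>2 + ((p \<bullet> n) / (u \<bullet> n))\<^sup>2 = r\<^sup>2 * (1 + ((e2 \<bullet> n) / (u \<bullet> n))\<^sup>2)"
    proof -
      have "norm p = r" by (simp add: r_def up)
      moreover have "p \<bullet> n = r * (e2 \<bullet> n)" by (subst e2(3)) simp
      ultimately show ?thesis by (simp add: power_mult_distrib power_divide distrib_left)
    qed
    then show "indicator (cball 0 1) n * disc_crossings n l = indicator (cball 0 1) n * k ((e2 \<bullet> n) / (u \<bullet> n))"
      using n by (simp add: disc_crossings_def up k_def)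
  qed
  also have "\<dots> = slope_mass * (\<integral>\<^sup>+ t. ennreal (1 / (1 + t\<^sup>2)) * k t \<partial>lborel)"
    by (rule slope_average[OF on]) measurable
  finally have "2 * (\<integral>\<^sup>+ n. indicator (cball 0 1) n * disc_crossings n l \<partial>lborel) =
      slope_mass * (2 * (\<integral>\<^sup>+ t. ennreal (1 / (1 + t\<^sup>2)) * k t \<partial>lborel))"
    by (simp only: mult_ac)
  also have "2 * (\<integral>\<^sup>+ t. ennreal (1 / (1 + t\<^sup>2)) * k t \<partial>lborel) = (\<integral>\<^sup>+ t. 2 * (ennreal (1 / (1 + t\<^sup>2)) * k t) \<partial>lborel)"
    by (rule nn_integral_cmult[symmetric]) measurable
  also have "\<dots> = (\<integral>\<^sup>+ t. ennreal (1 / (1 + t\<^sup>2)) * sphere_crossings (1 / sqrt (1 + t\<^sup>2)) l \<partial>lborel)"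
  proof (rule nn_integral_cong_AE)
    \<comment> \<open>Tangency, where the sphere is met once instead of twice, is possible only for
      \<open>t = s\<close> or \<open>t = - s\<close>.\<close>
    define s where "s = sqrt (1 / r\<^sup>2 - 1)"
    have "AE t in lborel. t \<noteq> s \<and> t \<noteq> - s"
      using AE_lborel_singleton[of s] AE_lborel_singleton[of "- s"] by eventually_elim simp
    then show "AE t in lborel. 2 * (ennreal (1 / (1 + t\<^sup>2)) * k t) = ennreal (1 / (1 + t\<^sup>2)) * sphere_crossings (1 / sqrt (1 + t\<^sup>2)) l"
    proof eventually_elim
      fix t assume t: "t \<noteq> s \<and> t \<noteq> - s"
      define d where "d = sqrt (1 + t\<^sup>2)"
      have d: "d > 0" "d\<^sup>2 = 1 + t\<^sup>2" by (simp_all add: d_def add_pos_nonneg)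
      have r0: "r \<ge> 0" by (simp add: r_def)
      have lt: "r < 1 / d \<longleftrightarrow> r\<^sup>2 * (1 + t\<^sup>2) < 1"
      proof -
        have "r < 1 / d \<longleftrightarrow> r * d < 1" using d(1) by (simp add: pos_less_divide_eq)
        also have "\<dots> \<longleftrightarrow> (r * d)\<^sup>2 < 1" using d(1) r0 by (simp add: abs_square_less_1)
        finally show ?thesis by (simp add: power_mult_distrib d(2))
      qed
      have "r \<noteq> 1 / d"
      proof
        assume "r = 1 / d"
        then have "1 / r\<^sup>2 - 1 = t\<^sup>2" using d by (simp add: power_divide)
        then have "s = \<bar>t\<bar>" by (simp add: s_def)
        with t show False by (auto simp: abs_if split: if_splits)
      qed
      then have "sphere_crossings (1 / sqrt (1 + t\<^sup>2)) l = 2 * k t"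
        unfolding sphere_crossings_def r_def[symmetric] d_def[symmetric] lt k_def by simp
      then show "2 * (ennreal (1 / (1 + t\<^sup>2)) * k t) = ennreal (1 / (1 + t\<^sup>2)) * sphere_crossings (1 / sqrt (1 + t\<^sup>2)) l"
        by (simp only: mult_ac)
    qed
  qed
  finally show ?thesis .
qed

section \<open>Averages against an arbitrary density\<close>

lemma disc_crossings_measurable [measurable]:
  "(\<lambda>(n, w). disc_crossings n (line_of w)) \<in> borel_measurable (borel \<Otimes>\<^sub>M borel)"
  unfolding disc_crossings_def by measurable

lemma sphere_crossings_measurable [measurable]:
  "(\<lambda>(t, w). sphere_crossings (1 / sqrt (1 + t\<^sup>2)) (line_of w)) \<in> borel_measurable (borel \<Otimes>\<^sub>M borel)"
  unfolding sphere_crossings_def by measurable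

lemma disc_crossings_line_measurable [measurable]: "disc_crossings n \<in> borel_measurable borel"
  unfolding disc_crossings_def[abs_def] by measurable

lemma sphere_crossings_line_measurable [measurable]: "sphere_crossings R \<in> borel_measurable borel"
  unfolding sphere_crossings_def[abs_def] by measurable

text \<open>The identity for single lines is integrated over all lines by Tonelli. Since
  \<open>G\<close> is an arbitrary nonnegative density, it applies to the positive and to the
  negative part of a signed one.\<close>

lemma crossing_integral_average:
  fixes G :: "(real^3) \<times> (real^3) \<Rightarrow> ennreal"
  assumes [measurable]: "G \<in> borel_measurable borel"
  defines "H \<equiv> \<lambda>n. \<integral>\<^sup>+ l \<in> oriented_lines. (G l * crossing_number l (disc n)) \<partial>line_measure"
    and "K \<equiv> \<lambda>t. \<integral>\<^sup>+ l \<in> oriented_lines. (G l * crossing_number l (sphere 0 (1 / sqrt (1 + t\<^sup>2)))) \<partial>line_measure"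
  shows "H \<in> borel_measurable borel" "K \<in> borel_measurable borel"
    and "2 * (\<integral>\<^sup>+ n. indicator (cball 0 1) n * H n \<partial>lborel) =
      slope_mass * (\<integral>\<^sup>+ t. ennreal (1 / (1 + t\<^sup>2)) * K t \<partial>lborel)"
proof -
  let ?d = "\<lambda>n w. disc_crossings n (line_of w)"
  let ?s = "\<lambda>t w. sphere_crossings (1 / sqrt (1 + t\<^sup>2)) (line_of w)"
  let ?B = "indicator (cball (0::real^3) 1) :: real^3 \<Rightarrow> ennreal"
  let ?c = "\<lambda>t::real. ennreal (1 / (1 + t\<^sup>2))"
  define g where "g w = line_weight w * (G (line_of w) * indicator oriented_lines (line_of w))" for w
  have g[measurable]: "g \<in> borel_measurable borel" unfolding g_def by measurable
  have H: "H = (\<lambda>n. \<integral>\<^sup>+ w. g w * ?d n w \<partial>lborel)"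
  proof
    fix n
    have "H n = (\<integral>\<^sup>+ l. G l * disc_crossings n l * indicator oriented_lines l \<partial>line_measure)"
      unfolding H_def by (intro nn_integral_cong) (simp add: indicator_def crossing_number_disc)
    also have "\<dots> = (\<integral>\<^sup>+ w. line_weight w * (G (line_of w) * ?d n w * indicator oriented_lines (line_of w)) \<partial>lborel)"
      by (rule nn_integral_line_measure_weight) measurable
    finally show "H n = (\<integral>\<^sup>+ w. g w * ?d n w \<partial>lborel)"
      by (simp add: g_def mult_ac)
  qed
  have K: "K = (\<lambda>t. \<integral>\<^sup>+ w. g w * ?s t w \<partial>lborel)"
  proof
    fix t
    have R: "1 / sqrt (1 + t\<^sup>2) > 0" by (simp add: add_pos_nonneg)
    have "K t = (\<integral>\<^sup>+ l. G l * sphere_crossings (1 / sqrt (1 + t\<^sup>2)) l * indicator oriented_lines l \<partial>line_measure)"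
      unfolding K_def by (intro nn_integral_cong) (simp add: indicator_def crossing_number_sphere[OF _ R])
    also have "\<dots> = (\<integral>\<^sup>+ w. line_weight w * (G (line_of w) * ?s t w * indicator oriented_lines (line_of w)) \<partial>lborel)"
      by (rule nn_integral_line_measure_weight) measurable
    finally show "K t = (\<integral>\<^sup>+ w. g w * ?s t w \<partial>lborel)"
      by (simp add: g_def mult_ac)
  qed
  show "H \<in> borel_measurable borel" unfolding H by measurable
  show "K \<in> borel_measurable borel" unfolding K by measurable
  have "2 * (\<integral>\<^sup>+ n. ?B n * H n \<partial>lborel) =
      2 * (\<integral>\<^sup>+ n. \<integral>\<^sup>+ w. ?B n * (g w * ?d n w) \<partial>lborel \<partial>lborel)"
    unfolding H by (simp add: nn_integral_cmult)
  also have "\<dots> = 2 * (\<integral>\<^sup>+ w. \<integral>\<^sup>+ n. ?B n * (g w * ?d n w) \<partial>lborel \<partial>lborel)"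
    by (intro arg_cong[where f = "(*) 2"] lborel_pair.Fubini'[symmetric]) measurable
  also have "\<dots> = (\<integral>\<^sup>+ w. 2 * (\<integral>\<^sup>+ n. ?B n * (g w * ?d n w) \<partial>lborel) \<partial>lborel)"
    by (rule nn_integral_cmult[symmetric]) measurable
  also have "\<dots> = (\<integral>\<^sup>+ w. slope_mass * (\<integral>\<^sup>+ t. ?c t * (g w * ?s t w) \<partial>lborel) \<partial>lborel)"
  proof (rule nn_integral_cong)
    fix w
    show "2 * (\<integral>\<^sup>+ n. ?B n * (g w * ?d n w) \<partial>lborel) =
        slope_mass * (\<integral>\<^sup>+ t. ?c t * (g w * ?s t w) \<partial>lborel)"
    proof (cases "line_of w \<in> oriented_lines")
      case True
      have "(\<integral>\<^sup>+ n. ?B n * (g w * ?d n w) \<partial>lborel) =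
          (\<integral>\<^sup>+ n. g w * (?B n * ?d n w) \<partial>lborel)"
        by (simp only: mult_ac)
      also have "\<dots> = g w * (\<integral>\<^sup>+ n. ?B n * ?d n w \<partial>lborel)"
        by (rule nn_integral_cmult) measurable
      finally have 1: "2 * (\<integral>\<^sup>+ n. ?B n * (g w * ?d n w) \<partial>lborel) =
          g w * (2 * (\<integral>\<^sup>+ n. ?B n * ?d n w \<partial>lborel))"
        by (simp only: mult_ac)
      have "(\<integral>\<^sup>+ t. ?c t * (g w * ?s t w) \<partial>lborel) =
          (\<integral>\<^sup>+ t. g w * (?c t * ?s t w) \<partial>lborel)"
        by (simp only: mult_ac)
      also have "\<dots> = g w * (\<integral>\<^sup>+ t. ?c t * ?s t w \<partial>lborel)"
        by (rule nn_integral_cmult) measurable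
      finally show ?thesis
        unfolding 1 crossing_average[OF True] by (simp only: mult_ac)
    qed (simp add: g_def)
  qed
  also have "\<dots> = slope_mass * (\<integral>\<^sup>+ w. \<integral>\<^sup>+ t. ?c t * (g w * ?s t w) \<partial>lborel \<partial>lborel)"
    by (rule nn_integral_cmult) measurable
  also have "(\<integral>\<^sup>+ w. \<integral>\<^sup>+ t. ?c t * (g w * ?s t w) \<partial>lborel \<partial>lborel) =
      (\<integral>\<^sup>+ t. \<integral>\<^sup>+ w. ?c t * (g w * ?s t w) \<partial>lborel \<partial>lborel)"
    by (rule lborel_pair.Fubini') measurable
  also have "\<dots> = (\<integral>\<^sup>+ t. ?c t * K t \<partial>lborel)"
    unfolding K by (simp add: nn_integral_cmult)
  finally show "2 * (\<integral>\<^sup>+ n. ?B n * H n \<partial>lborel) =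
      slope_mass * (\<integral>\<^sup>+ t. ?c t * K t \<partial>lborel)" .
qed

section \<open>Finiteness of the crossing integrals\<close>

lemma compact_lines_through_ball: "compact {l \<in> oriented_lines. norm (snd l) \<le> 1}"
proof -
  have "{l \<in> oriented_lines. norm (snd l) \<le> 1} = oriented_lines \<inter> {l. norm (snd l) \<le> 1}" by blast
  then have "closed {l \<in> oriented_lines. norm (snd l) \<le> 1}"
    using closed_oriented_lines by (auto intro!: closed_Int closed_Collect_le continuous_intros)
  moreover have "{l \<in> oriented_lines. norm (snd l) \<le> 1} \<subseteq> cball 0 1 \<times> cball 0 1"
    by (auto simp: oriented_lines_def)
  then have "bounded {l \<in> oriented_lines. norm (snd l) \<le> 1}"
    by (rule bounded_subset[rotated]) (simp add: bounded_Times)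
  ultimately show ?thesis by (simp add: compact_eq_bounded_closed)
qed

text \<open>A line that meets the unit ball has its closest point to the origin in the ball, and
  such lines form a compact set on which \<open>f\<close> is bounded. The Euclidean Crofton formula
  evaluates the integral of the remaining constant.\<close>

lemma crossing_integral_bound:
  assumes "continuous_on oriented_lines f"
  obtains M where "\<And>N I. N \<subseteq> cball 0 1 \<Longrightarrow> has_surface_integral (phi_area 0) N I \<Longrightarrow>
    crossing_integral_pos f N \<le> ennreal M * (crofton_const * I)"
proof -
  have "compact (f ` {l \<in> oriented_lines. norm (snd l) \<le> 1})"
    by (intro compact_continuous_image compact_lines_through_ball continuous_on_subset[OF assms]) auto
  then have "bounded (f ` {l \<in> oriented_lines. norm (snd l) \<le> 1})" by (rule compact_imp_bounded)
  then obtain M where "\<forall>y \<in> f ` {l \<in> oriented_lines. norm (snd l) \<le> 1}. norm y \<le> M"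
    unfolding bounded_iff by blast
  then have M: "\<bar>f l\<bar> \<le> M" if "l \<in> oriented_lines" "norm (snd l) \<le> 1" for l
    using that by (metis (mono_tags, lifting) image_eqI mem_Collect_eq real_norm_def)
  show thesis
  proof (rule that)
    fix N I
    assume N: "N \<subseteq> cball 0 1" and I: "has_surface_integral (phi_area 0) N I"
    have "crossing_integral_pos f N \<le> (\<integral>\<^sup>+ l. ennreal M * (crossing_number l N * indicator oriented_lines l) \<partial>line_measure)"
      unfolding crossing_integral_pos_def
    proof (rule nn_integral_mono)
      fix l
      show "ennreal (f l) * crossing_number l N * indicator oriented_lines l \<le> ennreal M * (crossing_number l N * indicator oriented_lines l)"
      proof (cases "l \<in> oriented_lines \<and> crossing_number l N \<noteq> 0")
        case True
        then have "line_points l \<inter> N \<noteq> {}" by (auto simp: crossing_number_def)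
        then obtain t where "snd l + t *\<^sub>R fst l \<in> N" by (auto simp: line_points_def)
        then have "norm (snd l + t *\<^sub>R fst l) \<le> 1" using subsetD[OF N] by fastforce
        then have "(norm (snd l + t *\<^sub>R fst l))\<^sup>2 \<le> 1" by (simp add: abs_square_le_1)
        then have "(norm (snd l))\<^sup>2 \<le> 1"
          using oriented_line_norm[of l t] True zero_le_power2[of t] by linarith
        then have "norm (snd l) \<le> 1" by (simp add: abs_square_le_1)
        then have "f l \<le> M" using M[of l] True by auto
        then show ?thesis by (simp add: mult.assoc mult_right_mono ennreal_leI)
      qed auto
    qed
    also have "\<dots> = ennreal M * (crofton_const * I)"
      by (rule crossing_integral_euclidean_cmult[OF I])
    finally show "crossing_integral_pos f N \<le> ennreal M * (crofton_const * I)" .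
  qed
qed

text \<open>This puts the signed formula into an additive form in \<open>ennreal\<close>, which can
  be averaged by nonnegative integrals.\<close>

lemma enn2ereal_diff_eqD:
  assumes "enn2ereal I = enn2ereal P - enn2ereal Q" "P < \<infinity>" "Q < \<infinity>"
  shows "P = I + Q"
proof -
  obtain p q where p: "P = ennreal p" "p \<ge> 0" and q: "Q = ennreal q" "q \<ge> 0"
    using assms(2,3) by (cases P; cases Q) auto
  have "enn2ereal I = ereal (p - q)" using assms(1) by (simp add: p q enn2ereal_ennreal)
  then obtain i where i: "I = ennreal i" "i \<ge> 0" "i = p - q"
    by (cases I) (auto simp: enn2ereal_ennreal)
  then have "p = i + q" by simp
  then show ?thesis unfolding p(1) q(1) i(1) by (simp add: ennreal_plus i(2) q(2))
qed

section \<open>The averaged sphere integral compared with the disc integral\<close>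

lemma sphere_average:
  "(\<integral>\<^sup>+ t. ennreal (1 / (1 + t\<^sup>2)) * ennreal (4 * pi * (1 / sqrt (1 + t\<^sup>2))\<^sup>2 * (1 + a\<^sup>2 * (1 / sqrt (1 + t\<^sup>2))\<^sup>2)\<^sup>2) \<partial>lborel) =
    ennreal (2 * pi * (pi * (1 + 3 / 2 * a\<^sup>2 + 5 / 8 * a ^ 4)))"
proof -
  let ?G = "\<lambda>t. ennreal (1 / (1 + t\<^sup>2)) * ennreal (4 * pi * (1 / sqrt (1 + t\<^sup>2))\<^sup>2 * (1 + a\<^sup>2 * (1 / sqrt (1 + t\<^sup>2))\<^sup>2)\<^sup>2)"
  \<comment> \<open>With \<open>v = 1 / (1 + t^2)\<close> the integrand is
    \<open>4 pi (v^2 + 2 a^2 v^3 + a^4 v^4)\<close>. The reduction formula turns the antiderivative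
    of \<open>v^2\<close> into \<open>(t v + arctan t) / 2\<close>, that of \<open>v^3\<close> into
    \<open>t v^2 / 4\<close> plus 3/4 of the former, and that of \<open>v^4\<close> into
    \<open>t v^3 / 6\<close> plus 5/6 of that for \<open>v^3\<close>. At infinity only the
    arctangents survive; \<open>?T A\<close> is the limit when they tend to
    \<open>A\<close>.\<close>
  let ?T = "\<lambda>A. 4 * pi * (A / 2 + 2 * a\<^sup>2 * (3 / 8 * A) + a ^ 4 * (5 / 6 * (3 / 8 * A)))"
  let ?F = "\<lambda>t. 4 * pi * ((t * inverse (1 + t\<^sup>2) + arctan t) / 2 +
      2 * a\<^sup>2 * (t * (inverse (1 + t\<^sup>2))\<^sup>2 / 4 + 3 / 8 * (t * inverse (1 + t\<^sup>2) + arctan t)) +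
      a ^ 4 * (t * (inverse (1 + t\<^sup>2)) ^ 3 / 6 + 5 / 6 * (t * (inverse (1 + t\<^sup>2))\<^sup>2 / 4 + 3 / 8 * (t * inverse (1 + t\<^sup>2) + arctan t))))"
  let ?f = "\<lambda>t. 4 * pi * ((inverse (1 + t\<^sup>2))\<^sup>2 * (1 + a\<^sup>2 * inverse (1 + t\<^sup>2))\<^sup>2)"
  have pos: "1 + t\<^sup>2 > 0" for t :: real by (simp add: add_pos_nonneg)
  have "(\<integral>\<^sup>+ t. ?G t \<partial>lborel) =
      (\<integral>\<^sup>+ t. ennreal (?f t) \<partial>lborel)"
  proof (rule nn_integral_cong)
    fix t :: real
    have "(1 / sqrt (1 + t\<^sup>2))\<^sup>2 = inverse (1 + t\<^sup>2)"
      using pos[of t] by (simp add: power_divide inverse_eq_divide less_imp_le)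
    then show "?G t = ennreal (?f t)"
      using pos[of t] by (simp add: ennreal_mult[symmetric] inverse_eq_divide[symmetric] power2_eq_square[of "inverse _"] mult_ac)
  qed
  also have "\<dots> = ennreal (?T (pi / 2) -
      ?T (- (pi / 2)))"
  proof (rule nn_integral_FTC_UNIV[where F = ?F])
    fix t :: real
    define v where "v = inverse (1 + t\<^sup>2)"
    have v: "v * (1 + t\<^sup>2) = 1" using pos[of t] by (simp add: v_def)
    have dv: "((\<lambda>t. inverse (1 + t\<^sup>2)) has_real_derivative - (v * (2 * t) * v)) (at t)"
      using pos[of t] by (auto intro!: derivative_eq_intros simp: v_def)
    have da: "(arctan has_real_derivative v) (at t)" unfolding v_def by (rule DERIV_arctan)
    have d1: "((\<lambda>t. t * inverse (1 + t\<^sup>2)) has_real_derivative v - 2 * t\<^sup>2 * v\<^sup>2) (at t)"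
      by (rule DERIV_cong[OF DERIV_mult[OF DERIV_ident dv]])
         (simp only: v_def[symmetric], simp add: power2_eq_square)
    have d2: "((\<lambda>t. t * (inverse (1 + t\<^sup>2))\<^sup>2) has_real_derivative v\<^sup>2 - 4 * t\<^sup>2 * v ^ 3) (at t)"
      by (rule DERIV_cong[OF DERIV_mult[OF DERIV_ident DERIV_power[OF dv]]])
         (simp only: v_def[symmetric], simp add: power2_eq_square power3_eq_cube)
    have d3: "((\<lambda>t. t * (inverse (1 + t\<^sup>2)) ^ 3) has_real_derivative v ^ 3 - 6 * t\<^sup>2 * v ^ 4) (at t)"
      by (rule DERIV_cong[OF DERIV_mult[OF DERIV_ident DERIV_power[OF dv]]])
         (simp only: v_def[symmetric], simp add: power2_eq_square power3_eq_cube power4_eq_xxxx)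
    have "(?F has_real_derivative 4 * pi * ((v - 2 * t\<^sup>2 * v\<^sup>2 + v) / 2 +
      2 * a\<^sup>2 * ((v\<^sup>2 - 4 * t\<^sup>2 * v ^ 3) / 4 + 3 / 8 * (v - 2 * t\<^sup>2 * v\<^sup>2 + v)) +
      a ^ 4 * ((v ^ 3 - 6 * t\<^sup>2 * v ^ 4) / 6 + 5 / 6 * ((v\<^sup>2 - 4 * t\<^sup>2 * v ^ 3) / 4 + 3 / 8 * (v - 2 * t\<^sup>2 * v\<^sup>2 + v))))) (at t)"
      by (intro DERIV_add DERIV_cmult DERIV_cdivide d1 d2 d3 da)
    also have "4 * pi * ((v - 2 * t\<^sup>2 * v\<^sup>2 + v) / 2 +
      2 * a\<^sup>2 * ((v\<^sup>2 - 4 * t\<^sup>2 * v ^ 3) / 4 + 3 / 8 * (v - 2 * t\<^sup>2 * v\<^sup>2 + v)) +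
      a ^ 4 * ((v ^ 3 - 6 * t\<^sup>2 * v ^ 4) / 6 + 5 / 6 * ((v\<^sup>2 - 4 * t\<^sup>2 * v ^ 3) / 4 + 3 / 8 * (v - 2 * t\<^sup>2 * v\<^sup>2 + v)))) =
      4 * pi * (v\<^sup>2 * (1 + a\<^sup>2 * v)\<^sup>2)"
    proof -
      have tv: "t\<^sup>2 * v = 1 - v" using v by (simp add: algebra_simps)
      have e: "v - 2 * t\<^sup>2 * v\<^sup>2 + v = 2 * v\<^sup>2" "v\<^sup>2 - 4 * t\<^sup>2 * v ^ 3 = 4 * v ^ 3 - 3 * v\<^sup>2" "v ^ 3 - 6 * t\<^sup>2 * v ^ 4 = 6 * v ^ 4 - 5 * v ^ 3"
        using tv by algebra+
      show ?thesis unfolding e by (simp add: field_simps power2_eq_square power3_eq_cube power4_eq_xxxx)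
    qed
    finally show "(?F has_real_derivative ?f t) (at t)" unfolding v_def .
  next
    show "0 \<le> ?f t" for t by simp
    have r: "((\<lambda>t. t * inverse (1 + t\<^sup>2)) \<longlongrightarrow> (0::real)) at_top" "((\<lambda>t. t * (inverse (1 + t\<^sup>2))\<^sup>2) \<longlongrightarrow> (0::real)) at_top"
      "((\<lambda>t. t * (inverse (1 + t\<^sup>2)) ^ 3) \<longlongrightarrow> (0::real)) at_top"
      by real_asymp+
    have "(?F \<longlongrightarrow> 4 * pi * ((0 + pi / 2) / 2 + 2 * a\<^sup>2 * (0 / 4 + 3 / 8 * (0 + pi / 2)) +
        a ^ 4 * (0 / 6 + 5 / 6 * (0 / 4 + 3 / 8 * (0 + pi / 2))))) at_top"
      by (intro tendsto_add tendsto_mult tendsto_divide tendsto_const r tendsto_arctan_at_top) simp_all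
    then show "(?F \<longlongrightarrow> ?T (pi / 2)) at_top"
      by simp
    have r: "((\<lambda>t. t * inverse (1 + t\<^sup>2)) \<longlongrightarrow> (0::real)) at_bot" "((\<lambda>t. t * (inverse (1 + t\<^sup>2))\<^sup>2) \<longlongrightarrow> (0::real)) at_bot"
      "((\<lambda>t. t * (inverse (1 + t\<^sup>2)) ^ 3) \<longlongrightarrow> (0::real)) at_bot"
      by real_asymp+
    have "(?F \<longlongrightarrow> 4 * pi * ((0 + - (pi / 2)) / 2 + 2 * a\<^sup>2 * (0 / 4 + 3 / 8 * (0 + - (pi / 2))) +
        a ^ 4 * (0 / 6 + 5 / 6 * (0 / 4 + 3 / 8 * (0 + - (pi / 2)))))) at_bot"
      by (intro tendsto_add tendsto_mult tendsto_divide tendsto_const r tendsto_arctan_at_bot) simp_all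
    then show "(?F \<longlongrightarrow> ?T (- (pi / 2))) at_bot"
      by simp
  qed measurable
  also have "?T (pi / 2) -
      ?T (- (pi / 2)) =
      2 * pi * (pi * (1 + 3 / 2 * a\<^sup>2 + 5 / 8 * a ^ 4))"
    by (simp add: field_simps)
  finally show ?thesis .
qed

text \<open>The integrand on the disc that the Crofton formula for concentric spheres would force.\<close>

definition disc_polynomial :: "real \<Rightarrow> real \<Rightarrow> real" where
  "disc_polynomial a \<rho> = 1 + 3 * a\<^sup>2 * \<rho>\<^sup>2 + 15 / 8 * a ^ 4 * \<rho> ^ 4"

text \<open>The coefficients of \<open>disc_polynomial\<close> are those that make this value, in
  each power of \<open>a\<close>, the one of \<open>sphere_average\<close> divided by
  \<open>2 * pi\<close>.\<close>

lemma disc_polynomial_integral: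
  "(\<integral>\<^sup>+ w \<in> ball (0 :: real \<times> real) 1. ennreal (disc_polynomial a (norm w)) \<partial>lborel) =
    ennreal (pi * (1 + 3 / 2 * a\<^sup>2 + 5 / 8 * a ^ 4))"
proof -
  have nonneg: "disc_polynomial a \<rho> \<ge> 0" for \<rho> by (simp add: disc_polynomial_def)
  have [measurable]: "disc_polynomial a \<in> borel_measurable borel"
    unfolding disc_polynomial_def[abs_def] by measurable
  have "(\<integral>\<^sup>+ w \<in> ball (0 :: real \<times> real) 1. ennreal (disc_polynomial a (norm w)) \<partial>lborel) =
      (\<integral>\<^sup>+ w. ennreal (disc_polynomial a (norm w)) * indicator {..<1} (norm w) \<partial>(lborel :: (real \<times> real) measure))"
    by (intro nn_integral_cong) (simp add: indicator_def)
  also have "\<dots> = ennreal (2 * pi) * (\<integral>\<^sup>+ x \<in> {0..}. (ennreal x * (ennreal (disc_polynomial a x) * indicator {..<1} x)) \<partial>lborel)"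
    by (rule nn_integral_radial) measurable
  also have "(\<integral>\<^sup>+ x \<in> {0..}. (ennreal x * (ennreal (disc_polynomial a x) * indicator {..<1} x)) \<partial>lborel) =
      (\<integral>\<^sup>+ x. ennreal (x * disc_polynomial a x) * indicator {0..1} x \<partial>lborel)"
    by (intro nn_integral_cong_AE, rule_tac eventually_mono[OF AE_lborel_singleton[of 1]])
       (auto simp: indicator_def ennreal_mult nonneg)
  also have "\<dots> = ennreal ((1\<^sup>2 / 2 + 3 / 4 * a\<^sup>2 * 1 ^ 4 + 15 / 48 * a ^ 4 * 1 ^ 6) - (0\<^sup>2 / 2 + 3 / 4 * a\<^sup>2 * 0 ^ 4 + 15 / 48 * a ^ 4 * 0 ^ 6))"
  proof (rule nn_integral_FTC_Icc[where F = "\<lambda>x. x\<^sup>2 / 2 + 3 / 4 * a\<^sup>2 * x ^ 4 + 15 / 48 * a ^ 4 * x ^ 6"])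
    fix x :: real
    have "((\<lambda>x. x\<^sup>2 / 2 + 3 / 4 * a\<^sup>2 * x ^ 4 + 15 / 48 * a ^ 4 * x ^ 6) has_real_derivative
        (2 * x) / 2 + 3 / 4 * a\<^sup>2 * (4 * x ^ 3) + 15 / 48 * a ^ 4 * (6 * x ^ 5)) (at x)"
      by (auto intro!: derivative_eq_intros)
    also have "(2 * x) / 2 + 3 / 4 * a\<^sup>2 * (4 * x ^ 3) + 15 / 48 * a ^ 4 * (6 * x ^ 5) = x * disc_polynomial a x"
      by (simp add: disc_polynomial_def eval_nat_numeral algebra_simps)
    finally show "DERIV (\<lambda>x. x\<^sup>2 / 2 + 3 / 4 * a\<^sup>2 * x ^ 4 + 15 / 48 * a ^ 4 * x ^ 6) x :> x * disc_polynomial a x" .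
  qed (auto simp: nonneg)
  also have "(1\<^sup>2 / 2 + 3 / 4 * a\<^sup>2 * 1 ^ 4 + 15 / 48 * a ^ 4 * 1 ^ 6) - (0\<^sup>2 / 2 + 3 / 4 * a\<^sup>2 * 0 ^ 4 + 15 / 48 * a ^ 4 * 0 ^ 6) =
      (1 + 3 / 2 * a\<^sup>2 + 5 / 8 * a ^ 4) / 2"
    by (simp add: field_simps)
  also have "ennreal (2 * pi) * ennreal ((1 + 3 / 2 * a\<^sup>2 + 5 / 8 * a ^ 4) / 2) =
      ennreal (2 * pi * ((1 + 3 / 2 * a\<^sup>2 + 5 / 8 * a ^ 4) / 2))"
    by (rule ennreal_mult[symmetric]) simp_all
  also have "2 * pi * ((1 + 3 / 2 * a\<^sup>2 + 5 / 8 * a ^ 4) / 2) = pi * (1 + 3 / 2 * a\<^sup>2 + 5 / 8 * a ^ 4)"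
    by simp
  finally show ?thesis .
qed

lemma disc_polynomial_less:
  assumes "a \<noteq> 0" "\<rho> \<noteq> 0"
  shows "disc_polynomial a \<rho> < disc_integrand a \<rho>"
proof -
  define s where "s = a\<^sup>2 * \<rho>\<^sup>2"
  have s: "s > 0" using assms by (simp add: s_def)
  let ?A = "1 + s" and ?C = "1 + 2 * s"
  have P: "disc_polynomial a \<rho> = 1 + 3 * s + 15 / 8 * s\<^sup>2"
    by (simp add: disc_polynomial_def s_def power_mult_distrib power_mult[symmetric])
  have I: "disc_integrand a \<rho> = 2 * (?A * ?C) * sqrt (?A * ?C) / (2 + 3 * s)"
    unfolding disc_integrand_def Let_def mult.assoc s_def[symmetric] by (simp add: mult.assoc)
  have "(2 * (?A * ?C) * sqrt (?A * ?C))\<^sup>2 = 4 * (?A * ?C)\<^sup>2 * (?A * ?C)"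
  proof -
    have "(sqrt (?A * ?C))\<^sup>2 = ?A * ?C" using s by (intro real_sqrt_pow2) simp
    then show ?thesis unfolding power_mult_distrib[of "2 * (?A * ?C)"] by (simp add: power_mult_distrib)
  qed
  \<comment> \<open>Clearing the denominator and squaring removes the root. All terms up to
    \<open>s^3\<close> cancel, and the remaining coefficients are positive.\<close>
  then have "(2 * (?A * ?C) * sqrt (?A * ?C))\<^sup>2 - ((1 + 3 * s + 15 / 8 * s\<^sup>2) * (2 + 3 * s))\<^sup>2 =
      s ^ 4 * (3 / 16 + 9 / 16 * s + 23 / 64 * s\<^sup>2)"
    by (simp only:) (simp add: field_simps power2_eq_square power4_eq_xxxx)
  also have "\<dots> > 0" using s by (intro mult_pos_pos) (auto intro: add_pos_pos)
  finally have "((1 + 3 * s + 15 / 8 * s\<^sup>2) * (2 + 3 * s))\<^sup>2 < (2 * (?A * ?C) * sqrt (?A * ?C))\<^sup>2" by simp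
  then have "(1 + 3 * s + 15 / 8 * s\<^sup>2) * (2 + 3 * s) < 2 * (?A * ?C) * sqrt (?A * ?C)"
    by (rule power2_less_imp_less) (use s in simp)
  then show ?thesis
    unfolding P I using s by (simp add: pos_less_divide_eq)
qed

lemma disc_integral_not_polynomial_integral:
  assumes "a \<noteq> 0"
  shows "(\<integral>\<^sup>+ w \<in> ball (0 :: real \<times> real) 1. ennreal (disc_integrand a (norm w)) \<partial>lborel) \<noteq>
    (\<integral>\<^sup>+ w \<in> ball (0 :: real \<times> real) 1. ennreal (disc_polynomial a (norm w)) \<partial>lborel)" (is "?D \<noteq> ?P")
proof
  assume eq: "?D = ?P"
  have [measurable]: "disc_polynomial a \<in> borel_measurable borel" "disc_integrand a \<in> borel_measurable borel"
    unfolding disc_polynomial_def[abs_def] disc_integrand_def[abs_def] Let_def by measurable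
  have [measurable]: "ball (0 :: real \<times> real) 1 \<in> sets borel" by simp
  let ?f = "\<lambda>w :: real \<times> real. ennreal (disc_integrand a (norm w)) * indicator (ball 0 1) w"
  let ?g = "\<lambda>w :: real \<times> real. ennreal (disc_polynomial a (norm w)) * indicator (ball 0 1) w"
  have less: "?g w < ?f w" if "w \<noteq> 0" "w \<in> ball 0 1" for w
  proof -
    have "disc_polynomial a (norm w) \<ge> 0" by (simp add: disc_polynomial_def)
    then show ?thesis
      using that disc_polynomial_less[OF assms, of "norm w"] by (simp add: ennreal_less_iff)
  qed
  have "\<not> (AE w in lborel. ?f w \<le> ?g w)"
  proof
    assume "AE w in lborel. ?f w \<le> ?g w"
    then have "AE w in lborel. w \<notin> ball (0 :: real \<times> real) 1"
      using AE_lborel_singleton[of "0 :: real \<times> real"] by eventually_elim (use less in \<open>fastforce simp: not_le[symmetric]\<close>)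
    then have "emeasure lborel (ball (0 :: real \<times> real) 1) = 0"
      by (subst (asm) AE_iff_measurable[of "ball 0 1"]) auto
    then show False by (simp add: emeasure_ball unit_ball_vol_2)
  qed
  then have "?P < ?D"
  proof (intro nn_integral_less)
    show "?P \<noteq> \<infinity>" unfolding disc_polynomial_integral by simp
    show "AE w in lborel. ?g w \<le> ?f w"
      using AE_lborel_singleton[of "0 :: real \<times> real"]
      by eventually_elim (use less in \<open>auto simp: indicator_def less_imp_le\<close>)
  qed measurable
  with eq show False by simp
qed

section \<open>The contradiction for \<open>a \<noteq> 0\<close>\<close>

lemma not_admits_crofton:
  assumes a: "a \<noteq> 0"
  shows "\<not> admits_crofton_formula (phi_area a)"
proof
  assume "admits_crofton_formula (phi_area a)"
  then obtain f where f: "smooth_line_density f" and crofton: "\<And>N I. embedded_surface N \<Longrightarrow>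
      has_surface_integral (phi_area a) N I \<Longrightarrow>
      crossing_integral_pos f N < \<infinity> \<Longrightarrow>
      enn2ereal I = enn2ereal (crossing_integral_pos f N) - enn2ereal (crossing_integral_pos (\<lambda>l. - f l) N)"
    unfolding admits_crofton_formula_def by blast
  obtain W where W: "open W" "oriented_lines \<subseteq> W" "smooth_on W f"
    using f unfolding smooth_line_density_def by blast
  have "Ck_on 0 W f" using W(3) unfolding smooth_on_def by blast
  then have cf: "continuous_on oriented_lines f"
    using continuous_on_subset[OF _ W(2)] by simp
  then have cnf: "continuous_on oriented_lines (\<lambda>l. - f l)" by (intro continuous_intros)
  obtain M1 where M1: "\<And>N I. N \<subseteq> cball 0 1 \<Longrightarrow> has_surface_integral (phi_area 0) N I \<Longrightarrow>
    crossing_integral_pos f N \<le> ennreal M1 * (crofton_const * I)"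
    using crossing_integral_bound[OF cf] by blast
  obtain M2 where M2: "\<And>N I. N \<subseteq> cball 0 1 \<Longrightarrow> has_surface_integral (phi_area 0) N I \<Longrightarrow>
    crossing_integral_pos (\<lambda>l. - f l) N \<le> ennreal M2 * (crofton_const * I)"
    using crossing_integral_bound[OF cnf] by blast
  \<comment> \<open>The auxiliary value \<open>I0\<close> is the Euclidean area of \<open>N\<close>.
    Its finiteness bounds both parts of the signed integral, after which the formula can be written
    without subtraction.\<close>
  have split: "crossing_integral_pos f N = I + crossing_integral_pos (\<lambda>l. - f l) N"
    if "has_surface_integral (phi_area a) N I" "N \<subseteq> cball 0 1"
      "has_surface_integral (phi_area 0) N I0" "I0 < \<infinity>" for N I I0
  proof -
    have "crofton_const * I0 < \<infinity>" using crofton_const_finite_pos(1) that(4) by (simp add: ennreal_mult_less_top)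
    then have "ennreal M * (crofton_const * I0) < \<infinity>" for M by (simp add: ennreal_mult_less_top)
    then have fin: "crossing_integral_pos f N < \<infinity>" "crossing_integral_pos (\<lambda>l. - f l) N < \<infinity>"
      using le_less_trans[OF M1[OF that(2,3)]] le_less_trans[OF M2[OF that(2,3)]] by blast+
    have "embedded_surface N"
      using that(1) unfolding has_surface_integral_def embedded_surface_iff_atlas by blast
    from enn2ereal_diff_eqD[OF crofton[OF this that(1) fin(1)] fin] show ?thesis .
  qed
  \<comment> \<open>Both \<open>D a\<close>, the integral over every disc, and \<open>D 0\<close>,
    its Euclidean area, will be used; the latter controls finiteness.\<close>
  define D where "D b = (\<integral>\<^sup>+ w \<in> ball (0 :: real \<times> real) 1. ennreal (disc_integrand b (norm w)) \<partial>lborel)" for b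
  have D0: "D 0 < \<infinity>"
  proof -
    have "D 0 = (\<integral>\<^sup>+ w \<in> ball (0 :: real \<times> real) 1. ennreal (disc_polynomial 0 (norm w)) \<partial>lborel)"
      by (simp add: D_def disc_integrand_def disc_polynomial_def)
    then show ?thesis unfolding disc_polynomial_integral by simp
  qed
  define R where "R t = 1 / sqrt (1 + t\<^sup>2)" for t :: real
  have R: "R t > 0" "R t \<le> 1" for t by (simp_all add: R_def add_pos_nonneg)
  define S where "S t = ennreal (4 * pi * (R t)\<^sup>2 * (1 + a\<^sup>2 * (R t)\<^sup>2)\<^sup>2)" for t
  have [measurable]: "S \<in> borel_measurable borel" unfolding S_def R_def by measurable
  define Hp where "Hp n = crossing_integral_pos f (disc n)" for n
  define Hn where "Hn n = crossing_integral_pos (\<lambda>l. - f l) (disc n)" for n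
  define Kp where "Kp t = crossing_integral_pos f (sphere 0 (R t))" for t
  define Kn where "Kn t = crossing_integral_pos (\<lambda>l. - f l) (sphere 0 (R t))" for t
  have disc_sub: "disc n \<subseteq> cball 0 1" for n by (auto simp: disc_def)
  have HD: "Hp n = D a + Hn n" "Hn n \<le> ennreal M2 * (crofton_const * D 0)" if "n \<noteq> 0" for n
    using split[OF disc_has_surface_integral[OF that, folded D_def] disc_sub disc_has_surface_integral[OF that, folded D_def] D0]
      M2[OF disc_sub disc_has_surface_integral[OF that, folded D_def]]
    by (simp_all add: Hp_def Hn_def)
  have KS: "Kp t = S t + Kn t" for t
  proof -
    have "sphere 0 (R t) \<subseteq> (cball 0 1 :: (real^3) set)" using R[of t] by auto
    then show ?thesis
      unfolding Kp_def Kn_def S_def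
      by (rule split[OF sphere_has_surface_integral[OF R(1)] _ sphere_has_surface_integral[OF R(1)]]) simp
  qed
  have G: "(\<lambda>l. ennreal (g l) * indicator oriented_lines l) \<in> borel_measurable borel"
    if "continuous_on oriented_lines g" for g
  proof -
    have "(\<lambda>l. indicator oriented_lines l *\<^sub>R g l) \<in> borel_measurable borel"
      by (rule borel_measurable_continuous_on_indicator[OF sets_oriented_lines that])
    then have "(\<lambda>l. ennreal (indicator oriented_lines l *\<^sub>R g l)) \<in> borel_measurable borel" by measurable
    also have "(\<lambda>l. ennreal (indicator oriented_lines l *\<^sub>R g l)) = (\<lambda>l. ennreal (g l) * indicator oriented_lines l)"
      by (auto simp: indicator_def)
    finally show ?thesis .
  qed
  have pos: "crossing_integral_pos g N = (\<integral>\<^sup>+ l \<in> oriented_lines. (ennreal (g l) * indicator oriented_lines l * crossing_number l N) \<partial>line_measure)" for g N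
    unfolding crossing_integral_pos_def by (intro nn_integral_cong) (simp add: indicator_def)
  note avp = crossing_integral_average[OF G[OF cf], folded pos R_def Hp_def Kp_def]
  note avn = crossing_integral_average[OF G[OF cnf], folded pos R_def Hn_def Kn_def]
  note [measurable] = avp(1,2) avn(1,2)
  let ?B = "indicator (cball (0::real^3) 1) :: real^3 \<Rightarrow> ennreal"
  let ?c = "\<lambda>t::real. ennreal (1 / (1 + t\<^sup>2))"
  have vol: "(\<integral>\<^sup>+ n. ?B n \<partial>lborel) = slope_mass * ennreal pi"
    using slope_mass(1) by simp
  have "2 * (\<integral>\<^sup>+ n. ?B n * Hp n \<partial>lborel) = 2 * (\<integral>\<^sup>+ n. ?B n * D a + ?B n * Hn n \<partial>lborel)"
    \<comment> \<open>The normal \<open>n = 0\<close> does not define a disc and is removed as a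
      null set.\<close>
    by (intro arg_cong[where f = "(*) 2"] nn_integral_cong_AE, rule_tac eventually_mono[OF AE_lborel_singleton[of 0]])
       (simp add: HD(1) distrib_left)
  also have "(\<integral>\<^sup>+ n. ?B n * D a + ?B n * Hn n \<partial>lborel) = (\<integral>\<^sup>+ n. ?B n * D a \<partial>lborel) + (\<integral>\<^sup>+ n. ?B n * Hn n \<partial>lborel)"
    by (rule nn_integral_add) measurable
  also have "(\<integral>\<^sup>+ n. ?B n * D a \<partial>lborel) = slope_mass * ennreal pi * D a"
    unfolding vol[symmetric] by (rule nn_integral_multc) measurable
  finally have 1: "2 * (\<integral>\<^sup>+ n. ?B n * Hp n \<partial>lborel) = slope_mass * (ennreal (2 * pi) * D a) + 2 * (\<integral>\<^sup>+ n. ?B n * Hn n \<partial>lborel)"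
    by (simp add: distrib_left ennreal_mult mult_ac)
  have "(\<integral>\<^sup>+ t. ?c t * Kp t \<partial>lborel) = (\<integral>\<^sup>+ t. ?c t * S t + ?c t * Kn t \<partial>lborel)"
    by (simp add: KS distrib_left)
  also have "\<dots> = (\<integral>\<^sup>+ t. ?c t * S t \<partial>lborel) + (\<integral>\<^sup>+ t. ?c t * Kn t \<partial>lborel)"
    by (rule nn_integral_add) measurable
  finally have 2: "slope_mass * (\<integral>\<^sup>+ t. ?c t * Kp t \<partial>lborel) =
      slope_mass * (\<integral>\<^sup>+ t. ?c t * S t \<partial>lborel) + slope_mass * (\<integral>\<^sup>+ t. ?c t * Kn t \<partial>lborel)"
    by (simp only: distrib_left)
  \<comment> \<open>The negative part is bounded uniformly in \<open>n\<close>, so its average over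
    the ball is finite and may be cancelled.\<close>
  have fin: "2 * (\<integral>\<^sup>+ n. ?B n * Hn n \<partial>lborel) \<noteq> \<infinity>"
  proof -
    have "(\<integral>\<^sup>+ n. ?B n * Hn n \<partial>lborel) \<le> (\<integral>\<^sup>+ n. ?B n * (ennreal M2 * (crofton_const * D 0)) \<partial>lborel)"
      by (intro nn_integral_mono_AE, rule_tac eventually_mono[OF AE_lborel_singleton[of 0]])
         (intro mult_left_mono HD(2), auto)
    also have "\<dots> = slope_mass * ennreal pi * (ennreal M2 * (crofton_const * D 0))"
      unfolding vol[symmetric] by (rule nn_integral_multc) measurable
    also have "\<dots> < \<infinity>"
      using slope_mass(3) crofton_const_finite_pos(1) D0 by (auto simp: ennreal_mult_eq_top_iff less_top[symmetric])
    finally show ?thesis by (simp add: ennreal_mult_eq_top_iff less_top)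
  qed
  \<comment> \<open>The positive parts have equal averages by \<open>avp(3)\<close>, the negative
    ones by \<open>avn(3)\<close>. Cancelling the latter leaves an identity between the integrals
    over discs and spheres from which the density has disappeared.\<close>
  have "2 * (\<integral>\<^sup>+ n. ?B n * Hn n \<partial>lborel) + slope_mass * (ennreal (2 * pi) * D a) =
      2 * (\<integral>\<^sup>+ n. ?B n * Hn n \<partial>lborel) + slope_mass * (\<integral>\<^sup>+ t. ?c t * S t \<partial>lborel)"
    using avp(3) 1 2 avn(3) by (simp add: add.commute)
  then have "slope_mass * (ennreal (2 * pi) * D a) = slope_mass * (\<integral>\<^sup>+ t. ?c t * S t \<partial>lborel)"
    using fin unfolding ennreal_add_left_cancel by blast
  then have "ennreal (2 * pi) * D a = (\<integral>\<^sup>+ t. ?c t * S t \<partial>lborel)"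
    using slope_mass(2,3) by (simp add: ennreal_mult_cancel_left)
  also have "\<dots> = ennreal (2 * pi) * ennreal (pi * (1 + 3 / 2 * a\<^sup>2 + 5 / 8 * a ^ 4))"
    unfolding S_def R_def sphere_average by (simp add: ennreal_mult[symmetric])
  finally have "D a = ennreal (pi * (1 + 3 / 2 * a\<^sup>2 + 5 / 8 * a ^ 4))"
    by (simp add: ennreal_mult_cancel_left)
  then show False
    using disc_integral_not_polynomial_integral[OF a] unfolding D_def disc_polynomial_integral by simp
qed

theorem corollary5p7:
  fixes a :: real
  shows "admits_crofton_formula (hausdorff_area_integrand (phi_metric a)) \<longleftrightarrow> a = 0"
  using not_admits_crofton euclidean_admits_crofton by blast

end
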